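(* Let $G$ be a locally compact second countable amenable group with right-invariant Haar measure and $(F_n)_{n\ge0}$ an admissible Følner sequence in $G$. Consider a measure-preserving action of $G$ on a measure space $(X,\mu)$ and let $$A_nf=\frac1{|F_n|}\int_{F_n}s.f\,ds,\qquad f\in L_1(X),$$ where $ds$ denotes integration against the right-invariant Haar measure. Then there is a constant $c>0$ such that for all $\lambda>0$ and $m>0$, $$\mu\{N_\lambda((A_nf)_{n\ge0})>m\}\le\frac c{\lambda\sqrt m}\|f\|_1,\qquad f\in L_1(X).$$
   Context: For a sequence $(f_n)_{n\ge0}$ of measurable functions on $X$, $\lambda>0$ and $x\in X$, the jump quantity $N_\lambda((f_n)_{n\ge0})(x)\in\{0,1,2,\dots\}\cup\{\infty\}$ is the supremum of the integers $N\geq 0$ for which there are indices $n_1<n_2<\dots<n_{N+1}$ with $|f_{n_i}(x)-f_{n_{i+1}}(x)|>\lambda$ for all $1\le i\le N$. The action of $G$ on $X$ is by $\mu$-preserving transformations, (jointly) measurable so that the averages make sense, and $s.f$ is the induced action on functions, $(s.f)(x)=f(s^{-1}x)$. Write $|E|$ for the right-invariant Haar measure of $E\subset G$. For $K\subset G$ compact, $\varepsilon>0$ and $E\subset G$ of finite measure: $E$ is $(\varepsilon,K)$-invariant if $|EK\setminus E|\le\varepsilon|E|$ and $|EK^{-1}\setminus E|\le\varepsilon|E|$; the $K$-boundary $\partial_K(E)$ is the union of all left translates $gK$ ($g\in G$) that intersect both $E$ and $G\setminus E$; $E$ is $(\varepsilon,K)$-boundary-invariant if $|\partial_K(E)|\le\varepsilon|E|$.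 A Følner sequence is a sequence $(F_n)_{n\ge0}$ of compact subsets of $G$ (of positive measure) such that for every $\varepsilon>0$ and compact $K\subset G$, $F_n$ is $(\varepsilon,K)$-boundary-invariant for all sufficiently large $n$; $G$ is amenable if it admits a Følner sequence. The (lower) Banach density of $E\subset G$ is $\underline{\mathrm B}(E)=\sup_{K}\inf_{g\in G}\frac{|gK\cap E|}{|gK|}$, the supremum being over compact subsets $K\subset G$ of positive measure. An atomic filtration $(\mathcal P_n)_{n\ge0}$ on $G$ is a sequence of partitions of $G$ into measurable sets (atoms) $A$ with $0<|A|<\infty$, such that for all $m'\ge n\ge0$ and $A\in\mathcal P_n$ there is $B\in\mathcal P_{m'}$ with $A\subset B$. A filtered Følner sequence is a triple $\mathcal S=((F_n)_{n\ge0},(B_n)_{n\ge0},(\mathcal P_n)_{n\ge0})$ where $(F_n)$ is a Følner sequence, $(B_n)$ is a sequence of compact subsets of $G$ and $(\mathcal P_n)$ is an atomic filtration on $G$ such that (i) for any $n\ge0$ and $A\in\mathcal P_n$ there is $\gamma\in G$ with $A\subset\gamma B_n$; (ii) for any $n\ge k$, $F_n$ is $(2^{k-n},B_k)$-boundary-invariant. An atom $A\in\mathcal P_k$ is admissible if $A$ is $(2^{n-k},F_n)$-invariant for every $n<k$; $\mathcal P_k^a$ is the family of admissible atoms of $\mathcal P_k$, and $\mathrm{Adm}(\mathcal S)=\bigcap_{k\ge0}\bigcup_{A\in\mathcal P_k^a}A$. $\mathcal S$ is admissible if $\underline{\mathrm B}(\mathrm{Adm}(\mathcal S))\ge1-c'$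 for some $c'\in(0,1)$. A Følner sequence is admissible if it can be completed into an admissible triple.
   Formalization: The measure space (X, μ) is assumed to be sigma-finite; for arbitrary measure spaces the averages need not be well defined on L_1(X) and the inequality can fail. *)

theory Defs
  imports "HOL-Analysis.Analysis" "HOL-Library.Set_Algebras" "HOL-Library.Disjoint_Sets"
    "HOL-Library.Extended_Nat"
begin

text \<open>
  The group is a type of class \<^class>\<open>topological_group_add\<close>.  This class is not assumed to be
  commutative; it is merely written additively: the product of g and h is g + h, the inverse of g
  is - g, the left translate of K by g is g +o K, the product set of E and K is E + K, and the
  set of inverses of K is uminus ` K.
\<close>

text \<open>
  Regularity is automatic for a Borel measure that is finite on compact sets, since
  the group is going to be locally compact, Hausdorff and second countable.
\<close>

definition right_haar_measure :: "'g::topological_group_add measure \<Rightarrow> bool" where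
  "right_haar_measure h \<longleftrightarrow>
     sets h = sets borel \<and>
     emeasure h UNIV \<noteq> 0 \<and>
     (\<forall>K. compact K \<longrightarrow> emeasure h K < \<infinity>) \<and>
     (\<forall>E\<in>sets borel. \<forall>g. emeasure h ((\<lambda>x. x + g) ` E) = emeasure h E)"

text \<open>
  The size of a set is taken to be its outer Haar measure.  It agrees with \<^const>\<open>emeasure\<close> on
  Borel sets.  A product E + K of a Borel set with a compact set need not be Borel, only analytic,
  so \<^const>\<open>emeasure\<close> could assign it the default value 0; on such sets the outer measure is the
  completed Haar measure.
\<close>

abbreviation haar_size :: "'g measure \<Rightarrow> 'g set \<Rightarrow> ennreal" where
  "haar_size h E \<equiv> outer_measure_of h E"

definition invariant_set ::
  "'g::topological_group_add measure \<Rightarrow> real \<Rightarrow> 'g set \<Rightarrow> 'g set \<Rightarrow> bool" where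
  "invariant_set h \<epsilon> K E \<longleftrightarrow>
     haar_size h ((E + K) - E) \<le> ennreal \<epsilon> * haar_size h E \<and>
     haar_size h ((E + uminus ` K) - E) \<le> ennreal \<epsilon> * haar_size h E"

definition K_boundary :: "'g::topological_group_add set \<Rightarrow> 'g set \<Rightarrow> 'g set" where
  "K_boundary K E = \<Union> {g +o K |g. (g +o K) \<inter> E \<noteq> {} \<and> (g +o K) \<inter> (- E) \<noteq> {}}"

definition boundary_invariant_set ::
  "'g::topological_group_add measure \<Rightarrow> real \<Rightarrow> 'g set \<Rightarrow> 'g set \<Rightarrow> bool" where
  "boundary_invariant_set h \<epsilon> K E \<longleftrightarrow>
     haar_size h (K_boundary K E) \<le> ennreal \<epsilon> * haar_size h E"

definition folner_sequence ::
  "'g::topological_group_add measure \<Rightarrow> (nat \<Rightarrow> 'g set) \<Rightarrow> bool" where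
  "folner_sequence h F \<longleftrightarrow>
     (\<forall>n. compact (F n) \<and> 0 < haar_size h (F n)) \<and>
     (\<forall>\<epsilon>>0. \<forall>K. compact K \<longrightarrow>
        (\<forall>\<^sub>F n in sequentially. boundary_invariant_set h \<epsilon> K (F n)))"

definition amenable :: "'g::topological_group_add measure \<Rightarrow> bool" where
  "amenable h \<longleftrightarrow> (\<exists>F. folner_sequence h F)"

definition lower_banach_density ::
  "'g::topological_group_add measure \<Rightarrow> 'g set \<Rightarrow> ennreal" where
  "lower_banach_density h E =
     (SUP K\<in>{K. compact K \<and> 0 < haar_size h K}.
        INF g. haar_size h ((g +o K) \<inter> E) / haar_size h (g +o K))"

definition atomic_filtration ::
  "'g::topological_group_add measure \<Rightarrow> (nat \<Rightarrow> 'g set set) \<Rightarrow> bool" where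
  "atomic_filtration h P \<longleftrightarrow>
     (\<forall>n. partition_on UNIV (P n)) \<and>
     (\<forall>n. \<forall>A\<in>P n. A \<in> sets h \<and> 0 < haar_size h A \<and> haar_size h A < \<infinity>) \<and>
     (\<forall>n m. n \<le> m \<longrightarrow> (\<forall>A\<in>P n. \<exists>B\<in>P m. A \<subseteq> B))"

definition filtered_folner_sequence ::
  "'g::topological_group_add measure \<Rightarrow> (nat \<Rightarrow> 'g set) \<Rightarrow> (nat \<Rightarrow> 'g set) \<Rightarrow>
     (nat \<Rightarrow> 'g set set) \<Rightarrow> bool" where
  "filtered_folner_sequence h F B P \<longleftrightarrow>
     folner_sequence h F \<and>
     (\<forall>n. compact (B n)) \<and>
     atomic_filtration h P \<and>
     (\<forall>n. \<forall>A\<in>P n. \<exists>g. A \<subseteq> g +o B n) \<and>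
     (\<forall>k n. k \<le> n \<longrightarrow> boundary_invariant_set h (2 powi (int k - int n)) (B k) (F n))"

definition admissible_atoms ::
  "'g::topological_group_add measure \<Rightarrow> (nat \<Rightarrow> 'g set) \<Rightarrow> (nat \<Rightarrow> 'g set set) \<Rightarrow> nat \<Rightarrow>
     'g set set" where
  "admissible_atoms h F P k =
     {A \<in> P k. \<forall>n<k. invariant_set h (2 powi (int n - int k)) (F n) A}"

definition Adm ::
  "'g::topological_group_add measure \<Rightarrow> (nat \<Rightarrow> 'g set) \<Rightarrow> (nat \<Rightarrow> 'g set set) \<Rightarrow> 'g set" where
  "Adm h F P = (\<Inter>k. \<Union> (admissible_atoms h F P k))"

definition admissible_triple ::
  "'g::topological_group_add measure \<Rightarrow> (nat \<Rightarrow> 'g set) \<Rightarrow> (nat \<Rightarrow> 'g set) \<Rightarrow>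
     (nat \<Rightarrow> 'g set set) \<Rightarrow> bool" where
  "admissible_triple h F B P \<longleftrightarrow>
     filtered_folner_sequence h F B P \<and>
     (\<exists>c'::real. 0 < c' \<and> c' < 1 \<and> lower_banach_density h (Adm h F P) \<ge> ennreal (1 - c'))"

definition admissible_folner_sequence ::
  "'g::topological_group_add measure \<Rightarrow> (nat \<Rightarrow> 'g set) \<Rightarrow> bool" where
  "admissible_folner_sequence h F \<longleftrightarrow>
     folner_sequence h F \<and> (\<exists>B P. admissible_triple h F B P)"

definition measure_preserving_action ::
  "'x measure \<Rightarrow> ('g::topological_group_add \<Rightarrow> 'x \<Rightarrow> 'x) \<Rightarrow> bool" where
  "measure_preserving_action M a \<longleftrightarrow>
     (\<lambda>(g, x). a g x) \<in> borel \<Otimes>\<^sub>M M \<rightarrow>\<^sub>M M \<and>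
     (\<forall>x\<in>space M. a 0 x = x) \<and>
     (\<forall>g h. \<forall>x\<in>space M. a (g + h) x = a g (a h x)) \<and>
     (\<forall>g. distr M M (a g) = M)"

definition ergodic_average ::
  "'g::topological_group_add measure \<Rightarrow> (nat \<Rightarrow> 'g set) \<Rightarrow> ('g \<Rightarrow> 'x \<Rightarrow> 'x) \<Rightarrow>
     nat \<Rightarrow> ('x \<Rightarrow> complex) \<Rightarrow> 'x \<Rightarrow> complex" where
  "ergodic_average h F a n f x =
     (1 / measure h (F n)) *\<^sub>R set_lebesgue_integral h (F n) (\<lambda>s. f (a (- s) x))"

text \<open>The indices \<open>n\<^sub>1 < \<dots> < n\<^bsub>N+1\<^esub>\<close> are numbered from 0 to N here.\<close>

definition jump_quantity :: "real \<Rightarrow> (nat \<Rightarrow> 'x \<Rightarrow> complex) \<Rightarrow> 'x \<Rightarrow> enat" where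
  "jump_quantity lam f x =
     Sup {enat N |N. \<exists>n::nat \<Rightarrow> nat. strict_mono_on {..N} n \<and>
            (\<forall>i<N. cmod (f (n i) x - f (n (Suc i)) x) > lam)}"

end

theory Submission
  imports Defs
begin

text \<open>
  An admissible atom is moved by an element of \<open>F\<^sub>n\<close> only by a small proportion of its size, so a
  product of a few elements of earlier sets \<open>F\<^sub>n\<close> and their inverses is a quotient of two points
  of one atom. Therefore \<open>F\<^sub>N\<close> is \<open>2\<^bsup>i+3-N\<^esup>\<close>-invariant under products of four elements of
  \<open>F\<^sub>n\<close> and their inverses, \<open>n \<le> i\<close>. This invariance is all that is used of the filtration.

  Let \<open>T\<^sub>n\<close> be the average over \<open>F\<^sub>n\<close> acting on functions on the group, so that \<open>T\<^sub>N T\<^sub>n\<close> and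
  \<open>T\<^sub>N T\<^sub>n\<^sup>*\<close> are close to \<open>T\<^sub>N\<close> for \<open>n < N\<close>. In \<open>L\<^sup>2\<close>, a random path that multiplies by independent
  uniform points of every tenth \<open>F\<^sub>n\<close> (from large to small \<open>n\<close>) carries a martingale that
  differs from the averages at the end point of the path only by a square summable error. The
  martingale obeys the jump inequality, because the squares of its increments between jump times
  have a bounded sum.

  For \<open>f\<close> in \<open>L\<^sup>1\<close>, going from large to small \<open>n\<close>, remove the mass of \<open>f\<close> from translates of
  \<open>F\<^sub>n\<close> on which its mean is large. For small \<open>n\<close> the averages of a removed piece \<open>b\<^sub>k\<close> vanish outside
  a small exceptional set, and for large \<open>n\<close> they agree up to a summable error with those of the
  smoothed piece \<open>T\<^sub>k\<^sub>+\<^sub>1\<^sup>*T\<^sub>k b\<^sub>k\<close>. The sum of the smoothed pieces has small \<open>L\<^sup>2\<close> norm, and leaving out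
  its large scales costs a monotone function of \<open>n\<close>, which has few jumps. The inequality on the
  group is transferred to the action along orbits.
\<close>

section \<open>Counting jumps\<close>

text \<open>\<open>F N\<close> is almost invariant only under multiplication from the right. So an
  average over \<open>F N\<close> absorbs a finer average applied before it, whereas a finer average
  applied after it produces left translates of \<open>F N\<close>, which are not controlled:
  \<open>T n (T N f)\<close> need not be close to \<open>T N f\<close>. It is the adjoint
  \<open>T' N\<close> that absorbs from the left. This one-sidedness dictates the order of the
  factors along the random path, the smoothing of a piece by a coarser adjoint, and the separate
  estimates for pieces below and above a level. A second asymmetry: right Haar measure does not
  preserve the left translates of \<open>F k\<close> that serve as covering sets. It scales them by
  a modular factor, which cancels in the means. The square root in the bound comes from the height
  \<open>\<beta> = lam * sqrt M\<close> at which mass is removed. The exceptional set costs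
  \<open>I / \<beta>\<close> and the jump inequality in L^2 costs a multiple of
  \<open>\<beta> * I / (lam^2 * M)\<close>, where \<open>I\<close> is the integral of
  \<open>f\<close>; this height makes the two equal.\<close>

fun jumps :: "real \<Rightarrow> (nat \<Rightarrow> 'a::real_normed_vector) \<Rightarrow> nat list \<Rightarrow> nat" where
  "jumps lam u (x # y # zs) = (if lam < norm (u x - u y) then 1 else 0) + jumps lam u (y # zs)"
| "jumps lam u _ = 0"

definition jump_chains :: "nat \<Rightarrow> nat list set" where
  "jump_chains L = {ns. sorted_wrt (<) ns \<and> set ns \<subseteq> {..L}}"

text \<open>In contrast to \<open>jump_quantity\<close>, a chain may contain steps that do not jump.
  This freedom allows the same chain to be used for a sum and for both summands, which gives
  \<open>jmax_add\<close>; the count can only become larger. The cutoff \<open>L\<close> leaves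
  finitely many chains.\<close>

definition jmax :: "real \<Rightarrow> nat \<Rightarrow> (nat \<Rightarrow> 'a::real_normed_vector) \<Rightarrow> nat" where
  "jmax lam L u = Max (jumps lam u ` jump_chains L)"

lemma finite_jump_chains: "finite (jump_chains L)"
proof (rule finite_subset)
  show "jump_chains L \<subseteq> {ns. set ns \<subseteq> {..L} \<and> distinct ns}"
    by (auto simp: jump_chains_def strict_sorted_iff)
  show "finite {ns. set ns \<subseteq> {..L} \<and> distinct ns}"
    by (rule finite_subset_distinct) simp
qed

lemma Nil_in_jump_chains: "[] \<in> jump_chains L"
  by (simp add: jump_chains_def)

lemma jump_chains_mono: "L \<le> L' \<Longrightarrow> jump_chains L \<subseteq> jump_chains L'"
  by (auto simp: jump_chains_def)

lemma jumps_le_jmax: "ns \<in> jump_chains L \<Longrightarrow> jumps lam u ns \<le> jmax lam L u"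
  unfolding jmax_def by (intro Max_ge) (auto simp: finite_jump_chains)

lemma jmax_leI: "(\<And>ns. ns \<in> jump_chains L \<Longrightarrow> jumps lam u ns \<le> N) \<Longrightarrow> jmax lam L u \<le> N"
  unfolding jmax_def using Nil_in_jump_chains[of L] by (subst Max_le_iff) (auto simp: finite_jump_chains)

lemma jmax_real_leI:
  "(\<And>ns. ns \<in> jump_chains L \<Longrightarrow> real (jumps lam u ns) \<le> c) \<Longrightarrow> real (jmax lam L u) \<le> c"
proof -
  assume *: "\<And>ns. ns \<in> jump_chains L \<Longrightarrow> real (jumps lam u ns) \<le> c"
  have "jmax lam L u \<in> jumps lam u ` jump_chains L"
    unfolding jmax_def using Nil_in_jump_chains[of L] by (intro Max_in) (auto simp: finite_jump_chains)
  then show ?thesis using * by auto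
qed

lemma jmax_mono_length: "L \<le> L' \<Longrightarrow> jmax lam L u \<le> jmax lam L' u"
  by (intro jmax_leI jumps_le_jmax) (use jump_chains_mono in blast)

lemma jumps_cong: "(\<And>n. n \<in> set ns \<Longrightarrow> u n = v n) \<Longrightarrow> jumps lam u ns = jumps lam v ns"
  by (induction lam u ns rule: jumps.induct) auto

lemma jmax_cong: "(\<And>n. n \<le> L \<Longrightarrow> u n = v n) \<Longrightarrow> jmax lam L u = jmax lam L v"
  unfolding jmax_def
  by (intro arg_cong[of _ _ Max] image_cong refl jumps_cong) (auto simp: jump_chains_def)

lemma jumps_add:
  "jumps (a + b) (\<lambda>n. u n + v n) ns \<le> jumps a u ns + jumps b v ns"
proof (induction a u ns rule: jumps.induct)
  case (1 a u x y zs)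
  have "norm (u x + v x - (u y + v y)) \<le> norm (u x - u y) + norm (v x - v y)"
    by (metis add_diff_add norm_triangle_ineq)
  then show ?case using 1 by auto
qed auto

lemma jmax_add:
  "jmax (a + b) L (\<lambda>n. u n + v n) \<le> jmax a L u + jmax b L v"
proof (rule jmax_leI)
  fix ns assume "ns \<in> jump_chains L"
  then show "jumps (a + b) (\<lambda>n. u n + v n) ns \<le> jmax a L u + jmax b L v"
    using jumps_add[of a b u v ns] jumps_le_jmax[of ns L a u] jumps_le_jmax[of ns L b v] by linarith
qed

lemma jumps_weaken:
  "(\<And>x y. a < norm (u x - u y) \<Longrightarrow> b < norm (v x - v y)) \<Longrightarrow> jumps a u ns \<le> jumps b v ns"
  by (induction ns rule: induct_list012) auto

lemma jmax_weaken:
  "(\<And>x y. a < norm (u x - u y) \<Longrightarrow> b < norm (v x - v y)) \<Longrightarrow> jmax a L u \<le> jmax b L v"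
  by (meson jmax_leI jumps_weaken jumps_le_jmax order_trans)

text \<open>The steps of a chain span disjoint intervals, so jumps that are each paid for by
  \<open>q\<close> on their own interval are paid for without overlap.\<close>

lemma jumps_interval:
  fixes q :: "nat \<Rightarrow> real"
  assumes q: "\<And>n. 0 \<le> q n"
    and "sorted_wrt (<) ns" "set ns \<subseteq> {..L}"
    and "\<And>m m'. m < m' \<Longrightarrow> m' \<le> L \<Longrightarrow> lam < norm (u m - u m') \<Longrightarrow> 1 \<le> (\<Sum>n=m..<m'. q n)"
  shows "real (jumps lam u ns) \<le> (if ns = [] then 0 else \<Sum>n=hd ns..<L. q n)"
  using assms(2-)
proof (induction ns rule: induct_list012)
  case (3 x y zs)
  have IH: "real (jumps lam u (y # zs)) \<le> (\<Sum>n=y..<L. q n)"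
    using 3(2) 3(3-) by auto
  have xy: "x < y" "y \<le> L" using 3 by auto
  have "(\<Sum>n=x..<L. q n) = (\<Sum>n=x..<y. q n) + (\<Sum>n=y..<L. q n)"
    using xy by (simp add: sum.atLeastLessThan_concat)
  moreover have "(if lam < norm (u x - u y) then 1 else 0) \<le> (\<Sum>n=x..<y. q n)"
    using 3(5)[of x y] xy q by (auto intro!: sum_nonneg)
  ultimately show ?case using IH by auto
qed (auto intro!: sum_nonneg q)

lemma jmax_interval:
  fixes q :: "nat \<Rightarrow> real"
  assumes q: "\<And>n. 0 \<le> q n"
    and "\<And>m m'. m < m' \<Longrightarrow> m' \<le> L \<Longrightarrow> lam < norm (u m - u m') \<Longrightarrow> 1 \<le> (\<Sum>n=m..<m'. q n)"
  shows "real (jmax lam L u) \<le> (\<Sum>n<L. q n)"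
proof (rule jmax_real_leI)
  fix ns assume "ns \<in> jump_chains L"
  then have "real (jumps lam u ns) \<le> (if ns = [] then 0 else \<Sum>n=hd ns..<L. q n)"
    by (intro jumps_interval assms) (auto simp: jump_chains_def)
  also have "\<dots> \<le> (\<Sum>n<L. q n)"
    by (auto intro!: sum_nonneg q sum_mono2)
  finally show "real (jumps lam u ns) \<le> (\<Sum>n<L. q n)" .
qed

text \<open>A jump is paid for at its two end points, and an index belongs to at most two steps of a
  chain, hence the factor 2. The subtracted term records that the head belongs to one step only; the
  induction needs this credit.\<close>

lemma jumps_pointwise:
  fixes c :: "nat \<Rightarrow> real"
  assumes c: "\<And>n. 0 \<le> c n"
    and "sorted_wrt (<) ns"
    and "\<And>m m'. lam < norm (u m - u m') \<Longrightarrow> 1 \<le> c m + c m'"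
  shows "real (jumps lam u ns) \<le> 2 * (\<Sum>n\<in>set ns. c n) - (if ns = [] then 0 else c (hd ns))"
  using assms(2-)
proof (induction ns rule: induct_list012)
  case (3 x y zs)
  have IH: "real (jumps lam u (y # zs)) \<le> 2 * (\<Sum>n\<in>set (y # zs). c n) - c y"
    using 3(2) 3(3-) by auto
  have "x \<notin> set (y # zs)" using 3 by auto
  then have "(\<Sum>n\<in>set (x # y # zs). c n) = c x + (\<Sum>n\<in>set (y # zs). c n)" by simp
  moreover have "(if lam < norm (u x - u y) then 1 else 0) \<le> c x + c y"
    using 3(4)[of x y] c by auto
  ultimately show ?case using IH by (auto simp del: list.set)
qed (auto simp: c)

lemma jmax_pointwise:
  fixes c :: "nat \<Rightarrow> real"
  assumes c: "\<And>n. 0 \<le> c n"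
    and "\<And>m m'. lam < norm (u m - u m') \<Longrightarrow> 1 \<le> c m + c m'"
  shows "real (jmax lam L u) \<le> 2 * (\<Sum>n\<le>L. c n)"
proof (rule jmax_real_leI)
  fix ns assume ns: "ns \<in> jump_chains L"
  then have "real (jumps lam u ns) \<le> 2 * (\<Sum>n\<in>set ns. c n) - (if ns = [] then 0 else c (hd ns))"
    by (intro jumps_pointwise assms) (auto simp: jump_chains_def)
  also have "\<dots> \<le> 2 * (\<Sum>n\<in>set ns. c n)" using c by auto
  also have "\<dots> \<le> 2 * (\<Sum>n\<le>L. c n)"
    using ns by (intro mult_left_mono sum_mono2 c) (auto simp: jump_chains_def)
  finally show "real (jumps lam u ns) \<le> 2 * (\<Sum>n\<le>L. c n)" .
qed

lemma jmax_abs_sum: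
  assumes a: "0 < (a::real)"
  shows "real (jmax a L u) \<le> 2 / a * (\<Sum>n\<le>L. norm (u n))"
proof -
  have "real (jmax a L u) \<le> 2 * (\<Sum>n\<le>L. norm (u n) / a)"
  proof (rule jmax_pointwise)
    show "0 \<le> norm (u n) / a" for n using a by simp
    show "1 \<le> norm (u m) / a + norm (u m') / a" if "a < norm (u m - u m')" for m m'
      using that norm_triangle_ineq4[of "u m" "u m'"] a by (simp add: field_simps)
  qed
  then show ?thesis by (simp add: sum_divide_distrib[symmetric])
qed

lemma jmax_square_sum:
  fixes u :: "nat \<Rightarrow> real"
  assumes a: "0 < (a::real)"
  shows "real (jmax a L u) \<le> 4 / a\<^sup>2 * (\<Sum>n\<le>L. (u n)\<^sup>2)"
proof -
  have "real (jmax a L u) \<le> 2 * (\<Sum>n\<le>L. 2 * (u n)\<^sup>2 / a\<^sup>2)"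
  proof (rule jmax_pointwise)
    show "0 \<le> 2 * (u n)\<^sup>2 / a\<^sup>2" for n using a by simp
    show "1 \<le> 2 * (u m)\<^sup>2 / a\<^sup>2 + 2 * (u m')\<^sup>2 / a\<^sup>2" if "a < norm (u m - u m')" for m m'
    proof -
      have "a\<^sup>2 \<le> (u m - u m')\<^sup>2" using that a by (auto intro!: abs_le_square_iff[THEN iffD1])
      also have "\<dots> \<le> 2 * (u m)\<^sup>2 + 2 * (u m')\<^sup>2"
        using zero_le_power2[of "u m + u m'"] by (simp add: power2_eq_square algebra_simps)
      finally show ?thesis using a by (simp add: field_simps)
    qed
  qed
  then show ?thesis by (simp add: sum_distrib_left sum_divide_distrib)
qed

text \<open>The drops over disjoint intervals add up to at most the total drop.\<close>

lemma jmax_monotone: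
  fixes v :: "nat \<Rightarrow> real"
  assumes a: "0 < (a::real)" and dec: "\<And>n. v (Suc n) \<le> v n" and v: "\<And>n. 0 \<le> v n" "v 0 \<le> V"
  shows "real (jmax a L v) \<le> V / a"
proof -
  have tele: "(\<Sum>n=m..<m'. v n - v (Suc n)) = v m - v m'" if "m \<le> m'" for m m'
    using that by (induction m' rule: dec_induct) auto
  have mono: "v m' \<le> v m" if "m \<le> m'" for m m'
    using that by (induction m' rule: dec_induct) (auto intro: order_trans[OF dec])
  have "real (jmax a L v) \<le> (\<Sum>n<L. (v n - v (Suc n)) / a)"
  proof (rule jmax_interval)
    show "0 \<le> (v n - v (Suc n)) / a" for n using a dec[of n] by simp
    show "1 \<le> (\<Sum>n=m..<m'. (v n - v (Suc n)) / a)" if "m < m'" "a < norm (v m - v m')" for m m'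
      using tele[of m m'] mono[of m m'] that a
      by (simp add: sum_divide_distrib[symmetric] field_simps)
  qed
  also have "\<dots> = (v 0 - v L) / a"
    using tele[of 0 L] by (simp add: sum_divide_distrib[symmetric] atLeast0LessThan)
  also have "\<dots> \<le> V / a" using a v(1)[of L] v(2) by (intro divide_right_mono) auto
  finally show ?thesis .
qed

section \<open>Measurability of the counts and comparison with the jump quantity\<close>

lemma measurable_jumps [measurable]:
  fixes u :: "'x \<Rightarrow> nat \<Rightarrow> 'a::{real_normed_vector, second_countable_topology}"
  assumes [measurable]: "\<And>n. (\<lambda>x. u x n) \<in> borel_measurable M"
  shows "(\<lambda>x. jumps lam (u x) ns) \<in> measurable M (count_space UNIV)"
  by (induction ns rule: induct_list012) auto

lemma measurable_jmax [measurable (raw)]: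
  fixes u :: "'x \<Rightarrow> nat \<Rightarrow> 'a::{real_normed_vector, second_countable_topology}"
  assumes [measurable]: "\<And>n. (\<lambda>x. u x n) \<in> borel_measurable M"
  shows "(\<lambda>x. jmax lam L (u x)) \<in> measurable M (count_space UNIV)"
proof -
  have "(\<lambda>x. jmax lam L (u x)) = (\<lambda>x. Max ((\<lambda>ns. jumps lam (u x) ns) ` jump_chains L))"
    by (simp add: jmax_def)
  moreover have "(\<lambda>x. Max ((\<lambda>ns. jumps lam (u x) ns) ` A)) \<in> measurable M (count_space UNIV)"
    if "finite A" "A \<noteq> {}" for A
    using that
  proof (induction A rule: finite_ne_induct)
    case (insert ns A)
    have [measurable]: "(\<lambda>x. Max ((\<lambda>ns. jumps lam (u x) ns) ` A)) \<in> measurable M (count_space UNIV)"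
      by (rule insert.IH)
    have "(\<lambda>x. max (jumps lam (u x) ns) (Max ((\<lambda>ns. jumps lam (u x) ns) ` A)))
        \<in> measurable M (count_space UNIV)"
      by measurable
    then show ?case using insert by simp
  qed simp
  ultimately show ?thesis
    using finite_jump_chains[of L] Nil_in_jump_chains[of L] by auto
qed

lemma jumps_all:
  "(\<And>i. Suc i < length ns \<Longrightarrow> lam < norm (u (ns ! i) - u (ns ! Suc i))) \<Longrightarrow>
     jumps lam u ns = length ns - 1"
proof (induction ns rule: induct_list012)
  case (3 x y zs)
  have "lam < norm (u x - u y)" using 3(3)[of 0] by simp
  moreover have "jumps lam u (y # zs) = length (y # zs) - 1"
    using 3(3)[of "Suc _"] by (intro 3(2)) auto
  ultimately show ?case by simp
qed auto

text \<open>An infinite supremum is not attained, so the witness is found indirectly: if all lengths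
  were at most \<open>m\<close>, the supremum would be at most the integer part of
  \<open>m\<close>.\<close>

lemma jump_quantity_less:
  assumes "ereal m < ereal_of_enat (jump_quantity lam f x)" "0 \<le> m"
  shows "\<exists>L. m < real (jmax lam L (\<lambda>n. f n x))"
proof -
  define S where "S = {enat N |N. \<exists>n::nat \<Rightarrow> nat. strict_mono_on {..N} n \<and>
            (\<forall>i<N. cmod (f (n i) x - f (n (Suc i)) x) > lam)}"
  have "\<exists>e\<in>S. ereal m < ereal_of_enat e"
  proof (rule ccontr)
    assume "\<not> ?thesis"
    then have *: "\<And>e. e \<in> S \<Longrightarrow> ereal_of_enat e \<le> ereal m" by (auto simp: not_less)
    have "e \<le> enat (nat \<lfloor>m\<rfloor>)" if "e \<in> S" for e
      using *[OF that] assms(2) by (cases e) (auto simp: le_nat_floor)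
    then have "Sup S \<le> enat (nat \<lfloor>m\<rfloor>)" by (rule Sup_least)
    then have "ereal_of_enat (Sup S) \<le> ereal_of_enat (enat (nat \<lfloor>m\<rfloor>))"
      by (simp only: ereal_of_enat_le_iff)
    also have "\<dots> \<le> ereal m" using assms(2) by (simp add: of_nat_floor)
    finally show False using assms(1) by (simp add: jump_quantity_def S_def)
  qed
  then obtain N n where N: "ereal m < ereal_of_enat (enat N)"
    and n: "strict_mono_on {..N} (n :: nat \<Rightarrow> nat)"
    and j: "\<And>i. i < N \<Longrightarrow> lam < cmod (f (n i) x - f (n (Suc i)) x)"
    by (auto simp: S_def)
  define ns where "ns = map n [0..<Suc N]"
  have nth: "ns ! i = n i" if "i < Suc N" for i
    using that unfolding ns_def by (simp add: nth_map_upt del: upt_Suc)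
  have len: "length ns = Suc N" by (simp add: ns_def)
  have "sorted_wrt (<) ns"
    using n by (auto simp: sorted_wrt_iff_nth_less len nth strict_mono_on_def)
  moreover have "set ns \<subseteq> {..n N}"
    using n by (auto simp: ns_def strict_mono_on_def) (metis atMost_iff le_refl less_imp_le nat_less_le)
  ultimately have "ns \<in> jump_chains (n N)" by (simp add: jump_chains_def)
  moreover have "jumps lam (\<lambda>n. f n x) ns = N"
    using j by (subst jumps_all) (auto simp: len nth)
  ultimately have "N \<le> jmax lam (n N) (\<lambda>n. f n x)" using jumps_le_jmax by metis
  then show ?thesis using N by (intro exI[of _ "n N"]) auto
qed

section \<open>Almost orthogonality in an abstract inner product space\<close>

text \<open>Definiteness is left out for two reasons: functions that agree almost everywhere are not
  identified, and the locale is also instantiated with defect forms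
  \<open>B x y - B (P x) (P y)\<close>, which vanish on vectors whose norm \<open>P\<close>
  preserves.\<close>

locale semi_inner =
  fixes B :: "'v::real_vector \<Rightarrow> 'v \<Rightarrow> real"
  assumes B_add: "B (x + y) z = B x z + B y z"
    and B_scale: "B (c *\<^sub>R x) z = c * B x z"
    and B_sym: "B x y = B y x"
    and B_pos: "0 \<le> B x x"
begin

definition N :: "'v \<Rightarrow> real" where "N x = sqrt (B x x)"

lemma B_add_right: "B z (x + y) = B z x + B z y"
  using B_add B_sym by metis

lemma B_scale_right: "B z (c *\<^sub>R x) = c * B z x"
  using B_scale B_sym by metis

lemma B_minus: "B (- x) z = - B x z"
  using B_scale[of "-1" x z] by simp

lemma B_diff: "B (x - y) z = B x z - B y z"
  using B_add[of x "- y" z] B_minus[of y z] by simp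

lemma B_diff_right: "B z (x - y) = B z x - B z y"
  using B_diff B_sym by metis

lemma B_zero: "B 0 z = 0"
  using B_scale[of 0 0 z] by simp

lemma N_nonneg [simp]: "0 \<le> N x"
  by (simp add: N_def B_pos)

lemma N_square: "(N x)\<^sup>2 = B x x"
  by (simp add: N_def B_pos)

lemma Cauchy_Schwarz: "\<bar>B x y\<bar> \<le> N x * N y"
proof -
  have quad: "0 \<le> t\<^sup>2 * B x x + 2 * t * s * B x y + s\<^sup>2 * B y y" for t s
  proof -
    have "0 \<le> B (t *\<^sub>R x + s *\<^sub>R y) (t *\<^sub>R x + s *\<^sub>R y)" by (rule B_pos)
    also have "\<dots> = t\<^sup>2 * B x x + 2 * t * s * B x y + s\<^sup>2 * B y y"
      by (simp add: B_add B_add_right B_scale B_scale_right B_sym[of y x] power2_eq_square algebra_simps)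
    finally show ?thesis .
  qed
  have "(B x y)\<^sup>2 \<le> B x x * B y y"
  proof (cases "B y y = 0")
    case True
    have "B x y = 0"
    proof (rule ccontr)
      assume n: "B x y \<noteq> 0"
      show False
        \<comment> \<open>For this value of \<open>s\<close> the quadratic expression, linear in
          \<open>s\<close> because \<open>B y y = 0\<close>, equals -1.\<close>
        using quad[of 1 "- (B x x + 1) / (2 * B x y)"] n True by (simp add: field_simps)
    qed
    then show ?thesis using True by simp
  next
    case False
    then have p: "0 < B y y" using B_pos[of y] by simp
    have "0 \<le> B y y * (B x x * B y y - (B x y)\<^sup>2)"
      using quad[of "B y y" "- B x y"] by (simp add: power2_eq_square algebra_simps)
    then show ?thesis using p by (simp add: zero_le_mult_iff)
  qed
  then have "sqrt ((B x y)\<^sup>2) \<le> sqrt (B x x * B y y)" by (rule real_sqrt_le_mono)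
  then show ?thesis by (simp add: N_def real_sqrt_mult)
qed

lemma B_le: "B x y \<le> N x * N y"
  using Cauchy_Schwarz[of x y] by linarith

lemma N_triangle: "N (x + y) \<le> N x + N y"
proof (rule power2_le_imp_le)
  have "(N (x + y))\<^sup>2 = (N x)\<^sup>2 + 2 * B x y + (N y)\<^sup>2"
    by (simp add: N_square B_add B_add_right B_sym[of y x])
  also have "\<dots> \<le> (N x + N y)\<^sup>2"
    using B_le[of x y] by (simp add: power2_eq_square algebra_simps)
  finally show "(N (x + y))\<^sup>2 \<le> (N x + N y)\<^sup>2" .
qed simp

lemma N_minus: "N (- x) = N x"
  by (simp add: N_def B_minus B_sym[of x "- x"])

lemma N_diff: "N (x - y) \<le> N x + N y"
  using N_triangle[of x "- y"] by (simp add: N_minus)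

lemma N_commute: "N (x - y) = N (y - x)"
  using N_minus[of "x - y"] by simp

lemma N_diff_ge: "N x - N y \<le> N (x - y)"
  using N_triangle[of "x - y" y] by simp

lemma N_zero: "N 0 = 0"
  by (simp add: N_def B_zero)

lemma N_sum: "N (sum f I) \<le> (\<Sum>i\<in>I. N (f i))"
  by (induction I rule: infinite_finite_induct) (auto simp: N_zero intro: order_trans[OF N_triangle])

text \<open>Testing with \<open>y = x\<close> is enough. Through this duality bounds pass from an
  operator to its adjoint.\<close>

lemma N_leI: "(\<And>y. B x y \<le> c * N y) \<Longrightarrow> 0 \<le> c \<Longrightarrow> N x \<le> c"
proof -
  assume *: "\<And>y. B x y \<le> c * N y" and c: "0 \<le> c"
  show "N x \<le> c"
  proof (cases "N x = 0")
    case False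
    then have "0 < N x" using N_nonneg[of x] by linarith
    moreover have "N x * N x \<le> c * N x" using *[of x] N_square[of x] by (simp add: power2_eq_square)
    ultimately show ?thesis by simp
  qed (use c in simp)
qed

lemma adjoint_contraction:
  assumes adj: "\<And>x y. B (T x) y = B x (T' y)" and contr: "\<And>x. N (T x) \<le> N x"
  shows "N (T' y) \<le> N y"
proof (rule N_leI)
  fix z
  have "B (T' y) z = B (T z) y" by (metis adj B_sym)
  also have "\<dots> \<le> N (T z) * N y" by (rule B_le)
  also have "\<dots> \<le> N y * N z" using contr[of z] by (simp add: mult.commute mult_left_mono)
  finally show "B (T' y) z \<le> N y * N z" .
qed simp

end

lemma semi_inner_defect:
  assumes "semi_inner B" and lin: "linear P" and contr: "\<And>x. semi_inner.N B (P x) \<le> semi_inner.N B x"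
  shows "semi_inner (\<lambda>x y. B x y - B (P x) (P y))"
proof -
  interpret semi_inner B by fact
  show ?thesis
  proof
    show "0 \<le> B x x - B (P x) (P x)" for x
      using power_mono[OF contr[of x], of 2] by (simp add: N_square)
    show "B x y - B (P x) (P y) = B y x - B (P y) (P x)" for x y
      using B_sym by metis
  qed (auto simp: linear_add[OF lin] linear_scale[OF lin] B_add B_scale algebra_simps)
qed

lemma sum_geometric_sixteenth: "(\<Sum>t<l. (1/16::real) ^ (l - t)) \<le> 1 / 15"
proof (induction l)
  case (Suc l)
  have "(\<Sum>t<Suc l. (1/16::real) ^ (Suc l - t)) = (\<Sum>t<l. 1/16 * (1/16::real) ^ (l - t)) + 1/16"
    by (simp add: Suc_diff_le)
  then show ?case using Suc by (simp only: sum_distrib_left[symmetric])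
qed simp

definition ndist :: "nat \<Rightarrow> nat \<Rightarrow> nat" where
  "ndist j k = (if k \<le> j then j - k else k - j)"

lemma ndist_commute: "ndist j k = ndist k j"
  by (auto simp: ndist_def)

lemma sum_half_ndist: "(\<Sum>k\<le>K. (1/2::real) ^ ndist j k) \<le> 3"
proof -
  have low: "(\<Sum>k<m. (1/2::real) ^ (m - k)) \<le> 1" for m
  proof (induction m)
    case (Suc m)
    have "(\<Sum>t<Suc m. (1/2::real) ^ (Suc m - t)) = (\<Sum>t<m. 1/2 * (1/2::real) ^ (m - t)) + 1/2"
      by (simp add: Suc_diff_le)
    then show ?case using Suc by (simp only: sum_distrib_left[symmetric])
  qed simp
  have high: "(\<Sum>k=j..<m. (1/2::real) ^ (k - j)) \<le> 2 - (1/2)^(m - j) * 2" if "j \<le> m" for m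
    using that by (induction m rule: dec_induct) (auto simp: Suc_diff_le)
  have "(\<Sum>k\<le>K. (1/2::real) ^ ndist j k) \<le> (\<Sum>k\<in>{..<j} \<union> {j..<Suc (max j K)}. (1/2::real) ^ ndist j k)"
    by (intro sum_mono2) auto
  also have "\<dots> = (\<Sum>k<j. (1/2::real) ^ (j - k)) + (\<Sum>k=j..<Suc (max j K). (1/2::real) ^ (k - j))"
    by (subst sum.union_disjoint)
      (auto simp: ndist_def intro!: arg_cong2[of _ _ _ _ "(+)"] sum.cong)
  also have "\<dots> \<le> 1 + (2 - (1/2)^(Suc (max j K) - j) * 2)"
    by (intro add_mono low high) auto
  also have "\<dots> \<le> 3" by simp
  finally show ?thesis .
qed

text \<open>Schur's test for the kernel 2^-|j-k|, whose row and column sums are at most 3.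
  Cauchy-Schwarz is applied after splitting the kernel into two square roots.\<close>

lemma sum_convolution_square:
  fixes D :: "nat \<Rightarrow> real"
  shows "(\<Sum>j\<le>K. (\<Sum>k\<le>K. (1/2) ^ ndist j k * D k)\<^sup>2) \<le> 9 * (\<Sum>k\<le>K. (D k)\<^sup>2)"
proof -
  have "(\<Sum>k\<le>K. (1/2) ^ ndist j k * D k)\<^sup>2 \<le> 3 * (\<Sum>k\<le>K. (1/2) ^ ndist j k * (D k)\<^sup>2)" for j
  proof -
    have "(\<Sum>k\<le>K. (1/2) ^ ndist j k * D k)
        = (\<Sum>k\<le>K. sqrt ((1/2) ^ ndist j k) * (sqrt ((1/2) ^ ndist j k) * D k))"
      by (intro sum.cong refl) (simp add: mult.assoc[symmetric] flip: real_sqrt_mult)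
    also have "\<dots>\<^sup>2 \<le> (\<Sum>k\<le>K. (sqrt ((1/2) ^ ndist j k))\<^sup>2) * (\<Sum>k\<le>K. (sqrt ((1/2) ^ ndist j k) * D k)\<^sup>2)"
      by (rule Cauchy_Schwarz_ineq_sum)
    also have "\<dots> = (\<Sum>k\<le>K. (1/2) ^ ndist j k) * (\<Sum>k\<le>K. (1/2) ^ ndist j k * (D k)\<^sup>2)"
      by (simp add: power_mult_distrib)
    also have "\<dots> \<le> 3 * (\<Sum>k\<le>K. (1/2) ^ ndist j k * (D k)\<^sup>2)"
      by (intro mult_right_mono sum_half_ndist sum_nonneg) auto
    finally show ?thesis .
  qed
  then have "(\<Sum>j\<le>K. (\<Sum>k\<le>K. (1/2) ^ ndist j k * D k)\<^sup>2)
      \<le> (\<Sum>j\<le>K. 3 * (\<Sum>k\<le>K. (1/2) ^ ndist j k * (D k)\<^sup>2))"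
    by (intro sum_mono)
  also have "\<dots> = 3 * (\<Sum>k\<le>K. (\<Sum>j\<le>K. (1/2) ^ ndist k j) * (D k)\<^sup>2)"
    by (subst sum_distrib_left[symmetric], subst sum.swap) (simp add: sum_distrib_right ndist_commute)
  also have "\<dots> \<le> 3 * (\<Sum>k\<le>K. 3 * (D k)\<^sup>2)"
    by (intro mult_left_mono sum_mono mult_right_mono sum_half_ndist) auto
  finally show ?thesis by (simp add: sum_distrib_left)
qed

text \<open>\<open>P j\<close> is an average at level \<open>j\<close> and \<open>Q j\<close> its
  adjoint. A coarse level absorbs a finer one, or the adjoint of a finer one, that is applied before
  it. The rate 1/64 leaves room for the losses down to 1/4 in \<open>A_absorb\<close> and to 1/2 in
  \<open>piece_low\<close>.\<close>

locale absorbing = semi_inner B for B :: "'v::real_vector \<Rightarrow> 'v \<Rightarrow> real" +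
  fixes P Q :: "nat \<Rightarrow> 'v \<Rightarrow> 'v"
  assumes linear_P: "linear (P j)" and linear_Q: "linear (Q j)"
    and contr_P: "N (P j x) \<le> N x"
    and adj: "B (P j x) y = B x (Q j y)"
    and PP: "i < j \<Longrightarrow> N (P j (P i x) - P j x) \<le> (1/64) ^ (j - i) * N x"
    and PQ: "i < j \<Longrightarrow> N (P j (Q i x) - P j x) \<le> (1/64) ^ (j - i) * N x"
begin

text \<open>All levels below \<open>j\<close>, the finest applied first. Along the random path
  constructed later, \<open>A j g\<close> gives the conditional expectation of \<open>g\<close> at
  level \<open>j\<close>. \<open>Aad\<close> is the adjoint, with the factors in reverse
  order.\<close>

primrec A :: "nat \<Rightarrow> 'v \<Rightarrow> 'v" where
  "A 0 x = x"
| "A (Suc j) x = P j (A j x)"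

primrec Aad :: "nat \<Rightarrow> 'v \<Rightarrow> 'v" where
  "Aad 0 x = x"
| "Aad (Suc j) x = Aad j (Q j x)"

lemma linear_A: "linear (A j)"
proof (induction j)
  case (Suc j)
  then show ?case using linear_compose[OF Suc linear_P[of j]] by (simp add: o_def)
qed (simp add: linear_iff)

lemma linear_Aad: "linear (Aad j)"
proof (induction j)
  case (Suc j)
  then show ?case using linear_compose[OF linear_Q[of j] Suc] by (simp add: o_def)
qed (simp add: linear_iff)

lemma contr_Q: "N (Q j x) \<le> N x"
  using adjoint_contraction[OF adj contr_P] .

lemma contr_A: "N (A j x) \<le> N x"
  by (induction j) (auto intro: order_trans[OF contr_P])

lemma contr_Aad: "N (Aad j x) \<le> N x"
  by (induction j arbitrary: x) (auto intro: order_trans[OF _ contr_Q])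

lemma adj_A: "B (A j x) y = B x (Aad j y)"
  by (induction j arbitrary: y) (auto simp: adj)

text \<open>The last factor \<open>P l\<close> of \<open>A n\<close> (\<open>n = Suc l\<close>)
  swallows the earlier factors one at a time, see \<open>chain\<close>. So \<open>A n w\<close> is
  \<open>P l w\<close> up to errors \<open>(1/64) ^ (l - t)\<close> times the norms of the shorter
  products \<open>A t w\<close>, which the induction controls.\<close>

lemma A_absorb:
  assumes lin: "linear Y" and contr: "\<And>x. N (Y x) \<le> N x" and c: "1 \<le> c"
    and Y: "\<And>k x. m < k \<Longrightarrow> N (P k (Y x) - P k x) \<le> c * (1/64) ^ (k - m) * N x"
  shows "N (A n (Y x) - A n x) \<le> 8 * c * 4^m / 4^n * N x"
proof -
  define w where "w = Y x - x"
  have wle: "N w \<le> 2 * N x" using N_diff[of "Y x" x] contr[of x] by (simp add: w_def)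
  have chain: "N (P l (A i w)) \<le> N (P l w) + (\<Sum>t<i. (1/64) ^ (l - t) * N (A t w))" if "i \<le> l" for l i
    using that
  proof (induction i)
    case (Suc i)
    have "N (P l (A (Suc i) w)) \<le> N (P l (P i (A i w)) - P l (A i w)) + N (P l (A i w))"
      using N_triangle[of "P l (P i (A i w)) - P l (A i w)" "P l (A i w)"] by simp
    then show ?case using Suc PP[of i l "A i w"] by simp
  qed simp
  have "N (A n w) \<le> 8 * c * 4^m / 4^n * N x"
  proof (induction n rule: less_induct)
    case (less n)
    show ?case
    proof (cases "n \<le> Suc m")
      \<comment> \<open>The claimed bound is at least \<open>2 * N x\<close> here, so contraction
        suffices.\<close>
      case True
      have "N (A n w) \<le> 2 * N x" using contr_A[of n w] wle by linarith
      also have "\<dots> \<le> 8 * c * 4^m / 4^n * N x"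
      proof (intro mult_right_mono)
        have "(4::real)^n \<le> 4 ^ Suc m" using True by (intro power_increasing) auto
        also have "\<dots> \<le> 4 * c * 4 ^ m" using c by simp
        finally show "2 \<le> 8 * c * 4^m / 4^n" by (simp add: field_simps)
      qed simp
      finally show ?thesis .
    next
      case False
      then obtain l where l: "n = Suc l" "m < l" by (cases n) auto
      have "N (A n w) \<le> N (P l w) + (\<Sum>t<l. (1/64) ^ (l - t) * N (A t w))"
        using chain[of l l] l by simp
      also have "N (P l w) \<le> c * (1/64) ^ (l - m) * N x"
        using Y[OF l(2), of x] by (simp add: w_def linear_diff[OF linear_P])
      also have "(1/64::real) ^ (l - m) \<le> (1/4) ^ (l - m)" by (intro power_mono) auto
      also have "(1/4::real) ^ (l - m) = 4^m / 4^l"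
        using l by (simp add: power_diff power_one_over)
      also have "(\<Sum>t<l. (1/64) ^ (l - t) * N (A t w))
          \<le> (\<Sum>t<l. 8 * c * 4^m / 4^l * N x * (1/16) ^ (l - t))"
      proof (intro sum_mono)
        fix t assume t: "t \<in> {..<l}"
        have "(1/64::real) ^ (l - t) * N (A t w) \<le> (1/64::real) ^ (l - t) * (8 * c * 4^m / 4^t * N x)"
          using t l less.IH[of t] by (intro mult_left_mono) auto
        also have "\<dots> = 8 * c * 4^m / 4^l * N x * (1/16) ^ (l - t)"
        proof -
          have "(1/64::real) ^ (l - t) = (1/4) ^ (l - t) * (1/16) ^ (l - t)"
            by (simp flip: power_mult_distrib)
          also have "(1/4::real) ^ (l - t) = 4^t / 4^l"
            using t by (simp add: power_diff power_one_over)
          finally show ?thesis by simp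
        qed
        finally show "(1/64) ^ (l - t) * N (A t w) \<le> 8 * c * 4^m / 4^l * N x * (1/16) ^ (l - t)" .
      qed
      also have "\<dots> = 8 * c * 4^m / 4^l * N x * (\<Sum>t<l. (1/16) ^ (l - t))"
        by (simp add: sum_distrib_left)
      also have "\<dots> \<le> 8 * c * 4^m / 4^l * N x * (1 / 15)"
        using c by (intro mult_left_mono sum_geometric_sixteenth) auto
      \<comment> \<open>In units of \<open>c * 4^m / 4^l * N x\<close> the two contributions are 1
        and 8/15. Since \<open>4^n = 4 * 4^l\<close>, the target allows 8/4 = 2.\<close>
      also have "c * (4^m / 4^l) * N x + 8 * c * 4^m / 4^l * N x * (1 / 15) = (23/15) * c * 4^m / 4^l * N x"
        by (simp add: field_simps)
      also have "\<dots> \<le> 8 * c * 4^m / 4^n * N x"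
      proof -
        have "(23/15) * c * 4^m \<le> 2 * c * 4^m" using c by simp
        then have "(23/15) * c * 4^m / 4^l \<le> 2 * c * 4^m / 4^l" by (intro divide_right_mono) auto
        also have "\<dots> = 8 * c * 4^m / 4^n" using l by simp
        finally show ?thesis by (intro mult_right_mono) auto
      qed
      finally show ?thesis using c by (simp add: mult_right_mono)
    qed
  qed
  then show ?thesis by (simp add: w_def linear_diff[OF linear_A])
qed

lemma A_absorb_Q: "N (A n (Q i x) - A n x) \<le> 8 * 4^i / 4^n * N x"
  using A_absorb[OF linear_Q[of i] contr_Q, of 1 i n x] PQ[of i] by simp

text \<open>The factors \<open>Q i\<close> are absorbed one after another; 8/3 is the constant for
  which the geometric series closes, as 8/3 + 8 = 4 * (8/3).\<close>

lemma absorb_Aad: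
  assumes contr: "\<And>x. N (Y x) \<le> N x"
    and Y: "\<And>i x. i < n \<Longrightarrow> N (Y (Q i x) - Y x) \<le> 8 * 4^i / 4^n * N x"
    and k: "k \<le> n"
  shows "N (Y (Aad k x) - Y x) \<le> 8 / 3 * 4^k / 4^n * N x"
  using k
proof (induction k arbitrary: x)
  case (Suc k)
  have "N (Y (Aad (Suc k) x) - Y x) \<le> N (Y (Aad k (Q k x)) - Y (Q k x)) + N (Y (Q k x) - Y x)"
    using N_triangle[of "Y (Aad k (Q k x)) - Y (Q k x)" "Y (Q k x) - Y x"] by simp
  also have "\<dots> \<le> 8 / 3 * 4^k / 4^n * N (Q k x) + 8 * 4^k / 4^n * N x"
    using Suc by (intro add_mono Y Suc.IH) auto
  also have "\<dots> \<le> 8 / 3 * 4^k / 4^n * N x + 8 * 4^k / 4^n * N x"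
    by (intro add_mono mult_left_mono contr_Q) auto
  finally show ?case by (simp add: field_simps)
qed (simp add: N_zero)

text \<open>The substitute for a martingale difference: \<open>Aad k (piece k g)\<close> equals
  \<open>Aad k (A k g) - Aad (Suc k) (A (Suc k) g)\<close>, so these vectors telescope.\<close>

definition piece :: "nat \<Rightarrow> 'v \<Rightarrow> 'v" where
  "piece k g = A k g - Q k (A (Suc k) g)"

text \<open>The norm of \<open>A k g\<close> in the defect form of \<open>P k\<close>. The squares
  telescope, so their sum is at most \<open>B g g\<close>.\<close>

definition delta :: "nat \<Rightarrow> 'v \<Rightarrow> real" where
  "delta k g = sqrt (B (A k g) (A k g) - B (A (Suc k) g) (A (Suc k) g))"

lemma A_decreasing: "B (A (Suc k) g) (A (Suc k) g) \<le> B (A k g) (A k g)"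
  using power_mono[OF contr_P[of k "A k g"], of 2] by (simp add: N_square)

lemma delta_nonneg: "0 \<le> delta k g"
  using A_decreasing by (simp add: delta_def)

lemma delta_square: "(delta k g)\<^sup>2 = B (A k g) (A k g) - B (A (Suc k) g) (A (Suc k) g)"
  using A_decreasing by (simp add: delta_def)

lemma N_piece: "N (piece k g) \<le> delta k g"
proof (rule power2_le_imp_le)
  have "(N (piece k g))\<^sup>2 = B (A k g) (A k g) - 2 * B (A (Suc k) g) (A (Suc k) g)
      + B (Q k (A (Suc k) g)) (Q k (A (Suc k) g))"
    using adj[of k "A k g" "A (Suc k) g"] B_sym[of "Q k (A (Suc k) g)" "A k g"]
    unfolding N_square piece_def by (simp add: B_diff B_diff_right)
  also have "B (Q k (A (Suc k) g)) (Q k (A (Suc k) g)) \<le> B (A (Suc k) g) (A (Suc k) g)"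
    using power_mono[OF contr_Q[of k "A (Suc k) g"], of 2] by (simp add: N_square)
  finally show "(N (piece k g))\<^sup>2 \<le> (delta k g)\<^sup>2" by (simp add: delta_square)
qed (rule delta_nonneg)

text \<open>Pairing with \<open>x - Q (P x)\<close> is the form \<open>\<langle>x, y\<rangle> - \<langle>P x, P y\<rangle>\<close>, to which Cauchy-Schwarz applies.\<close>

lemma piece_low:
  assumes lin: "linear Y" and contr: "\<And>x. N (Y x) \<le> N x"
    and adjY: "\<And>x y. B (Y x) y = B x (Y' y)"
    and Y: "\<And>i x. i < n \<Longrightarrow> N (Y (Q i x) - Y x) \<le> 8 * 4^i / 4^n * N x"
    and k: "k < n"
  shows "N (Y (Aad k (piece k g))) \<le> 6 * (1/2) ^ (n - k) * delta k g"
proof -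
  interpret S: semi_inner "\<lambda>x y. B x y - B (P k x) (P k y)"
    by (intro semi_inner_defect semi_inner_axioms linear_P contr_P)
  \<comment> \<open>14 rounds up 8/3 + 32/3, the errors of absorbing \<open>Aad k\<close> and
    \<open>Aad (Suc k)\<close> into \<open>Y\<close>.\<close>
  define e where "e = 14 * 4^k / (4::real)^n"
  define chi where "chi = Y (Aad k (piece k g))"
  \<comment> \<open>\<open>chi\<close> is paired with itself; transposing \<open>Y\<close> and
    \<open>Aad k\<close> turns one copy into the test vector \<open>xi\<close> for
    \<open>piece k g\<close>.\<close>
  define xi where "xi = A k (Y' chi)"
  have e: "0 \<le> e" by (simp add: e_def)
  have step: "N (Y (Aad k x) - Y (Aad (Suc k) x)) \<le> e * N x" for x
  proof -
    have "N (Y (Aad k x) - Y (Aad (Suc k) x)) \<le> N (Y (Aad k x) - Y x) + N (Y (Aad (Suc k) x) - Y x)"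
      using N_diff[of "Y (Aad k x) - Y x" "Y (Aad (Suc k) x) - Y x"] by simp
    also have "\<dots> \<le> 8 / 3 * 4^k / 4^n * N x + 8 / 3 * 4^(Suc k) / 4^n * N x"
      using k by (intro add_mono absorb_Aad contr Y) auto
    also have "\<dots> = (40 / 3) * (4^k / 4^n) * N x" by (simp add: field_simps)
    also have "\<dots> \<le> 14 * (4^k / 4^n) * N x" by (intro mult_right_mono) auto
    finally show ?thesis by (simp add: e_def)
  qed
  \<comment> \<open>Dual to \<open>step\<close>: \<open>xi\<close> is nearly fixed by
    \<open>P k\<close>. Its squared defect norm is therefore of order \<open>e\<close>, and taking
    the root turns the rate 1/4 into 1/2. The other factor in Cauchy-Schwarz is exactly
    \<open>delta k g\<close>, where a direct estimate would only give \<open>N g\<close>.\<close>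
  have "N (xi - P k xi) \<le> e * N chi"
  proof (rule N_leI)
    fix y
    have "B (xi - P k xi) y = B chi (Y (Aad k y) - Y (Aad (Suc k) y))"
    proof -
      have "B (P k xi) y = B (A (Suc k) (Y' chi)) y" by (simp add: xi_def)
      also have "\<dots> = B chi (Y (Aad (Suc k) y))" using adj_A adjY B_sym by metis
      finally have "B (P k xi) y = B chi (Y (Aad (Suc k) y))" .
      moreover have "B xi y = B chi (Y (Aad k y))" unfolding xi_def using adj_A adjY B_sym by metis
      ultimately show ?thesis by (simp only: B_diff B_diff_right)
    qed
    also have "\<dots> \<le> N chi * (e * N y)"
      by (intro order_trans[OF B_le] mult_left_mono step) simp
    finally show "B (xi - P k xi) y \<le> e * N chi * N y" by (simp add: ac_simps)
  qed (use e in simp)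
  have Nxi: "N xi \<le> N chi"
    unfolding xi_def using contr_A adjoint_contraction[OF adjY contr] by (meson order_trans)
  have "(S.N xi)\<^sup>2 = (N xi - N (P k xi)) * (N xi + N (P k xi))"
    unfolding S.N_square by (simp add: N_square[symmetric] power2_eq_square algebra_simps)
  also have "\<dots> \<le> (e * N chi) * (N chi + N chi)"
  proof (intro mult_mono add_mono)
    show "N xi - N (P k xi) \<le> e * N chi"
      using N_diff_ge[of xi "P k xi"] \<open>N (xi - P k xi) \<le> e * N chi\<close> by linarith
  qed (use Nxi contr_P[of k xi] e in auto)
  also have "\<dots> = (sqrt (2 * e) * N chi)\<^sup>2" using e by (simp add: power_mult_distrib) (simp add: power2_eq_square)
  finally have Sxi: "S.N xi \<le> sqrt (2 * e) * N chi"
    using e by (intro power2_le_imp_le[of "S.N xi"]) auto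
  have "(N chi)\<^sup>2 = B (Y (Aad k (piece k g))) chi" by (simp add: N_square chi_def)
  also have "\<dots> = B (piece k g) xi" unfolding xi_def using adj_A adjY B_sym by metis
  also have "\<dots> = B (A k g) xi - B (P k (A k g)) (P k xi)"
    using adj[of k xi "P k (A k g)"] B_sym[of "P k xi"] B_sym[of xi]
    by (simp add: piece_def B_diff)
  also have "\<dots> \<le> S.N (A k g) * S.N xi" by (rule S.B_le)
  also have "S.N (A k g) = delta k g" by (simp add: S.N_def delta_def)
  also have "delta k g * S.N xi \<le> delta k g * (sqrt (2 * e) * N chi)"
    by (intro mult_left_mono Sxi delta_nonneg)
  finally have main: "N chi * N chi \<le> (delta k g * sqrt (2 * e)) * N chi"
    by (simp only: power2_eq_square mult.assoc)
  have "N chi \<le> delta k g * sqrt (2 * e)"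
  proof (cases "N chi = 0")
    case False
    then show ?thesis using main N_nonneg[of chi] by (simp add: less_le)
  qed (use e delta_nonneg in simp)
  moreover have "sqrt (2 * e) \<le> 6 * (1/2) ^ (n - k)"
  proof (rule real_le_lsqrt)
    have "((1/2::real) ^ (n - k))\<^sup>2 = (1/4) ^ (n - k)"
      by (simp add: power2_eq_square flip: power_mult_distrib)
    also have "\<dots> = 4^k / 4^n" using k by (simp add: power_diff power_one_over)
    finally show "2 * e \<le> (6 * (1/2) ^ (n - k))\<^sup>2"
      by (simp only: power_mult_distrib) (simp add: e_def divide_right_mono)
  qed auto
  ultimately have "N chi \<le> delta k g * (6 * (1/2) ^ (n - k))"
    by (meson delta_nonneg mult_left_mono order_trans)
  then show ?thesis unfolding chi_def by (simp only: mult.commute[of "delta k g"])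
qed

text \<open>Dual to \<open>A_absorb\<close> with \<open>Y = T'\<close>: since \<open>A k\<close>
  absorbs \<open>T'\<close>, the operator \<open>T\<close> nearly fixes the range of
  \<open>Aad k\<close>.\<close>

lemma Aad_high:
  assumes lin: "linear T'" and contr: "\<And>x. N (T x) \<le> N x" and c: "1 \<le> c"
    and adjT: "\<And>x y. B (T x) y = B x (T' y)"
    and T': "\<And>k x. j < k \<Longrightarrow> N (P k (T' x) - P k x) \<le> c * (1/64) ^ (k - j) * N x"
    and k: "j \<le> k"
  shows "N (T (Aad k w) - Aad k w) \<le> 8 * c * (1/4) ^ (k - j) * N w"
proof (rule N_leI)
  fix y
  have "B (T (Aad k w) - Aad k w) y = B w (A k (T' y) - A k y)"
  proof -
    have "B (T (Aad k w)) y = B w (A k (T' y))" using adj_A adjT B_sym by metis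
    moreover have "B (Aad k w) y = B w (A k y)" using adj_A B_sym by metis
    ultimately show ?thesis by (simp only: B_diff B_diff_right)
  qed
  also have "\<dots> \<le> N w * (8 * c * 4^j / 4^k * N y)"
    by (intro order_trans[OF B_le] mult_left_mono A_absorb lin T' c
        adjoint_contraction[OF adjT contr]) auto
  finally show "B (T (Aad k w) - Aad k w) y \<le> 8 * c * (1/4) ^ (k - j) * N w * N y"
    using k by (simp add: power_diff power_one_over ac_simps)
qed (use c in auto)

text \<open>By duality \<open>A j\<close> nearly fixes \<open>Aad k w\<close>, so the two norms
  nearly agree. Factoring the difference of their squares gives the order 4^-(k-j), and the root
  gives 2^-(k-j).\<close>

lemma defect_high:
  assumes k: "j \<le> k"
  shows "sqrt (B (Aad k w) (Aad k w) - B (A j (Aad k w)) (A j (Aad k w))) \<le> 3 * (1/2) ^ (k - j) * N w"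
proof (rule real_le_lsqrt)
  define f where "f = Aad k w"
  have "N (f - A j f) \<le> 8 / 3 * 4^j / 4^k * N w"
  proof (rule N_leI)
    fix y
    have "B (f - A j f) y = B w (A k y - A k (Aad j y))"
    proof -
      have "B f y = B w (A k y)" unfolding f_def using adj_A B_sym by metis
      moreover have "B (A j f) y = B w (A k (Aad j y))" unfolding f_def using adj_A B_sym by metis
      ultimately show ?thesis by (simp only: B_diff B_diff_right)
    qed
    also have "\<dots> \<le> N w * (8 / 3 * 4^j / 4^k * N y)"
      by (intro order_trans[OF B_le] mult_left_mono,
          subst N_commute, intro absorb_Aad contr_A A_absorb_Q k) auto
    finally show "B (f - A j f) y \<le> 8 / 3 * 4^j / 4^k * N w * N y" by (simp add: ac_simps)
  qed simp
  then have *: "N f - N (A j f) \<le> 8 / 3 * 4^j / 4^k * N w" using N_diff_ge[of f "A j f"] by linarith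
  have "B f f - B (A j f) (A j f) = (N f - N (A j f)) * (N f + N (A j f))"
    by (simp add: N_square[symmetric] power2_eq_square algebra_simps)
  also have "\<dots> \<le> (8 / 3 * 4^j / 4^k * N w) * (N w + N w)"
    using contr_A[of j f] contr_Aad[of k w] by (intro mult_mono add_mono *) (auto simp: f_def)
  also have "\<dots> \<le> 9 * (4^j / 4^k) * (N w)\<^sup>2"
  proof -
    have "(8 / 3 * 4^j / 4^k * N w) * (N w + N w) = 16 / 3 * ((4^j / 4^k) * (N w)\<^sup>2)"
      by (simp add: power2_eq_square)
    also have "\<dots> \<le> 9 * ((4^j / 4^k) * (N w)\<^sup>2)" by (intro mult_right_mono) auto
    finally show ?thesis by (simp only: mult.assoc)
  qed
  also have "\<dots> = (3 * (1/2) ^ (k - j) * N w)\<^sup>2"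
  proof -
    have "((1/2::real) ^ (k - j))\<^sup>2 = (1/4) ^ (k - j)"
      by (simp add: power2_eq_square flip: power_mult_distrib)
    also have "\<dots> = 4^j / 4^k" using k by (simp add: power_diff power_one_over)
    finally show ?thesis by (simp only: power_mult_distrib) simp
  qed
  finally show "B (Aad k w) (Aad k w) - B (A j (Aad k w)) (A j (Aad k w)) \<le> (3 * (1/2) ^ (k - j) * N w)\<^sup>2"
    by (simp add: f_def)
qed auto

lemma telescope_pieces:
  assumes "m \<le> n"
  shows "Aad m (A m g) = (\<Sum>k=m..<n. Aad k (piece k g)) + Aad n (A n g)"
  using assms
proof (induction n rule: dec_induct)
  case (step n)
  have "Aad n (A n g) = Aad n (piece n g) + Aad (Suc n) (A (Suc n) g)"
    by (simp add: piece_def linear_diff[OF linear_Aad])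
  then show ?case using step by (simp add: add.assoc)
qed simp

text \<open>The operator \<open>T\<close> behaves as if it belonged to level \<open>j\<close>. This
  admits the averages over sets \<open>F n\<close> that are not among the chosen levels. The bound
  against finer levels is the one that \<open>A j\<close> itself satisfies in
  \<open>A_absorb_Q\<close>.\<close>

definition level_op :: "real \<Rightarrow> nat \<Rightarrow> ('v \<Rightarrow> 'v) \<Rightarrow> ('v \<Rightarrow> 'v) \<Rightarrow> bool" where
  "level_op c j T T' \<longleftrightarrow> linear T \<and> linear T' \<and> (\<forall>x. N (T x) \<le> N x) \<and> (\<forall>x y. B (T x) y = B x (T' y)) \<and>
     (\<forall>i x. i < j \<longrightarrow> N (T (Q i x) - T x) \<le> 8 * 4^i / 4^j * N x) \<and>
     (\<forall>k x. j < k \<longrightarrow> N (P k (T' x) - P k x) \<le> c * (1/64) ^ (k - j) * N x)"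

text \<open>At level \<open>j\<close> the vector \<open>g\<close> splits into the pieces below
  \<open>j\<close>, which \<open>T\<close> and \<open>A j\<close> nearly annihilate, and the part
  \<open>Aad j (A j g)\<close>, which \<open>T\<close> nearly fixes and whose norm
  \<open>A j\<close> nearly preserves. The error due to piece \<open>k\<close> is of order 2^-|j-k|
  times \<open>delta k g\<close>, so all errors together form a convolution of a square summable
  sequence.\<close>

theorem almost_orthogonality:
  fixes K :: nat and g :: 'v and c :: real
  assumes c: "1 \<le> c"
  obtains H :: "nat \<Rightarrow> real" where "\<And>j. 0 \<le> H j" "(\<Sum>j\<le>K. (H j)\<^sup>2) \<le> 9 * (N g)\<^sup>2"
    "\<And>j T T'. j \<le> K \<Longrightarrow> level_op c j T T' \<Longrightarrow> N (T (g - Aad j (A j g))) \<le> 8 * c * H j"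
    "\<And>j. j \<le> K \<Longrightarrow> N (A j (g - Aad j (A j g))) \<le> 8 * c * H j"
    "\<And>j T T'. j \<le> K \<Longrightarrow> level_op c j T T' \<Longrightarrow> N (T (Aad j (A j g)) - Aad j (A j g)) \<le> 8 * c * H j"
    "\<And>j. j \<le> K \<Longrightarrow> sqrt (B (Aad j (A j g)) (Aad j (A j g)) - B (A j (Aad j (A j g))) (A j (Aad j (A j g)))) \<le> 8 * c * H j"
proof -
  \<comment> \<open>The entry at \<open>K\<close> stands for what the pieces below \<open>K\<close>
    leave over; with it the squares add up to exactly \<open>(N g)\<^sup>2\<close>.\<close>
  define D where "D k = (if k < K then delta k g else N (A K g))" for k
  define H where "H j = (\<Sum>k\<le>K. (1/2) ^ ndist j k * D k)" for j
  have D: "0 \<le> D k" for k by (simp add: D_def delta_nonneg)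
  have H: "0 \<le> H j" for j unfolding H_def using D by (intro sum_nonneg) auto
  have tele: "(\<Sum>k<n. (delta k g)\<^sup>2) = (N g)\<^sup>2 - (N (A n g))\<^sup>2" for n
    by (induction n) (auto simp: delta_square N_square)
  have "(\<Sum>k\<le>K. (D k)\<^sup>2) = (\<Sum>k<K. (delta k g)\<^sup>2) + (N (A K g))\<^sup>2"
    by (simp add: D_def lessThan_Suc_atMost[symmetric])
  then have DD: "(\<Sum>k\<le>K. (D k)\<^sup>2) = (N g)\<^sup>2" using tele[of K] by simp
  have low_le: "(\<Sum>k<j. (1/2) ^ (j - k) * delta k g) \<le> H j" if "j \<le> K" for j
  proof -
    have "(\<Sum>k<j. (1/2) ^ (j - k) * delta k g) = (\<Sum>k<j. (1/2) ^ ndist j k * D k)"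
      using that by (intro sum.cong) (auto simp: ndist_def D_def)
    also have "\<dots> \<le> H j" unfolding H_def using that D by (intro sum_mono2) auto
    finally show ?thesis .
  qed
  have high_le: "(\<Sum>k=j..<K. (1/2) ^ (k - j) * delta k g) + (1/2) ^ (K - j) * N (A K g) \<le> H j"
    if "j \<le> K" for j
  proof -
    have "(\<Sum>k=j..<K. (1/2) ^ (k - j) * delta k g) + (1/2) ^ (K - j) * N (A K g)
        = (\<Sum>k=j..<K. (1/2) ^ ndist j k * D k) + (1/2) ^ ndist j K * D K"
      using that by (intro arg_cong2[of _ _ _ _ "(+)"] sum.cong) (auto simp: ndist_def D_def)
    also have "\<dots> = (\<Sum>k\<in>{j..K}. (1/2) ^ ndist j k * D k)"
      using that by (simp add: atLeastLessThanSuc_atLeastAtMost[symmetric])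
    also have "\<dots> \<le> H j" unfolding H_def using that D by (intro sum_mono2) auto
    finally show ?thesis .
  qed
  have low: "g - Aad j (A j g) = (\<Sum>k<j. Aad k (piece k g))" for j
    using telescope_pieces[of 0 j g] by (simp add: atLeast0LessThan) (metis add_diff_cancel_right')
  have low_N: "N (Y (g - Aad j (A j g))) \<le> 8 * c * H j"
    if Y: "linear Y" "\<And>x. N (Y x) \<le> N x" "\<And>x y. B (Y x) y = B x (Y' y)"
      "\<And>i x. i < j \<Longrightarrow> N (Y (Q i x) - Y x) \<le> 8 * 4^i / 4^j * N x" and j: "j \<le> K" for Y Y' j
  proof -
    have "N (Y (g - Aad j (A j g))) \<le> (\<Sum>k<j. N (Y (Aad k (piece k g))))"
      unfolding low linear_sum[OF Y(1)] by (rule N_sum)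
    also have "\<dots> \<le> (\<Sum>k<j. 6 * (1/2) ^ (j - k) * delta k g)"
      by (intro sum_mono piece_low[OF Y]) auto
    also have "\<dots> = 6 * (\<Sum>k<j. (1/2) ^ (j - k) * delta k g)" by (simp add: sum_distrib_left mult.assoc)
    also have "\<dots> \<le> 6 * H j" using low_le[OF j] by simp
    also have "\<dots> \<le> 8 * c * H j" using c H[of j] by (intro mult_right_mono) auto
    finally show ?thesis .
  qed
  show ?thesis
  proof (rule that)
    show "0 \<le> H j" for j by (rule H)
    show "(\<Sum>j\<le>K. (H j)\<^sup>2) \<le> 9 * (N g)\<^sup>2"
      unfolding H_def DD[symmetric] by (rule sum_convolution_square)
    show "N (T (g - Aad j (A j g))) \<le> 8 * c * H j" if "j \<le> K" "level_op c j T T'" for j T T'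
      using that unfolding level_op_def by (intro low_N[where Y' = T']) auto
    show "N (A j (g - Aad j (A j g))) \<le> 8 * c * H j" if "j \<le> K" for j
      using that by (intro low_N[where Y' = "Aad j"] linear_A contr_A adj_A A_absorb_Q)
    show "N (T (Aad j (A j g)) - Aad j (A j g)) \<le> 8 * c * H j" if j: "j \<le> K" and T: "level_op c j T T'" for j T T'
    proof -
      have lin: "linear T" and hi: "N (T (Aad k w) - Aad k w) \<le> 8 * c * (1/2) ^ (k - j) * N w" if "j \<le> k" for k w
      proof -
        show "linear T" using T by (simp add: level_op_def)
        have "N (T (Aad k w) - Aad k w) \<le> 8 * c * (1/4) ^ (k - j) * N w"
          using T c that unfolding level_op_def by (intro Aad_high[where T' = T']) auto
        also have "\<dots> \<le> 8 * c * (1/2) ^ (k - j) * N w"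
          using c by (intro mult_right_mono mult_left_mono power_mono) auto
        finally show "N (T (Aad k w) - Aad k w) \<le> 8 * c * (1/2) ^ (k - j) * N w" .
      qed
      have "T (Aad j (A j g)) - Aad j (A j g) = (\<Sum>k=j..<K. T (Aad k (piece k g)) - Aad k (piece k g))
          + (T (Aad K (A K g)) - Aad K (A K g))"
        unfolding telescope_pieces[OF j, of g] linear_add[OF lin[OF order_refl]] linear_sum[OF lin[OF order_refl]]
        by (simp add: sum_subtractf)
      then have "N (T (Aad j (A j g)) - Aad j (A j g)) \<le>
          (\<Sum>k=j..<K. N (T (Aad k (piece k g)) - Aad k (piece k g))) + N (T (Aad K (A K g)) - Aad K (A K g))"
        using order_trans[OF N_triangle add_right_mono[OF N_sum]] by (simp only:)
      also have "\<dots> \<le> (\<Sum>k=j..<K. 8 * c * (1/2) ^ (k - j) * delta k g) + 8 * c * (1/2) ^ (K - j) * N (A K g)"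
        using j c by (intro add_mono sum_mono order_trans[OF hi] mult_left_mono N_piece) auto
      also have "\<dots> = 8 * c * ((\<Sum>k=j..<K. (1/2) ^ (k - j) * delta k g) + (1/2) ^ (K - j) * N (A K g))"
        by (simp add: sum_distrib_left distrib_left mult.assoc)
      also have "\<dots> \<le> 8 * c * H j" using c by (intro mult_left_mono high_le j) auto
      finally show ?thesis .
    qed
    show "sqrt (B (Aad j (A j g)) (Aad j (A j g)) - B (A j (Aad j (A j g))) (A j (Aad j (A j g)))) \<le> 8 * c * H j"
      if j: "j \<le> K" for j
    proof -
      interpret S: semi_inner "\<lambda>x y. B x y - B (A j x) (A j y)"
        by (intro semi_inner_defect semi_inner_axioms linear_A contr_A)
      have hi: "S.N (Aad k w) \<le> 3 * (1/2) ^ (k - j) * N w" if "j \<le> k" for k w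
        unfolding S.N_def by (rule defect_high[OF that])
      have "S.N (Aad j (A j g)) \<le> (\<Sum>k=j..<K. S.N (Aad k (piece k g))) + S.N (Aad K (A K g))"
        unfolding telescope_pieces[OF j, of g] by (rule order_trans[OF S.N_triangle add_right_mono[OF S.N_sum]])
      also have "\<dots> \<le> (\<Sum>k=j..<K. 3 * (1/2) ^ (k - j) * delta k g) + 3 * (1/2) ^ (K - j) * N (A K g)"
        using j by (intro add_mono sum_mono order_trans[OF hi] mult_left_mono N_piece) auto
      also have "\<dots> = 3 * ((\<Sum>k=j..<K. (1/2) ^ (k - j) * delta k g) + (1/2) ^ (K - j) * N (A K g))"
        by (simp add: sum_distrib_left distrib_left mult.assoc)
      also have "\<dots> \<le> 3 * H j" using high_le[OF j] by simp
      also have "\<dots> \<le> 8 * c * H j" using c H[of j] by (intro mult_right_mono) auto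
      finally show ?thesis by (simp add: S.N_def)
    qed
  qed
qed

end

section \<open>Averaging operators\<close>

text \<open>Honest functions instead of classes modulo null sets: averages make sense at every
  point, all integrals exist, and the class is closed under the operations of the proof.\<close>

definition cbp :: "('g::topological_space \<Rightarrow> real) \<Rightarrow> bool" where
  "cbp f \<longleftrightarrow> f \<in> borel_measurable borel \<and> (\<exists>c. \<forall>x. \<bar>f x\<bar> \<le> c) \<and>
     (\<exists>K. compact K \<and> (\<forall>x. x \<notin> K \<longrightarrow> f x = 0))"

lemma cbpI:
  "f \<in> borel_measurable borel \<Longrightarrow> (\<And>x. \<bar>f x\<bar> \<le> c) \<Longrightarrow> compact K \<Longrightarrow> (\<And>x. x \<notin> K \<Longrightarrow> f x = 0) \<Longrightarrow> cbp f"
  by (auto simp: cbp_def)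

lemma cbp_measurable: "cbp f \<Longrightarrow> f \<in> borel_measurable borel"
  by (simp add: cbp_def)

lemma cbp_bounded:
  assumes "cbp f"
  obtains c where "0 \<le> c" "\<And>x. \<bar>f x\<bar> \<le> c"
proof -
  obtain c where "\<And>x. \<bar>f x\<bar> \<le> c" using assms by (auto simp: cbp_def)
  then show ?thesis using that[of c] abs_ge_zero order_trans by metis
qed

lemma cbp_support:
  assumes "cbp f"
  obtains K where "compact K" "\<And>x. x \<notin> K \<Longrightarrow> f x = 0"
  using assms by (auto simp: cbp_def)

lemma cbp_mult_bounded:
  assumes f: "cbp f" and [measurable]: "g \<in> borel_measurable borel" and g: "\<And>x. \<bar>g x\<bar> \<le> c"
  shows "cbp (\<lambda>x. f x * g x)"
proof -
  note [measurable] = cbp_measurable[OF f]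
  obtain d where d: "0 \<le> d" "\<And>x. \<bar>f x\<bar> \<le> d" using cbp_bounded[OF f] by blast
  obtain K where K: "compact K" "\<And>x. x \<notin> K \<Longrightarrow> f x = 0" using cbp_support[OF f] by blast
  show ?thesis
    by (rule cbpI[where c = "d * c" and K = K]) (auto simp: abs_mult K intro!: mult_mono d g)
qed

lemma cbp_mult: "cbp f \<Longrightarrow> cbp g \<Longrightarrow> cbp (\<lambda>x. f x * g x)"
  by (metis cbp_bounded cbp_measurable cbp_mult_bounded)

lemma cbp_indicator_mult: "cbp f \<Longrightarrow> S \<in> sets borel \<Longrightarrow> cbp (\<lambda>x. f x * indicator S x)"
  by (rule cbp_mult_bounded[where c = 1]) (auto simp: indicator_def)

lemma cbp_scale: "cbp f \<Longrightarrow> cbp (\<lambda>x. c * f x)"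
  using cbp_mult_bounded[of f "\<lambda>_. c" "\<bar>c\<bar>"] by (simp add: mult.commute)

lemma cbp_add:
  assumes f: "cbp f" and g: "cbp g"
  shows "cbp (\<lambda>x. f x + g x)"
proof -
  note [measurable] = cbp_measurable[OF f] cbp_measurable[OF g]
  obtain c where c: "0 \<le> c" "\<And>x. \<bar>f x\<bar> \<le> c" using cbp_bounded[OF f] by blast
  obtain d where d: "0 \<le> d" "\<And>x. \<bar>g x\<bar> \<le> d" using cbp_bounded[OF g] by blast
  obtain K where K: "compact K" "\<And>x. x \<notin> K \<Longrightarrow> f x = 0" using cbp_support[OF f] by blast
  obtain L where L: "compact L" "\<And>x. x \<notin> L \<Longrightarrow> g x = 0" using cbp_support[OF g] by blast
  show ?thesis
    by (rule cbpI[where c = "c + d" and K = "K \<union> L"])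
      (auto simp: K L intro!: compact_Un order_trans[OF abs_triangle_ineq] add_mono c d)
qed

lemma cbp_zero: "cbp (\<lambda>_. 0)"
  by (rule cbpI[where c = 0 and K = "{}"]) auto

lemma cbp_minus: "cbp f \<Longrightarrow> cbp (\<lambda>x. - f x)"
  using cbp_scale[of f "-1"] by simp

lemma cbp_diff: "cbp f \<Longrightarrow> cbp g \<Longrightarrow> cbp (\<lambda>x. f x - g x)"
  using cbp_add[of f "\<lambda>x. - g x"] cbp_minus by auto

lemma cbp_abs: "cbp f \<Longrightarrow> cbp (\<lambda>x. \<bar>f x\<bar>)"
  by (auto simp: cbp_def)

lemma cbp_sum: "(\<And>i. i \<in> I \<Longrightarrow> cbp (f i)) \<Longrightarrow> cbp (\<lambda>x. \<Sum>i\<in>I. f i x)"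
  by (induction I rule: infinite_finite_induct) (auto intro: cbp_zero cbp_add)

lemma cbp_power2: "cbp f \<Longrightarrow> cbp (\<lambda>x. (f x)\<^sup>2)"
  using cbp_mult[of f f] by (simp add: power2_eq_square)

section \<open>Averages against measures of compact support\<close>

definition av :: "'g::plus measure \<Rightarrow> ('g \<Rightarrow> real) \<Rightarrow> 'g \<Rightarrow> real" where
  "av \<nu> f x = (\<integral>s. f (x + s) \<partial>\<nu>)"

text \<open>Compact support keeps \<open>cbp\<close> closed under \<open>av\<close>; finiteness
  without normalisation admits the error measures \<open>smear\<close> besides
  probabilities.\<close>

definition cmeasure :: "'g::topological_space measure \<Rightarrow> bool" where
  "cmeasure \<nu> \<longleftrightarrow> finite_measure \<nu> \<and> sets \<nu> = sets borel \<and> (\<exists>C. compact C \<and> (AE s in \<nu>. s \<in> C))"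

definition cprob :: "'g::topological_space measure \<Rightarrow> bool" where
  "cprob \<nu> \<longleftrightarrow> cmeasure \<nu> \<and> emeasure \<nu> UNIV = 1"

lemma cprob_cmeasure: "cprob \<nu> \<Longrightarrow> cmeasure \<nu>"
  by (simp add: cprob_def)

lemma cprob_measure: "cprob \<nu> \<Longrightarrow> measure \<nu> UNIV = 1"
  by (simp add: cprob_def measure_def)

lemma cmeasure_sets: "cmeasure \<nu> \<Longrightarrow> sets \<nu> = sets borel"
  by (simp add: cmeasure_def)

lemma cmeasure_space: "cmeasure \<nu> \<Longrightarrow> space \<nu> = UNIV"
  using sets_eq_imp_space_eq[of \<nu> borel] by (simp add: cmeasure_def)

lemma cmeasure_finite: "cmeasure \<nu> \<Longrightarrow> finite_measure \<nu>"
  by (simp add: cmeasure_def)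

lemma cmeasure_integrable:
  fixes f :: "'g::topological_space \<Rightarrow> real"
  assumes \<nu>: "cmeasure \<nu>" and f: "f \<in> borel_measurable borel" "\<And>x. \<bar>f x\<bar> \<le> c"
  shows "integrable \<nu> f"
proof -
  interpret finite_measure \<nu> by (rule cmeasure_finite[OF \<nu>])
  show ?thesis
    using f measurable_cong_sets[OF cmeasure_sets[OF \<nu>] refl, of borel]
    by (intro integrable_const_bound[where B = c]) auto
qed

lemma measurable_plus [measurable (raw)]:
  fixes f g :: "'x \<Rightarrow> 'g::{topological_group_add, second_countable_topology}"
  assumes "f \<in> borel_measurable M" "g \<in> borel_measurable M"
  shows "(\<lambda>x. f x + g x) \<in> borel_measurable M"
  using assms by (rule borel_measurable_continuous_Pair) (intro continuous_intros)

lemma measurable_neg [measurable (raw)]: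
  fixes f :: "'x \<Rightarrow> 'g::{topological_group_add, second_countable_topology}"
  assumes "f \<in> borel_measurable M"
  shows "(\<lambda>x. - f x) \<in> borel_measurable M"
  using assms by (rule measurable_compose) (intro borel_measurable_continuous_onI continuous_intros)

lemma measurable_uminus [measurable]:
  "(uminus :: 'g::{topological_group_add, second_countable_topology} \<Rightarrow> 'g) \<in> borel_measurable borel"
  by (intro borel_measurable_continuous_onI continuous_intros)

lemma measurable_minus [measurable (raw)]:
  fixes f g :: "'x \<Rightarrow> 'g::{topological_group_add, second_countable_topology}"
  assumes "f \<in> borel_measurable M" "g \<in> borel_measurable M"
  shows "(\<lambda>x. f x - g x) \<in> borel_measurable M"
  using assms by (rule borel_measurable_continuous_Pair) (intro continuous_intros)

lemma cmeasure_borel: "cmeasure \<nu> \<Longrightarrow> f \<in> borel_measurable borel \<Longrightarrow> f \<in> borel_measurable \<nu>"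
  using measurable_cong_sets[OF cmeasure_sets refl, of \<nu> borel] by auto

lemma measurable_av:
  fixes f :: "'g::{topological_group_add, second_countable_topology} \<Rightarrow> real"
  assumes \<nu>: "cmeasure \<nu>" and [measurable]: "f \<in> borel_measurable borel"
  shows "av \<nu> f \<in> borel_measurable borel"
proof -
  interpret finite_measure \<nu> by (rule cmeasure_finite[OF \<nu>])
  have [measurable_cong]: "sets \<nu> = sets borel" by (rule cmeasure_sets[OF \<nu>])
  show ?thesis unfolding av_def by measurable
qed

lemma av_bound:
  fixes f :: "'g::{topological_group_add, second_countable_topology} \<Rightarrow> real"
  assumes \<nu>: "cmeasure \<nu>" and [measurable]: "f \<in> borel_measurable borel" and f: "\<And>x. \<bar>f x\<bar> \<le> c"
  shows "\<bar>av \<nu> f x\<bar> \<le> c * measure \<nu> UNIV"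
proof -
  interpret finite_measure \<nu> by (rule cmeasure_finite[OF \<nu>])
  have i: "integrable \<nu> (\<lambda>s. f (x + s))" using f by (intro cmeasure_integrable[OF \<nu>]) auto
  have "\<bar>av \<nu> f x\<bar> \<le> (\<integral>s. \<bar>f (x + s)\<bar> \<partial>\<nu>)" unfolding av_def by (rule integral_abs_bound)
  also have "\<dots> \<le> (\<integral>s. c \<partial>\<nu>)" using i f by (intro integral_mono) auto
  finally show ?thesis by (simp add: cmeasure_space[OF \<nu>] mult.commute)
qed

lemma cbp_integrable_av:
  fixes f :: "'g::{topological_group_add, second_countable_topology} \<Rightarrow> real"
  assumes \<nu>: "cmeasure \<nu>" and f: "cbp f"
  shows "integrable \<nu> (\<lambda>s. f (x + s))"
proof -
  note [measurable] = cbp_measurable[OF f]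
  obtain c where c: "\<And>x. \<bar>f x\<bar> \<le> c" using cbp_bounded[OF f] by metis
  show ?thesis by (rule cmeasure_integrable[OF \<nu>, where c = c]) (auto intro: c)
qed

lemma compact_add:
  fixes A B :: "'g::topological_group_add set"
  assumes "compact A" "compact B" shows "compact (A + B)"
proof -
  have "compact ((\<lambda>(x, y). x + y) ` (A \<times> B))"
    using assms by (intro compact_continuous_image compact_Times)
      (auto simp: case_prod_beta intro!: continuous_intros)
  also have "(\<lambda>(x, y). x + y) ` (A \<times> B) = A + B" by (auto simp: set_plus_def)
  finally show ?thesis .
qed

lemma compact_neg:
  fixes A :: "'g::topological_group_add set"
  assumes "compact A" shows "compact (uminus ` A)"
  using assms by (intro compact_continuous_image continuous_intros)

lemma cbp_av:
  fixes f :: "'g::{topological_group_add, second_countable_topology} \<Rightarrow> real"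
  assumes \<nu>: "cmeasure \<nu>" and f: "cbp f"
  shows "cbp (av \<nu> f)"
proof -
  note [measurable] = cbp_measurable[OF f]
  obtain c where c: "\<And>x. \<bar>f x\<bar> \<le> c" using cbp_bounded[OF f] by metis
  obtain K where K: "compact K" "\<And>x. x \<notin> K \<Longrightarrow> f x = 0" using cbp_support[OF f] by blast
  obtain C where C: "compact C" "AE s in \<nu>. s \<in> C" using \<nu> by (auto simp: cmeasure_def)
  show ?thesis
  proof (rule cbpI[where K = "K + uminus ` C"])
    show "av \<nu> f x = 0" if x: "x \<notin> K + uminus ` C" for x
    proof -
      have "f (x + s) = 0" if "s \<in> C" for s
      proof (rule K(2))
        show "x + s \<notin> K"
        proof
          assume "x + s \<in> K"
          then have "(x + s) + (- s) \<in> K + uminus ` C" using that by blast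
          then show False using x by (simp add: add.assoc)
        qed
      qed
      then have "AE s in \<nu>. f (x + s) = 0" using C(2) by auto
      then show ?thesis unfolding av_def by (rule integral_eq_zero_AE)
    qed
  qed (auto intro!: measurable_av \<nu> av_bound[OF \<nu> _ c] compact_add compact_neg K C)
qed

lemma av_add: "cmeasure \<nu> \<Longrightarrow> cbp f \<Longrightarrow> cbp g \<Longrightarrow>
    av \<nu> (\<lambda>x. f x + g x) x = av \<nu> f x + av \<nu> (g :: 'g::{topological_group_add, second_countable_topology} \<Rightarrow> real) x"
  unfolding av_def by (intro Bochner_Integration.integral_add cbp_integrable_av)

lemma av_scale: "av \<nu> (\<lambda>x. c * f x) x = c * av \<nu> f x"
  unfolding av_def by simp

lemma av_sum: "cmeasure \<nu> \<Longrightarrow> (\<And>i. i \<in> I \<Longrightarrow> cbp (f i)) \<Longrightarrow>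
    av \<nu> (\<lambda>x. \<Sum>i\<in>I. f i x) x = (\<Sum>i\<in>I. av \<nu> (f i :: 'g::{topological_group_add, second_countable_topology} \<Rightarrow> real) x)"
  unfolding av_def by (intro Bochner_Integration.integral_sum cbp_integrable_av)

lemma av_nonneg: "(\<And>x. 0 \<le> f x) \<Longrightarrow> 0 \<le> av \<nu> f x"
  unfolding av_def by simp

lemma av_abs: "\<bar>av \<nu> f x\<bar> \<le> av \<nu> (\<lambda>x. \<bar>f x\<bar>) x"
  unfolding av_def by (rule integral_abs_bound)

definition neg :: "'g::{uminus, topological_space} measure \<Rightarrow> 'g measure" where
  "neg \<nu> = distr \<nu> borel uminus"

lemma cmeasure_neg:
  fixes \<nu> :: "'g::{topological_group_add, second_countable_topology, t2_space} measure"
  assumes \<nu>: "cmeasure \<nu>" shows "cmeasure (neg \<nu>)"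
proof -
  interpret finite_measure \<nu> by (rule cmeasure_finite[OF \<nu>])
  have [measurable_cong]: "sets \<nu> = sets borel" by (rule cmeasure_sets[OF \<nu>])
  obtain C where C: "compact C" "AE s in \<nu>. s \<in> C" using \<nu> by (auto simp: cmeasure_def)
  have "AE s in neg \<nu>. s \<in> uminus ` C"
  proof -
    have "uminus ` C \<in> sets borel" by (intro borel_compact compact_neg[OF C(1)])
    then have "{x \<in> space borel. x \<in> uminus ` C} \<in> sets borel" by simp
    then show ?thesis unfolding neg_def using C(2)
      by (subst AE_distr_iff) auto
  qed
  moreover have "finite_measure (neg \<nu>)" unfolding neg_def by (rule finite_measure_distr) measurable
  moreover have "sets (neg \<nu>) = sets borel" by (simp add: neg_def)
  ultimately show ?thesis using compact_neg[OF C(1)] unfolding cmeasure_def by blast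
qed

lemma neg_UNIV: "cmeasure (\<nu> :: 'g::{topological_group_add, second_countable_topology} measure) \<Longrightarrow> emeasure (neg \<nu>) UNIV = emeasure \<nu> UNIV"
  unfolding neg_def by (subst emeasure_distr) (auto simp: cmeasure_space intro: cmeasure_borel[OF _ measurable_uminus])

lemma cprob_neg:
  "cprob (\<nu> :: 'g::{topological_group_add, second_countable_topology, t2_space} measure) \<Longrightarrow> cprob (neg \<nu>)"
  by (simp add: cprob_def cmeasure_neg neg_UNIV)

lemma integral_neg:
  fixes f :: "'g::{topological_group_add, second_countable_topology} \<Rightarrow> real"
  assumes "cmeasure \<nu>" "f \<in> borel_measurable borel"
  shows "(\<integral>s. f s \<partial>neg \<nu>) = (\<integral>s. f (- s) \<partial>\<nu>)"
  unfolding neg_def by (rule integral_distr[OF cmeasure_borel[OF assms(1) measurable_uminus] assms(2)])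

lemma av_neg:
  fixes f :: "'g::{topological_group_add, second_countable_topology} \<Rightarrow> real"
  assumes "cmeasure \<nu>" "f \<in> borel_measurable borel"
  shows "av (neg \<nu>) f x = (\<integral>s. f (x - s) \<partial>\<nu>)"
proof -
  have "(\<lambda>s. f (x + s)) \<in> borel_measurable borel" using assms(2) by measurable
  then show ?thesis unfolding av_def by (simp add: integral_neg[OF assms(1)] diff_conv_add_uminus del: add_uminus_conv_diff)
qed

definition conv :: "'g::{plus, topological_space} measure \<Rightarrow> 'g measure \<Rightarrow> 'g measure" where
  "conv \<mu> \<nu> = distr (\<mu> \<Otimes>\<^sub>M \<nu>) borel (\<lambda>(s, t). s + t)"

lemma av_conv:
  fixes f :: "'g::{topological_group_add, second_countable_topology} \<Rightarrow> real"
  assumes \<mu>: "cmeasure \<mu>" and \<nu>: "cmeasure \<nu>" and f: "cbp f"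
  shows "av (conv \<mu> \<nu>) f x = av \<mu> (av \<nu> f) x"
proof -
  interpret M: finite_measure \<mu> by (rule cmeasure_finite[OF \<mu>])
  interpret N: finite_measure \<nu> by (rule cmeasure_finite[OF \<nu>])
  interpret MN: pair_sigma_finite \<mu> \<nu> ..
  interpret MNf: finite_measure "\<mu> \<Otimes>\<^sub>M \<nu>" by (rule finite_measure_pair_measure[OF N.finite_measure_axioms M.finite_measure_axioms])
  have [measurable_cong]: "sets \<mu> = sets borel" "sets \<nu> = sets borel" by (rule cmeasure_sets[OF \<mu>] cmeasure_sets[OF \<nu>])+
  note [measurable] = cbp_measurable[OF f]
  obtain c where c: "\<And>x. \<bar>f x\<bar> \<le> c" using cbp_bounded[OF f] by metis
  have "av (conv \<mu> \<nu>) f x = (\<integral>p. f (x + (fst p + snd p)) \<partial>(\<mu> \<Otimes>\<^sub>M \<nu>))"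
    unfolding av_def conv_def by (subst integral_distr) (auto simp: case_prod_beta)
  also have "\<dots> = (\<integral>s. \<integral>t. f (x + (s + t)) \<partial>\<nu> \<partial>\<mu>)"
    by (subst MN.integral_fst'[symmetric]) (auto intro!: MNf.integrable_const_bound[where B = c] c)
  finally show ?thesis by (simp add: av_def add.assoc)
qed

lemma AE_conv:
  fixes \<mu> \<nu> :: "'g::{topological_group_add, second_countable_topology, t2_space} measure"
  assumes \<mu>: "cmeasure \<mu>" and \<nu>: "cmeasure \<nu>" and C: "compact C" "compact D"
    and "AE s in \<mu>. s \<in> C" "AE s in \<nu>. s \<in> D"
  shows "AE s in conv \<mu> \<nu>. s \<in> C + D"
proof -
  interpret M: finite_measure \<mu> by (rule cmeasure_finite[OF \<mu>])
  interpret N: finite_measure \<nu> by (rule cmeasure_finite[OF \<nu>])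
  interpret MN: pair_sigma_finite \<mu> \<nu> ..
  have [measurable_cong]: "sets \<mu> = sets borel" "sets \<nu> = sets borel" by (rule cmeasure_sets[OF \<mu>] cmeasure_sets[OF \<nu>])+
  have CD [measurable]: "C + D \<in> sets borel" by (intro borel_compact compact_add[OF C])
  show ?thesis unfolding conv_def
  proof (subst AE_distr_iff)
    show "{x \<in> space borel. x \<in> C + D} \<in> sets borel" using CD by simp
    show "AE p in \<mu> \<Otimes>\<^sub>M \<nu>. (case p of (s, t) \<Rightarrow> s + t) \<in> C + D"
    proof (rule MN.AE_pair_measure)
      show "AE s in \<mu>. AE t in \<nu>. (case (s, t) of (s, t) \<Rightarrow> s + t) \<in> C + D"
        using assms(5)
      proof eventually_elim
        case (elim s)
        show ?case using assms(6) by eventually_elim (use elim in auto)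
      qed
    qed measurable
  qed measurable
qed

lemma cmeasure_conv:
  fixes \<mu> \<nu> :: "'g::{topological_group_add, second_countable_topology, t2_space} measure"
  assumes \<mu>: "cmeasure \<mu>" and \<nu>: "cmeasure \<nu>"
  shows "cmeasure (conv \<mu> \<nu>)"
proof -
  interpret M: finite_measure \<mu> by (rule cmeasure_finite[OF \<mu>])
  interpret N: finite_measure \<nu> by (rule cmeasure_finite[OF \<nu>])
  interpret MNf: finite_measure "\<mu> \<Otimes>\<^sub>M \<nu>" by (rule finite_measure_pair_measure[OF N.finite_measure_axioms M.finite_measure_axioms])
  have [measurable_cong]: "sets \<mu> = sets borel" "sets \<nu> = sets borel" by (rule cmeasure_sets[OF \<mu>] cmeasure_sets[OF \<nu>])+
  obtain C where C: "compact C" "AE s in \<mu>. s \<in> C" using \<mu> by (auto simp: cmeasure_def)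
  obtain D where D: "compact D" "AE s in \<nu>. s \<in> D" using \<nu> by (auto simp: cmeasure_def)
  have "finite_measure (conv \<mu> \<nu>)" unfolding conv_def by (rule MNf.finite_measure_distr) measurable
  moreover have "sets (conv \<mu> \<nu>) = sets borel" by (simp add: conv_def)
  ultimately show ?thesis
    using AE_conv[OF \<mu> \<nu> C(1) D(1) C(2) D(2)] compact_add[OF C(1) D(1)] by (auto simp: cmeasure_def)
qed

lemma cprob_conv:
  fixes \<mu> \<nu> :: "'g::{topological_group_add, second_countable_topology, t2_space} measure"
  assumes \<mu>: "cprob \<mu>" and \<nu>: "cprob \<nu>"
  shows "cprob (conv \<mu> \<nu>)"
proof -
  interpret N: finite_measure \<nu> using \<nu> by (simp add: cprob_def cmeasure_def)
  have [measurable_cong]: "sets \<mu> = sets borel" "sets \<nu> = sets borel"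
    using \<mu> \<nu> by (simp_all add: cprob_def cmeasure_def)
  have "emeasure (conv \<mu> \<nu>) UNIV = emeasure (\<mu> \<Otimes>\<^sub>M \<nu>) (UNIV \<times> UNIV)"
    unfolding conv_def using \<mu> \<nu>
    by (subst emeasure_distr) (auto simp: space_pair_measure cmeasure_space cprob_cmeasure)
  also have "\<dots> = 1" using \<mu> \<nu>
    by (subst N.emeasure_pair_measure_Times) (auto simp: cprob_def)
  finally show ?thesis using \<mu> \<nu> by (simp add: cprob_def cmeasure_conv)
qed

section \<open>Averages over a group with right Haar measure\<close>

lemma integral_norm_le_nn:
  fixes f :: "'a \<Rightarrow> real"
  shows "ennreal \<bar>integral\<^sup>L M f\<bar> \<le> (\<integral>\<^sup>+x. ennreal \<bar>f x\<bar> \<partial>M)"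
proof (cases "integrable M f")
  case True
  then show ?thesis using integral_norm_bound_ennreal[OF True] by simp
qed (simp add: not_integrable_integral_eq)

lemma integral_square_le:
  fixes f :: "'g::topological_space \<Rightarrow> real"
  assumes \<nu>: "cmeasure \<nu>" and [measurable]: "f \<in> borel_measurable borel" and f: "\<And>x. \<bar>f x\<bar> \<le> c"
  shows "(\<integral>s. f s \<partial>\<nu>)\<^sup>2 \<le> measure \<nu> UNIV * (\<integral>s. (f s)\<^sup>2 \<partial>\<nu>)"
proof -
  interpret finite_measure \<nu> by (rule cmeasure_finite[OF \<nu>])
  have [simp]: "space \<nu> = UNIV" by (rule cmeasure_space[OF \<nu>])
  have [simp]: "integrable \<nu> f" by (rule cmeasure_integrable[OF \<nu>, where c = c]) (auto intro: f)
  have [simp]: "integrable \<nu> (\<lambda>s. (f s)\<^sup>2)"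
  proof (rule cmeasure_integrable[OF \<nu>, where c = "c\<^sup>2"])
    show "\<bar>(f x)\<^sup>2\<bar> \<le> c\<^sup>2" for x
      using f[of x] by (simp add: abs_le_square_iff[symmetric])
  qed measurable
  define a m where "a = (\<integral>s. f s \<partial>\<nu>)" and "m = measure \<nu> UNIV"
  show ?thesis
  proof (cases "m = 0")
    case True
    have "\<bar>a\<bar> \<le> (\<integral>s. \<bar>f s\<bar> \<partial>\<nu>)" unfolding a_def by (rule integral_abs_bound)
    also have "\<dots> \<le> (\<integral>s. c \<partial>\<nu>)" by (intro integral_mono) (auto intro: f)
    also have "\<dots> = 0" using True by (simp add: m_def)
    finally show ?thesis using True by (simp add: a_def m_def)
  next
    case False
    then have m: "0 < m" using measure_nonneg[of \<nu> UNIV] by (simp add: m_def less_le)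
    have "0 \<le> (\<integral>s. (f s - a / m)\<^sup>2 \<partial>\<nu>)" by simp
    also have "\<dots> = (\<integral>s. (f s)\<^sup>2 - 2 * (a / m) * f s + (a / m)\<^sup>2 \<partial>\<nu>)"
      by (simp add: power2_diff algebra_simps)
    also have "\<dots> = (\<integral>s. (f s)\<^sup>2 \<partial>\<nu>) - 2 * (a / m) * a + (a / m)\<^sup>2 * m"
      by (simp add: a_def m_def)
    also have "\<dots> = (\<integral>s. (f s)\<^sup>2 \<partial>\<nu>) - a\<^sup>2 / m"
      using m by (simp add: power2_eq_square field_simps)
    finally show ?thesis using m by (simp add: a_def[symmetric] m_def[symmetric] field_simps)
  qed
qed

locale haar_space = sigma_finite_measure h
  for h :: "'g::{topological_group_add, t2_space, second_countable_topology} measure" +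
  assumes sets_h [measurable_cong]: "sets h = sets borel"
    and finite_compact: "compact K \<Longrightarrow> emeasure h K < \<infinity>"
    and inv: "E \<in> sets borel \<Longrightarrow> emeasure h ((\<lambda>x. x + g) ` E) = emeasure h E"
begin

lemma space_h [simp]: "space h = UNIV"
  using sets_eq_imp_space_eq[OF sets_h] by simp

lemma distr_shift: "distr h h (\<lambda>x. x + g) = h"
proof (rule measure_eqI)
  fix E assume "E \<in> sets (distr h h (\<lambda>x. x + g))"
  then have E: "E \<in> sets borel" by (simp add: sets_h)
  have "(\<lambda>x. x + g) -` E = (\<lambda>x. x + - g) ` E"
  proof -
    have "x \<in> (\<lambda>x. x + - g) ` E" if "x + g \<in> E" for x
      using that by (intro image_eqI[of _ _ "x + g"]) (auto simp: add.assoc)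
    then show ?thesis by (auto simp: add.assoc)
  qed
  then show "emeasure (distr h h (\<lambda>x. x + g)) E = emeasure h E"
    using E inv[OF E, of "- g"] by (subst emeasure_distr) (auto simp: sets_h)
qed simp

lemma nn_shift:
  assumes [measurable]: "f \<in> borel_measurable borel"
  shows "(\<integral>\<^sup>+x. f (x + g) \<partial>h) = (\<integral>\<^sup>+x. f x \<partial>h)"
  by (subst (2) distr_shift[symmetric, of g], subst nn_integral_distr) auto

lemma integral_shift:
  fixes f :: "'g \<Rightarrow> real"
  assumes [measurable]: "f \<in> borel_measurable borel"
  shows "(\<integral>x. f (x + g) \<partial>h) = (\<integral>x. f x \<partial>h)"
  by (subst (2) distr_shift[symmetric, of g], subst integral_distr) auto

lemma cbp_integrable:
  assumes f: "cbp f" shows "integrable h f"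
proof -
  note [measurable] = cbp_measurable[OF f]
  obtain c where c: "\<And>x. \<bar>f x\<bar> \<le> c" using cbp_bounded[OF f] by metis
  obtain K where K: "compact K" "\<And>x. x \<notin> K \<Longrightarrow> f x = 0" using cbp_support[OF f] by blast
  show ?thesis
    by (rule integrableI_bounded_set[where A = K and B = c])
      (use K c finite_compact[OF K(1)] borel_compact[OF K(1)] in \<open>auto simp: sets_h\<close>)
qed

lemma pair_sigma_finite_cmeasure: "cmeasure \<nu> \<Longrightarrow> pair_sigma_finite h \<nu>"
  by (intro pair_sigma_finite.intro sigma_finite_measure_axioms finite_measure.axioms(1) cmeasure_finite)

lemma integrable_pair_shift:
  assumes \<nu>: "cmeasure \<nu>" and f: "cbp f"
  shows "integrable (h \<Otimes>\<^sub>M \<nu>) (\<lambda>(x, s). f (x + s))"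
proof -
  interpret pair_sigma_finite h \<nu> by (rule pair_sigma_finite_cmeasure[OF \<nu>])
  interpret N: finite_measure \<nu> by (rule cmeasure_finite[OF \<nu>])
  have [measurable_cong]: "sets \<nu> = sets borel" by (rule cmeasure_sets[OF \<nu>])
  note [measurable] = cbp_measurable[OF f]
  show ?thesis
  proof (rule integrableI_bounded)
    have "(\<integral>\<^sup>+p. ennreal (norm (case p of (x, s) \<Rightarrow> f (x + s))) \<partial>(h \<Otimes>\<^sub>M \<nu>))
        = (\<integral>\<^sup>+s. \<integral>\<^sup>+x. ennreal \<bar>f (x + s)\<bar> \<partial>h \<partial>\<nu>)"
      by (subst nn_integral_snd[symmetric]) (auto simp: case_prod_beta)
    also have "\<dots> = (\<integral>\<^sup>+s. \<integral>\<^sup>+x. ennreal \<bar>f x\<bar> \<partial>h \<partial>\<nu>)"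
      by (subst nn_shift[where f = "\<lambda>x. ennreal \<bar>f x\<bar>"]) auto
    also have "\<dots> < \<infinity>"
      using cbp_integrable[OF f] N.emeasure_finite[of "space \<nu>"]
      by (simp add: integrable_iff_bounded ennreal_mult_eq_top_iff less_top[symmetric])
    finally show "(\<integral>\<^sup>+p. ennreal (norm (case p of (x, s) \<Rightarrow> f (x + s))) \<partial>(h \<Otimes>\<^sub>M \<nu>)) < \<infinity>" .
  qed measurable
qed

lemma integral_av:
  assumes \<nu>: "cmeasure \<nu>" and f: "cbp f"
  shows "(\<integral>x. av \<nu> f x \<partial>h) = measure \<nu> UNIV * (\<integral>x. f x \<partial>h)"
proof -
  interpret pair_sigma_finite h \<nu> by (rule pair_sigma_finite_cmeasure[OF \<nu>])
  note [measurable] = cbp_measurable[OF f]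
  have "(\<integral>x. av \<nu> f x \<partial>h) = (\<integral>s. \<integral>x. f (x + s) \<partial>h \<partial>\<nu>)"
    unfolding av_def using Fubini_integral[OF integrable_pair_shift[OF \<nu> f]] by simp
  also have "\<dots> = (\<integral>s. \<integral>x. f x \<partial>h \<partial>\<nu>)" by (subst integral_shift[where f = f]) auto
  finally show ?thesis by (simp add: cmeasure_space[OF \<nu>])
qed

lemma integral_av_square:
  assumes \<nu>: "cmeasure \<nu>" and f: "cbp f"
  shows "(\<integral>x. (av \<nu> f x)\<^sup>2 \<partial>h) \<le> (measure \<nu> UNIV)\<^sup>2 * (\<integral>x. (f x)\<^sup>2 \<partial>h)"
proof -
  note [measurable] = cbp_measurable[OF f]
  obtain c where c: "\<And>x. \<bar>f x\<bar> \<le> c" using cbp_bounded[OF f] by metis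
  have "(\<integral>x. (av \<nu> f x)\<^sup>2 \<partial>h) \<le> (\<integral>x. measure \<nu> UNIV * av \<nu> (\<lambda>x. (f x)\<^sup>2) x \<partial>h)"
  proof (intro integral_mono cbp_integrable cbp_power2 cbp_scale cbp_av \<nu> f)
    show "(av \<nu> f x)\<^sup>2 \<le> measure \<nu> UNIV * av \<nu> (\<lambda>x. (f x)\<^sup>2) x" for x
      unfolding av_def by (rule integral_square_le[OF \<nu>, where c = c]) (auto intro: c)
  qed
  then show ?thesis by (simp add: integral_av[OF \<nu> cbp_power2[OF f]] power2_eq_square[of "measure \<nu> UNIV"] mult.assoc)
qed

text \<open>Right invariance permits the substitution of \<open>x - s\<close> for \<open>x\<close>,
  which moves the shift from \<open>f\<close> to \<open>g\<close> and reflects it.\<close>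

lemma av_adjoint:
  assumes \<nu>: "cmeasure \<nu>" and f: "cbp f" and g: "cbp g"
  shows "(\<integral>x. av \<nu> f x * g x \<partial>h) = (\<integral>x. f x * av (neg \<nu>) g x \<partial>h)"
proof -
  interpret pair_sigma_finite h \<nu> by (rule pair_sigma_finite_cmeasure[OF \<nu>])
  interpret N: finite_measure \<nu> by (rule cmeasure_finite[OF \<nu>])
  have [measurable_cong]: "sets \<nu> = sets borel" by (rule cmeasure_sets[OF \<nu>])
  note [measurable] = cbp_measurable[OF f] cbp_measurable[OF g]
  \<comment> \<open>Serves both applications of Fubini. One of the two arguments is always
    \<open>x\<close> itself, so the integrand lives on a compact set times the space of \<nu>, which
    has finite measure.\<close>
  have integrable: "integrable (h \<Otimes>\<^sub>M \<nu>) (\<lambda>(x, s). f (u x s) * g (v x s))"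
    if [measurable]: "(\<lambda>p. u (fst p) (snd p)) \<in> borel_measurable (h \<Otimes>\<^sub>M \<nu>)"
      "(\<lambda>p. v (fst p) (snd p)) \<in> borel_measurable (h \<Otimes>\<^sub>M \<nu>)"
      and uv: "(\<forall>x s. u x s = x) \<or> (\<forall>x s. v x s = x)" for u v
  proof -
    obtain c where c: "0 \<le> c" "\<And>x. \<bar>f x\<bar> \<le> c" using cbp_bounded[OF f] by blast
    obtain d where d: "0 \<le> d" "\<And>x. \<bar>g x\<bar> \<le> d" using cbp_bounded[OF g] by blast
    obtain K where K: "compact K" "\<And>x. x \<notin> K \<Longrightarrow> f x = 0" using cbp_support[OF f] by blast
    obtain L where L: "compact L" "\<And>x. x \<notin> L \<Longrightarrow> g x = 0" using cbp_support[OF g] by blast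
    have KL: "compact (K \<union> L)" using K L by (intro compact_Un)
    have sets: "K \<union> L \<in> sets h" using borel_compact[OF KL] by (simp add: sets_h)
    show ?thesis
    proof (rule integrableI_bounded_set[where A = "(K \<union> L) \<times> UNIV" and B = "c * d"])
      show "(K \<union> L) \<times> UNIV \<in> sets (h \<Otimes>\<^sub>M \<nu>)"
        using sets sets.top[of \<nu>] by (intro pair_measureI) (auto simp: cmeasure_space[OF \<nu>])
      have "emeasure (h \<Otimes>\<^sub>M \<nu>) ((K \<union> L) \<times> UNIV) = emeasure h (K \<union> L) * emeasure \<nu> UNIV"
        using sets sets.top[of \<nu>] by (intro M2.emeasure_pair_measure_Times) (auto simp: cmeasure_space[OF \<nu>])
      also have "\<dots> < \<infinity>"
        using finite_compact[OF KL] N.emeasure_finite[of UNIV] by (simp add: ennreal_mult_eq_top_iff less_top[symmetric])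
      finally show "emeasure (h \<Otimes>\<^sub>M \<nu>) ((K \<union> L) \<times> UNIV) < \<infinity>" .
      show "AE p in h \<Otimes>\<^sub>M \<nu>. p \<in> (K \<union> L) \<times> UNIV \<longrightarrow> norm (case p of (x, s) \<Rightarrow> f (u x s) * g (v x s)) \<le> c * d"
        by (auto simp: abs_mult intro!: AE_I2 mult_mono c d)
      show "AE p in h \<Otimes>\<^sub>M \<nu>. p \<notin> (K \<union> L) \<times> UNIV \<longrightarrow> (case p of (x, s) \<Rightarrow> f (u x s) * g (v x s)) = 0"
        using uv K(2) L(2) by (intro AE_I2) (clarsimp, metis)
      have "(\<lambda>p. f (u (fst p) (snd p)) * g (v (fst p) (snd p))) \<in> borel_measurable (h \<Otimes>\<^sub>M \<nu>)"
        by measurable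
      then show "(\<lambda>(x, s). f (u x s) * g (v x s)) \<in> borel_measurable (h \<Otimes>\<^sub>M \<nu>)"
        by (simp add: case_prod_beta')
    qed
  qed
  have "(\<integral>x. av \<nu> f x * g x \<partial>h) = (\<integral>x. \<integral>s. f (x + s) * g x \<partial>\<nu> \<partial>h)"
    by (simp add: av_def)
  also have "\<dots> = (\<integral>s. \<integral>x. f (x + s) * g x \<partial>h \<partial>\<nu>)"
    using Fubini_integral[OF integrable[of "\<lambda>x s. x + s" "\<lambda>x s. x"]] by simp
  also have "\<dots> = (\<integral>s. \<integral>x. f x * g (x - s) \<partial>h \<partial>\<nu>)"
  proof (rule Bochner_Integration.integral_cong[OF refl])
    fix s
    show "(\<integral>x. f (x + s) * g x \<partial>h) = (\<integral>x. f x * g (x - s) \<partial>h)"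
      using integral_shift[of "\<lambda>x. f x * g (x - s)" s] by simp
  qed
  also have "\<dots> = (\<integral>x. \<integral>s. f x * g (x - s) \<partial>\<nu> \<partial>h)"
    using Fubini_integral[OF integrable[of "\<lambda>x s. x" "\<lambda>x s. x - s"]] by simp
  also have "\<dots> = (\<integral>x. f x * av (neg \<nu>) g x \<partial>h)"
    by (simp add: av_neg[OF \<nu>])
  finally show ?thesis .
qed

section \<open>Uniform distributions and their translation errors\<close>

definition unif :: "'g set \<Rightarrow> 'g measure" where
  "unif F = density h (\<lambda>x. ennreal (indicator F x / measure h F))"

lemma measure_pos:
  assumes "compact F" "0 < emeasure h F" shows "0 < measure h F"
  using assms finite_compact[OF assms(1)] by (simp add: measure_def enn2real_positive_iff)

lemma emeasure_compact: "compact F \<Longrightarrow> emeasure h F = ennreal (measure h F)"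
  using finite_compact[of F] by (intro emeasure_eq_ennreal_measure) auto

lemma compact_sets: "compact F \<Longrightarrow> F \<in> sets h"
  using borel_compact by (simp add: sets_h)

lemma cprob_unif:
  assumes F: "compact F" "0 < emeasure h F"
  shows "cprob (unif F)" "AE s in unif F. s \<in> F"
proof -
  have [measurable]: "F \<in> sets h" by (rule compact_sets[OF F(1)])
  note p = measure_pos[OF F]
  have e: "emeasure (unif F) UNIV = 1"
  proof -
    have "emeasure (unif F) UNIV = (\<integral>\<^sup>+x. ennreal (1 / measure h F) * indicator F x \<partial>h)"
      unfolding unif_def using sets.top[of h] by (subst emeasure_density) (auto intro!: nn_integral_cong simp: indicator_def)
    also have "\<dots> = ennreal (1 / measure h F) * ennreal (measure h F)"
      by (subst nn_integral_cmult) (auto simp: emeasure_compact[OF F(1)])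
    also have "\<dots> = 1" using p by (simp flip: ennreal_mult)
    finally show ?thesis .
  qed
  show AE: "AE s in unif F. s \<in> F"
    unfolding unif_def by (subst AE_density) (auto simp: indicator_def)
  have "finite_measure (unif F)" using e by (intro finite_measureI) (simp add: unif_def)
  moreover have "sets (unif F) = sets borel" by (simp add: unif_def sets_h)
  ultimately show "cprob (unif F)" using e AE F by (auto simp: cprob_def cmeasure_def)
qed

lemma integral_unif:
  fixes f :: "'g \<Rightarrow> real"
  assumes "F \<in> sets h" and [measurable]: "f \<in> borel_measurable borel"
  shows "(\<integral>s. f s \<partial>unif F) = (1 / measure h F) * (\<integral>s. indicator F s * f s \<partial>h)"
proof -
  note [measurable] = assms(1)
  have "(\<integral>s. f s \<partial>unif F) = (\<integral>s. (indicator F s / measure h F) *\<^sub>R f s \<partial>h)"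
    unfolding unif_def by (rule integral_density) auto
  also have "\<dots> = (\<integral>s. (1 / measure h F) * (indicator F s * f s) \<partial>h)"
    by simp
  finally show ?thesis by simp
qed

context
  fixes F :: "'g set" and G :: "'g \<Rightarrow> real" and c :: real
  assumes F: "compact F" "0 < emeasure h F" and G [measurable]: "G \<in> borel_measurable borel"
begin

lemma unif_shift: "(\<integral>s. G (s + t) \<partial>unif F) = (1 / measure h F) * (\<integral>u. indicator F (u - t) * G u \<partial>h)"
proof -
  have [measurable]: "F \<in> sets borel" using F borel_compact by auto
  show ?thesis
    using integral_unif[OF compact_sets[OF F(1)], of "\<lambda>s. G (s + t)"]
      integral_shift[of "\<lambda>u. indicator F (u - t) * G u" t] by simp
qed

context
  fixes \<kappa> :: "'g measure"
  assumes \<kappa>: "cprob \<kappa>" and c: "\<And>x. \<bar>G x\<bar> \<le> c"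
begin

lemma unif_shift_swap: "(\<integral>s. \<integral>t. G (s + t) \<partial>\<kappa> \<partial>unif F) = (\<integral>t. \<integral>s. G (s + t) \<partial>unif F \<partial>\<kappa>)"
  and unif_shift_integrable: "integrable \<kappa> (\<lambda>t. \<integral>s. G (s + t) \<partial>unif F)"
proof -
  interpret K: finite_measure \<kappa> using \<kappa> by (simp add: cprob_def cmeasure_def)
  have U: "cprob (unif F)" by (rule cprob_unif[OF F])
  interpret Un: finite_measure "unif F" using U by (simp add: cprob_def cmeasure_def)
  interpret UK: pair_sigma_finite "unif F" \<kappa> ..
  interpret UKf: finite_measure "unif F \<Otimes>\<^sub>M \<kappa>"
    by (rule finite_measure_pair_measure[OF K.finite_measure_axioms Un.finite_measure_axioms])
  have [measurable_cong]: "sets \<kappa> = sets borel" "sets (unif F) = sets borel"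
    using \<kappa> U by (simp_all add: cprob_def cmeasure_def)
  show "(\<integral>s. \<integral>t. G (s + t) \<partial>\<kappa> \<partial>unif F) = (\<integral>t. \<integral>s. G (s + t) \<partial>unif F \<partial>\<kappa>)"
    by (rule UK.Fubini_integral[symmetric])
      (auto intro!: UKf.integrable_const_bound[where B = c] c simp: case_prod_beta)
  show "integrable \<kappa> (\<lambda>t. \<integral>s. G (s + t) \<partial>unif F)"
  proof (rule K.integrable_const_bound[where B = c])
    have "\<bar>\<integral>s. G (s + t) \<partial>unif F\<bar> \<le> c" for t
    proof -
      have "\<bar>\<integral>s. G (s + t) \<partial>unif F\<bar> \<le> (\<integral>s. \<bar>G (s + t)\<bar> \<partial>unif F)" by (rule integral_abs_bound)
      also have "\<dots> \<le> (\<integral>s. c \<partial>unif F)"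
        by (intro integral_mono cmeasure_integrable[OF cprob_cmeasure[OF U], where c = c]) (auto intro: c order_trans[OF abs_ge_zero c])
      also have "\<dots> = c" using cprob_measure[OF U] by (simp add: cmeasure_space[OF cprob_cmeasure[OF U]])
      finally show ?thesis .
    qed
    then show "AE t in \<kappa>. norm (\<integral>s. G (s + t) \<partial>unif F) \<le> c" by simp
  qed measurable
qed

end

end

text \<open>The total variation of the difference between the uniform distribution on a set and its
  convolution with \<open>\<kappa>\<close> is dominated by this measure.\<close>

definition smear :: "'g set \<Rightarrow> 'g measure \<Rightarrow> 'g measure" where
  "smear F \<kappa> = density h (\<lambda>u. \<integral>\<^sup>+t. ennreal (\<bar>indicator F (u - t) - indicator F u\<bar> / measure h F) \<partial>\<kappa>)"

context
  fixes F :: "'g set" and \<kappa> :: "'g measure" and e :: real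
  assumes F: "compact F" "0 < emeasure h F" and \<kappa>: "cprob \<kappa>" and e: "0 \<le> e"
    and close: "AE t in \<kappa>. (\<integral>\<^sup>+u. ennreal (\<bar>indicator F (u - t) - indicator F u\<bar> / measure h F) \<partial>h) \<le> ennreal e"
begin

lemma smear_density_measurable:
  "(\<lambda>u. \<integral>\<^sup>+t. ennreal (\<bar>indicator F (u - t) - indicator F u\<bar> / measure h F) \<partial>\<kappa>) \<in> borel_measurable h"
proof -
  interpret K: finite_measure \<kappa> using \<kappa> by (simp add: cprob_def cmeasure_def)
  have [measurable_cong]: "sets \<kappa> = sets borel" using \<kappa> by (simp add: cprob_def cmeasure_def)
  have [measurable]: "F \<in> sets borel" using F borel_compact by auto
  show ?thesis by measurable
qed

lemma smear_total: "emeasure (smear F \<kappa>) UNIV \<le> ennreal e"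
proof -
  interpret K: finite_measure \<kappa> using \<kappa> by (simp add: cprob_def cmeasure_def)
  interpret pair_sigma_finite h \<kappa> by (rule pair_sigma_finite_cmeasure[OF cprob_cmeasure[OF \<kappa>]])
  have [measurable_cong]: "sets \<kappa> = sets borel" using \<kappa> by (simp add: cprob_def cmeasure_def)
  have [measurable]: "F \<in> sets borel" using F borel_compact by auto
  have "emeasure (smear F \<kappa>) UNIV = (\<integral>\<^sup>+u. \<integral>\<^sup>+t. ennreal (\<bar>indicator F (u - t) - indicator F u\<bar> / measure h F) \<partial>\<kappa> \<partial>h)"
    unfolding smear_def using sets.top[of h] smear_density_measurable by (subst emeasure_density) auto
  also have "\<dots> = (\<integral>\<^sup>+t. \<integral>\<^sup>+u. ennreal (\<bar>indicator F (u - t) - indicator F u\<bar> / measure h F) \<partial>h \<partial>\<kappa>)"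
    by (rule Fubini'[symmetric]) measurable
  also have "\<dots> \<le> (\<integral>\<^sup>+t. ennreal e \<partial>\<kappa>)" by (rule nn_integral_mono_AE[OF close])
  also have "\<dots> = ennreal e" using \<kappa> cmeasure_space[OF cprob_cmeasure[OF \<kappa>]] by (simp add: cprob_def)
  finally show ?thesis .
qed

lemma cmeasure_smear: "cmeasure (smear F \<kappa>)"
proof -
  have [measurable]: "F \<in> sets borel" using F borel_compact by auto
  obtain C where C: "compact C" "AE s in \<kappa>. s \<in> C" using \<kappa> by (auto simp: cprob_def cmeasure_def)
  have FC: "compact (F \<union> (F + C))" using F C by (intro compact_Un compact_add)
  have "AE u in smear F \<kappa>. u \<in> F \<union> (F + C)"
  proof -
    have "u \<in> F \<union> (F + C)" if "0 < (\<integral>\<^sup>+t. ennreal (\<bar>indicator F (u - t) - indicator F u\<bar> / measure h F) \<partial>\<kappa>)" for u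
    proof (rule ccontr)
      assume u: "u \<notin> F \<union> (F + C)"
      have "AE t in \<kappa>. ennreal (\<bar>indicator F (u - t) - indicator F u\<bar> / measure h F) = 0"
        using C(2)
      proof eventually_elim
        case (elim t)
        have "u - t \<notin> F"
        proof
          assume "u - t \<in> F"
          then have "(u - t) + t \<in> F + C" using elim by blast
          then show False using u by simp
        qed
        then show ?case using u by simp
      qed
      then have "(\<integral>\<^sup>+t. ennreal (\<bar>indicator F (u - t) - indicator F u\<bar> / measure h F) \<partial>\<kappa>) = (\<integral>\<^sup>+t. 0 \<partial>\<kappa>)"
        by (rule nn_integral_cong_AE)
      then show False using that by simp
    qed
    then show ?thesis
      unfolding smear_def by (subst AE_density[OF smear_density_measurable]) auto
  qed
  moreover have "finite_measure (smear F \<kappa>)"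
    using smear_total by (intro finite_measureI) (auto simp: smear_def top_unique)
  moreover have "sets (smear F \<kappa>) = sets borel" by (simp add: smear_def sets_h)
  ultimately show ?thesis using FC by (auto simp: cmeasure_def)
qed

lemma smear_measure: "measure (smear F \<kappa>) UNIV \<le> e"
  unfolding measure_def using smear_total e by (rule enn2real_leI[rotated])

text \<open>After a change of variables both integrals are taken against \<open>h\<close>, and the
  triangle inequality is applied inside. \<open>G\<close> is arbitrary because it is used with
  \<open>f (x + u)\<close> for absorption by the average and with \<open>f (x - u)\<close> for
  absorption by its adjoint.\<close>

lemma smear_bound:
  fixes G :: "'g \<Rightarrow> real"
  assumes [measurable]: "G \<in> borel_measurable borel" and G: "\<And>x. \<bar>G x\<bar> \<le> c"
  shows "\<bar>(\<integral>s. \<integral>t. G (s + t) \<partial>\<kappa> \<partial>unif F) - (\<integral>s. G s \<partial>unif F)\<bar> \<le> (\<integral>u. \<bar>G u\<bar> \<partial>smear F \<kappa>)"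
proof -
  interpret K: finite_measure \<kappa> using \<kappa> by (simp add: cprob_def cmeasure_def)
  interpret hK: pair_sigma_finite h \<kappa> by (rule pair_sigma_finite_cmeasure[OF cprob_cmeasure[OF \<kappa>]])
  have [measurable_cong]: "sets \<kappa> = sets borel" using \<kappa> by (simp add: cprob_def cmeasure_def)
  have [measurable]: "F \<in> sets borel" using F borel_compact by auto
  have Fint: "integrable h (\<lambda>u. indicator F (u - t) * G u)" for t
  proof (rule integrableI_bounded_set[where A = "F + {t}" and B = c])
    have "compact (F + {t})" using F by (intro compact_add) auto
    then show "F + {t} \<in> sets h" "emeasure h (F + {t}) < \<infinity>" using compact_sets finite_compact by auto
    show "AE u in h. u \<notin> F + {t} \<longrightarrow> indicator F (u - t) * G u = 0"
    proof (intro AE_I2 impI)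
      fix u assume u: "u \<notin> F + {t}"
      have "u - t \<notin> F"
      proof
        assume "u - t \<in> F"
        then have "(u - t) + t \<in> F + {t}" by blast
        then show False using u by simp
      qed
      then show "indicator F (u - t) * G u = 0" by simp
    qed
    have "0 \<le> c" using G[of 0] abs_ge_zero[of "G 0"] by linarith
    then show "AE u in h. u \<in> F + {t} \<longrightarrow> norm (indicator F (u - t) * G u) \<le> c"
      using G by (auto simp: indicator_def)
  qed measurable
  note inner = unif_shift[OF F assms(1)]
  have inner0: "(\<integral>s. G s \<partial>unif F) = (1 / measure h F) * (\<integral>u. indicator F u * G u \<partial>h)"
    using inner[of 0] by simp
  note swap = unif_shift_swap[OF F assms(1) \<kappa> G] and iK = unif_shift_integrable[OF F assms(1) \<kappa> G]
  have diff: "(\<integral>s. \<integral>t. G (s + t) \<partial>\<kappa> \<partial>unif F) - (\<integral>s. G s \<partial>unif F)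
      = (\<integral>t. (\<integral>s. G (s + t) \<partial>unif F) - (\<integral>s. G s \<partial>unif F) \<partial>\<kappa>)"
    unfolding swap using iK cprob_measure[OF \<kappa>] by (simp add: cmeasure_space[OF cprob_cmeasure[OF \<kappa>]])
  have pt: "(\<integral>s. G (s + t) \<partial>unif F) - (\<integral>s. G s \<partial>unif F)
      = (\<integral>u. (indicator F (u - t) - indicator F u) / measure h F * G u \<partial>h)" for t
  proof -
    have "(\<integral>s. G (s + t) \<partial>unif F) - (\<integral>s. G s \<partial>unif F)
        = (1 / measure h F) * ((\<integral>u. indicator F (u - t) * G u \<partial>h) - (\<integral>u. indicator F (u - 0) * G u \<partial>h))"
      unfolding inner inner0 by (simp add: right_diff_distrib)
    also have "(\<integral>u. indicator F (u - t) * G u \<partial>h) - (\<integral>u. indicator F (u - 0) * G u \<partial>h)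
        = (\<integral>u. indicator F (u - t) * G u - indicator F (u - 0) * G u \<partial>h)"
      by (rule Bochner_Integration.integral_diff[symmetric]) (rule Fint)+
    also have "(1 / measure h F) * \<dots> = (\<integral>u. (1 / measure h F) * (indicator F (u - t) * G u - indicator F (u - 0) * G u) \<partial>h)"
      by simp
    finally show ?thesis by (simp add: left_diff_distrib)
  qed
  have "ennreal \<bar>(\<integral>s. \<integral>t. G (s + t) \<partial>\<kappa> \<partial>unif F) - (\<integral>s. G s \<partial>unif F)\<bar>
      \<le> (\<integral>\<^sup>+t. ennreal \<bar>(\<integral>s. G (s + t) \<partial>unif F) - (\<integral>s. G s \<partial>unif F)\<bar> \<partial>\<kappa>)"
    unfolding diff by (rule integral_norm_le_nn)
  also have "\<dots> \<le> (\<integral>\<^sup>+t. \<integral>\<^sup>+u. ennreal (\<bar>indicator F (u - t) - indicator F u\<bar> / measure h F) * ennreal \<bar>G u\<bar> \<partial>h \<partial>\<kappa>)"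
    unfolding pt
    by (intro nn_integral_mono order_trans[OF integral_norm_le_nn])
      (auto simp: abs_mult ennreal_mult[symmetric])
  also have "\<dots> = (\<integral>\<^sup>+u. \<integral>\<^sup>+t. ennreal (\<bar>indicator F (u - t) - indicator F u\<bar> / measure h F) * ennreal \<bar>G u\<bar> \<partial>\<kappa> \<partial>h)"
    by (rule hK.Fubini') measurable
  also have "\<dots> = (\<integral>\<^sup>+u. (\<integral>\<^sup>+t. ennreal (\<bar>indicator F (u - t) - indicator F u\<bar> / measure h F) \<partial>\<kappa>) * ennreal \<bar>G u\<bar> \<partial>h)"
    by (intro nn_integral_cong nn_integral_multc) measurable
  also have "\<dots> = (\<integral>\<^sup>+u. ennreal \<bar>G u\<bar> \<partial>smear F \<kappa>)"
    unfolding smear_def by (rule nn_integral_density[symmetric, OF smear_density_measurable]) measurable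
  also have "\<dots> = ennreal (\<integral>u. \<bar>G u\<bar> \<partial>smear F \<kappa>)"
    by (intro nn_integral_eq_integral cmeasure_integrable[OF cmeasure_smear, where c = c]) (auto intro: G)
  finally show ?thesis by (simp add: ennreal_le_iff)
qed

lemma av_absorb_right:
  assumes f: "cbp f"
  shows "\<bar>av (unif F) (av \<kappa> f) x - av (unif F) f x\<bar> \<le> av (smear F \<kappa>) (\<lambda>x. \<bar>f x\<bar>) x"
proof -
  note [measurable] = cbp_measurable[OF f]
  obtain c where c: "\<And>x. \<bar>f x\<bar> \<le> c" using cbp_bounded[OF f] by metis
  show ?thesis
    using smear_bound[of "\<lambda>u. f (x + u)" c] c by (simp add: av_def add.assoc)
qed

end

text \<open>Since \<open>x + t - s = x - (s + - t)\<close>, a move by \<open>t\<close> in front of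
  the adjoint average is a right translation of \<open>s\<close> by \<open>- t\<close>. This is why
  the left-hand absorption holds for the adjoint, and why \<open>neg \<kappa>\<close>
  appears.\<close>

lemma av_absorb_left:
  fixes e :: real
  assumes F: "compact F" "0 < emeasure h F" and \<kappa>: "cprob \<kappa>" and e: "0 \<le> e"
    and close: "AE t in neg \<kappa>. (\<integral>\<^sup>+u. ennreal (\<bar>indicator F (u - t) - indicator F u\<bar> / measure h F) \<partial>h) \<le> ennreal e"
    and f: "cbp f"
  shows "\<bar>av \<kappa> (av (neg (unif F)) f) x - av (neg (unif F)) f x\<bar> \<le> av (neg (smear F (neg \<kappa>))) (\<lambda>x. \<bar>f x\<bar>) x"
proof -
  note \<kappa>n = cprob_cmeasure[OF \<kappa>]
  have U: "cprob (unif F)" by (rule cprob_unif[OF F])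
  note Un = cprob_cmeasure[OF U]
  note [measurable] = cbp_measurable[OF f]
  obtain c where c: "\<And>x. \<bar>f x\<bar> \<le> c" using cbp_bounded[OF f] by metis
  interpret K: finite_measure \<kappa> by (rule cmeasure_finite[OF \<kappa>n])
  interpret Un: finite_measure "unif F" by (rule cmeasure_finite[OF Un])
  interpret UK: pair_sigma_finite "unif F" \<kappa> ..
  interpret UKf: finite_measure "unif F \<Otimes>\<^sub>M \<kappa>"
    by (rule finite_measure_pair_measure[OF K.finite_measure_axioms Un.finite_measure_axioms])
  have [measurable_cong]: "sets \<kappa> = sets borel" "sets (unif F) = sets borel"
    using \<kappa>n Un by (simp_all add: cmeasure_def)
  have "av \<kappa> (av (neg (unif F)) f) x = (\<integral>t. \<integral>s. f (x + t - s) \<partial>unif F \<partial>\<kappa>)"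
    unfolding av_def[of \<kappa>] by (simp add: av_neg[OF Un])
  also have "\<dots> = (\<integral>s. \<integral>t. f (x + t - s) \<partial>\<kappa> \<partial>unif F)"
    by (rule UK.Fubini_integral)
      (auto intro!: UKf.integrable_const_bound[where B = c] c simp: case_prod_beta)
  also have "\<dots> = (\<integral>s. \<integral>t. f (x - (s + t)) \<partial>neg \<kappa> \<partial>unif F)"
  proof (rule Bochner_Integration.integral_cong[OF refl])
    fix s
    have "(\<integral>t. f (x - (s + t)) \<partial>neg \<kappa>) = (\<integral>t. f (x - (s + - t)) \<partial>\<kappa>)"
      by (rule integral_neg[OF \<kappa>n]) measurable
    also have "\<dots> = (\<integral>t. f (x + t - s) \<partial>\<kappa>)"
      by (simp add: diff_diff_eq2)
    finally show "(\<integral>t. f (x + t - s) \<partial>\<kappa>) = (\<integral>t. f (x - (s + t)) \<partial>neg \<kappa>)" by simp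
  qed
  finally have 1: "av \<kappa> (av (neg (unif F)) f) x = (\<integral>s. \<integral>t. f (x - (s + t)) \<partial>neg \<kappa> \<partial>unif F)" .
  have 2: "av (neg (unif F)) f x = (\<integral>s. f (x - s) \<partial>unif F)" by (simp add: av_neg[OF Un])
  have 3: "av (neg (smear F (neg \<kappa>))) (\<lambda>x. \<bar>f x\<bar>) x = (\<integral>u. \<bar>f (x - u)\<bar> \<partial>smear F (neg \<kappa>))"
    by (rule av_neg[OF cmeasure_smear[OF F cprob_neg[OF \<kappa>] e close]]) measurable
  show ?thesis unfolding 1 2 3
    by (rule smear_bound[OF F cprob_neg[OF \<kappa>] e close, where c = c]) (auto intro: c)
qed

text \<open>The error is dominated pointwise by an average of |f| of mass at most \<open>e\<close>,
  which gives the bounds in L^1 and L^2 together.\<close>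

lemma absorb_right_bounds:
  fixes e :: real
  assumes F: "compact F" "0 < emeasure h F" and \<kappa>: "cprob \<kappa>" and e: "0 \<le> e"
    and close: "AE t in \<kappa>. (\<integral>\<^sup>+u. ennreal (\<bar>indicator F (u - t) - indicator F u\<bar> / measure h F) \<partial>h) \<le> ennreal e"
    and f: "cbp f"
  shows "(\<integral>x. \<bar>av (unif F) (av \<kappa> f) x - av (unif F) f x\<bar> \<partial>h) \<le> e * (\<integral>x. \<bar>f x\<bar> \<partial>h)" (is ?L1)
    and "(\<integral>x. (av (unif F) (av \<kappa> f) x - av (unif F) f x)\<^sup>2 \<partial>h) \<le> e\<^sup>2 * (\<integral>x. (f x)\<^sup>2 \<partial>h)" (is ?L2)
proof -
  note S = cmeasure_smear[OF F \<kappa> e close]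
  note U = cprob_cmeasure[OF cprob_unif(1)[OF F]]
  note \<kappa>n = cprob_cmeasure[OF \<kappa>]
  note bd = av_absorb_right[OF F \<kappa> e close f]
  have m: "measure (smear F \<kappa>) UNIV \<le> e" by (rule smear_measure[OF F \<kappa> e close])
  have "(\<integral>x. \<bar>av (unif F) (av \<kappa> f) x - av (unif F) f x\<bar> \<partial>h) \<le> (\<integral>x. av (smear F \<kappa>) (\<lambda>x. \<bar>f x\<bar>) x \<partial>h)"
    by (intro integral_mono bd cbp_integrable cbp_abs cbp_diff cbp_av U \<kappa>n f S)
  also have "\<dots> \<le> e * (\<integral>x. \<bar>f x\<bar> \<partial>h)"
    unfolding integral_av[OF S cbp_abs[OF f]] by (intro mult_right_mono m) simp
  finally show ?L1 .
  have "(\<integral>x. (av (unif F) (av \<kappa> f) x - av (unif F) f x)\<^sup>2 \<partial>h) \<le> (\<integral>x. (av (smear F \<kappa>) (\<lambda>x. \<bar>f x\<bar>) x)\<^sup>2 \<partial>h)"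
  proof (intro integral_mono cbp_integrable cbp_abs cbp_diff cbp_av cbp_power2 U \<kappa>n f S)
    show "(av (unif F) (av \<kappa> f) x - av (unif F) f x)\<^sup>2 \<le> (av (smear F \<kappa>) (\<lambda>x. \<bar>f x\<bar>) x)\<^sup>2" for x
      using bd[of x] by (auto intro!: abs_le_square_iff[THEN iffD1])
  qed
  also have "\<dots> \<le> (measure (smear F \<kappa>) UNIV)\<^sup>2 * (\<integral>x. \<bar>f x\<bar>\<^sup>2 \<partial>h)"
    by (rule integral_av_square[OF S cbp_abs[OF f]])
  also have "\<dots> \<le> e\<^sup>2 * (\<integral>x. (f x)\<^sup>2 \<partial>h)"
    using m by (simp add: mult_right_mono power_mono)
  finally show ?L2 .
qed

lemma absorb_left_bound:
  fixes e :: real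
  assumes F: "compact F" "0 < emeasure h F" and \<kappa>: "cprob \<kappa>" and e: "0 \<le> e"
    and close: "AE t in neg \<kappa>. (\<integral>\<^sup>+u. ennreal (\<bar>indicator F (u - t) - indicator F u\<bar> / measure h F) \<partial>h) \<le> ennreal e"
    and f: "cbp f"
  shows "(\<integral>x. \<bar>av \<kappa> (av (neg (unif F)) f) x - av (neg (unif F)) f x\<bar> \<partial>h) \<le> e * (\<integral>x. \<bar>f x\<bar> \<partial>h)"
proof -
  note S = cmeasure_smear[OF F cprob_neg[OF \<kappa>] e close]
  note U = cmeasure_neg[OF cprob_cmeasure[OF cprob_unif(1)[OF F]]]
  note \<kappa>n = cprob_cmeasure[OF \<kappa>]
  have m: "measure (neg (smear F (neg \<kappa>))) UNIV \<le> e"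
    using smear_measure[OF F cprob_neg[OF \<kappa>] e close] neg_UNIV[OF S] by (simp add: measure_def)
  have "(\<integral>x. \<bar>av \<kappa> (av (neg (unif F)) f) x - av (neg (unif F)) f x\<bar> \<partial>h)
      \<le> (\<integral>x. av (neg (smear F (neg \<kappa>))) (\<lambda>x. \<bar>f x\<bar>) x \<partial>h)"
    by (intro integral_mono av_absorb_left[OF F \<kappa> e close f] cbp_integrable cbp_abs cbp_diff cbp_av U \<kappa>n f cmeasure_neg[OF S])
  also have "\<dots> \<le> e * (\<integral>x. \<bar>f x\<bar> \<partial>h)"
    unfolding integral_av[OF cmeasure_neg[OF S] cbp_abs[OF f]] by (intro mult_right_mono m) simp
  finally show ?thesis .
qed

end

text \<open>A type of its own carries the structure of a \<open>real_vector\<close>, as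
  \<open>semi_inner\<close> demands.\<close>

typedef (overloaded) 'g cb = "{f :: 'g::topological_space \<Rightarrow> real. cbp f}"
  morphisms cb_fun Abs_cb
  using cbp_zero by auto

setup_lifting type_definition_cb

instantiation cb :: (topological_space) real_vector
begin

lift_definition zero_cb :: "'a cb" is "\<lambda>_. 0" by (rule cbp_zero)
lift_definition plus_cb :: "'a cb \<Rightarrow> 'a cb \<Rightarrow> 'a cb" is "\<lambda>f g x. f x + g x" by (rule cbp_add)
lift_definition minus_cb :: "'a cb \<Rightarrow> 'a cb \<Rightarrow> 'a cb" is "\<lambda>f g x. f x - g x" by (rule cbp_diff)
lift_definition uminus_cb :: "'a cb \<Rightarrow> 'a cb" is "\<lambda>f x. - f x" by (rule cbp_minus)
lift_definition scaleR_cb :: "real \<Rightarrow> 'a cb \<Rightarrow> 'a cb" is "\<lambda>c f x. c * f x" by (rule cbp_scale)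

instance
  by standard (transfer; auto simp: fun_eq_iff algebra_simps)+

end

lemma cb_fun_cbp: "cbp (cb_fun f)"
  using cb_fun[of f] by simp

lemma cb_fun_Abs: "cbp f \<Longrightarrow> cb_fun (Abs_cb f) = f"
  by (simp add: Abs_cb_inverse)

section \<open>Averages as operators on an inner product space\<close>

context haar_space
begin

definition ip :: "'g cb \<Rightarrow> 'g cb \<Rightarrow> real" where
  "ip f g = (\<integral>x. cb_fun f x * cb_fun g x \<partial>h)"

definition avop :: "'g measure \<Rightarrow> 'g cb \<Rightarrow> 'g cb" where
  "avop \<nu> f = Abs_cb (av \<nu> (cb_fun f))"

lemma cb_fun_avop: "cmeasure \<nu> \<Longrightarrow> cb_fun (avop \<nu> f) = av \<nu> (cb_fun f)"
  by (simp add: avop_def cb_fun_Abs cbp_av cb_fun_cbp)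

sublocale ip: semi_inner ip
proof
  fix x y z :: "'g cb" and c :: real
  have i: "integrable h (\<lambda>t. cb_fun f t * cb_fun g t)" for f g
    by (intro cbp_integrable cbp_mult cb_fun_cbp)
  show "ip (x + y) z = ip x z + ip y z"
    unfolding ip_def by (simp add: plus_cb.rep_eq distrib_right i)
  show "ip (c *\<^sub>R x) z = c * ip x z"
    unfolding ip_def by (simp add: scaleR_cb.rep_eq mult.assoc)
  show "ip x y = ip y x" unfolding ip_def by (simp add: mult.commute)
  show "0 \<le> ip x x" unfolding ip_def by simp
qed

lemma N_square_integral: "(ip.N f)\<^sup>2 = (\<integral>x. (cb_fun f x)\<^sup>2 \<partial>h)"
  unfolding ip.N_square ip_def by (simp add: power2_eq_square)

lemma linear_avop: "cmeasure \<nu> \<Longrightarrow> linear (avop \<nu>)"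
  by (intro linearI; subst cb_fun_inject[symmetric])
    (auto simp: cb_fun_avop plus_cb.rep_eq scaleR_cb.rep_eq av_add av_scale cb_fun_cbp fun_eq_iff)

lemma contraction_avop:
  assumes \<nu>: "cprob \<nu>" shows "ip.N (avop \<nu> f) \<le> ip.N f"
proof (rule power2_le_imp_le)
  show "(ip.N (avop \<nu> f))\<^sup>2 \<le> (ip.N f)\<^sup>2"
    using integral_av_square[OF cprob_cmeasure[OF \<nu>] cb_fun_cbp[of f]]
    by (simp add: N_square_integral cb_fun_avop cprob_cmeasure[OF \<nu>] cprob_measure[OF \<nu>])
qed simp

lemma adjoint_avop: "cmeasure \<nu> \<Longrightarrow> ip (avop \<nu> f) g = ip f (avop (neg \<nu>) g)"
  unfolding ip_def by (simp add: cb_fun_avop cmeasure_neg av_adjoint cb_fun_cbp)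

text \<open>For every \<open>t\<close> in the support of \<kappa> the translate of \<open>F\<close>
  by \<open>t\<close> stays inside \<open>F'\<close>, so each of the averaged integrals is at most
  the one over \<open>F'\<close>, still normalised by the measure of \<open>F\<close>.\<close>

lemma av_dominate:
  assumes F: "compact F" "0 < emeasure h F" and \<kappa>: "cprob \<kappa>" and b: "cbp b" "\<And>x. 0 \<le> b x"
    and C: "AE t in \<kappa>. t \<in> C" and FC: "F + C \<subseteq> F'" and F': "compact F'"
  shows "av (unif F) (av \<kappa> b) x \<le> (1 / measure h F) * (\<integral>s. indicator F' s * b (x + s) \<partial>h)"
proof -
  interpret K: finite_measure \<kappa> using \<kappa> by (simp add: cprob_def cmeasure_def)
  have [measurable]: "F \<in> sets borel" "F' \<in> sets borel" using F F' borel_compact by auto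
  note [measurable] = cbp_measurable[OF b(1)]
  obtain c where c: "\<And>x. \<bar>b x\<bar> \<le> c" using cbp_bounded[OF b(1)] by metis
  note conv = unif_shift_swap[OF F _ \<kappa>, where G = "\<lambda>u. b (x + u)" and c = c]
    unif_shift_integrable[OF F _ \<kappa>, where G = "\<lambda>u. b (x + u)" and c = c]
    unif_shift[OF F, where G = "\<lambda>u. b (x + u)"]
  define V where "V = (1 / measure h F) * (\<integral>s. indicator F' s * b (x + s) \<partial>h)"
  have int: "integrable h (\<lambda>s. indicator A s * b (x + s))" if "compact A" for A
  proof (rule integrableI_bounded_set[where A = A and B = c])
    show "A \<in> sets h" "emeasure h A < \<infinity>" using that compact_sets finite_compact by auto
    then show "(\<lambda>s. indicator A s * b (x + s)) \<in> borel_measurable h" by measurable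
    show "AE s in h. s \<in> A \<longrightarrow> norm (indicator A s * b (x + s)) \<le> c" using c by auto
  qed auto
  have "av (unif F) (av \<kappa> b) x = (\<integral>t. \<integral>s. b (x + (s + t)) \<partial>unif F \<partial>\<kappa>)"
    using conv(1) c by (simp add: av_def add.assoc)
  also have "\<dots> \<le> (\<integral>t. V \<partial>\<kappa>)"
  proof (rule integral_mono_AE)
    show "integrable \<kappa> (\<lambda>t. \<integral>s. b (x + (s + t)) \<partial>unif F)" using conv(2) c by simp
    show "AE t in \<kappa>. (\<integral>s. b (x + (s + t)) \<partial>unif F) \<le> V"
      using C
    proof eventually_elim
      case (elim t)
      have "(\<integral>s. b (x + (s + t)) \<partial>unif F) = (1 / measure h F) * (\<integral>u. indicator F (u - t) * b (x + u) \<partial>h)"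
        by (rule conv(3)) measurable
      also have "(\<integral>u. indicator F (u - t) * b (x + u) \<partial>h) \<le> (\<integral>u. indicator F' u * b (x + u) \<partial>h)"
      proof (rule integral_mono)
        have sub: "u - t \<in> F \<Longrightarrow> u \<in> F'" for u
        proof -
          assume "u - t \<in> F"
          then have "(u - t) + t \<in> F + C" using elim by blast
          then show ?thesis using FC by auto
        qed
        show "indicator F (u - t) * b (x + u) \<le> indicator F' u * b (x + u)" for u
          using sub[of u] b(2)[of "x + u"] by (auto simp: indicator_def)
        show "integrable h (\<lambda>u. indicator F' u * b (x + u))" by (rule int[OF F'])
        then show "integrable h (\<lambda>u. indicator F (u - t) * b (x + u))"
          by (rule Bochner_Integration.integrable_bound)
            (use sub b(2) in \<open>auto simp: indicator_def intro!: AE_I2\<close>)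
      qed
      finally show ?case by (simp add: V_def divide_right_mono)
    qed
  qed simp
  also have "\<dots> = V" using cprob_measure[OF \<kappa>] by (simp add: cmeasure_space[OF cprob_cmeasure[OF \<kappa>]])
  finally show ?thesis by (simp add: V_def)
qed

end

text \<open>\<open>W i\<close> will be \<open>sym_union F i\<close>. At \<open>n = i + 3\<close> the
  ratio in \<open>W_inv\<close> is 1, so there the product with four factors \<open>W i\<close> at
  most doubles the measure of \<open>F n\<close>.\<close>

locale folner_inv = haar_space h
  for h :: "'g::{topological_group_add, t2_space, second_countable_topology} measure" +
  fixes F W :: "nat \<Rightarrow> 'g set"
  assumes F_compact: "compact (F n)" and F_pos: "0 < emeasure h (F n)"
    and W_compact: "compact (W i)" and W_zero: "0 \<in> W i"
    and W_F: "n \<le> i \<Longrightarrow> F n \<subseteq> W i" and W_negF: "n \<le> i \<Longrightarrow> uminus ` F n \<subseteq> W i"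
    and W_inv: "i + 3 \<le> n \<Longrightarrow>
      emeasure h ((F n + W i + W i + W i + W i) - F n) \<le> ennreal (2 ^ (i + 3) / 2 ^ n) * emeasure h (F n)"
begin

abbreviation "m n \<equiv> measure h (F n)"
abbreviation "U n \<equiv> unif (F n)"

lemma m_pos: "0 < m n"
  by (rule measure_pos[OF F_compact F_pos])

lemma cprob_U: "cprob (U n)" and U_supp: "AE s in U n. s \<in> F n"
  by (rule cprob_unif[OF F_compact F_pos])+

lemmas cmeasure_U = cprob_cmeasure[OF cprob_U]

lemmas cmeasure_negU = cmeasure_neg[OF cmeasure_U]

lemmas cprob_negU = cprob_neg[OF cprob_U]

lemma negU_supp: "AE s in neg (U n). s \<in> uminus ` F n"
proof -
  have s: "uminus ` F n \<in> sets borel" by (intro borel_compact compact_neg F_compact)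
  have [measurable_cong]: "sets (U n) = sets borel" by (rule cmeasure_sets[OF cmeasure_U])
  show ?thesis unfolding neg_def
  proof (subst AE_distr_iff)
    show "{x \<in> space borel. x \<in> uminus ` F n} \<in> sets borel" using s by simp
    show "AE x in U n. - x \<in> uminus ` F n" using U_supp by eventually_elim auto
  qed measurable
qed

text \<open>The translate has the same measure as \<open>F n\<close>, so the symmetric difference is
  twice the one-sided one: 16 = 2 * 8. If \<open>n < i + 3\<close>, the one-sided bound exceeds the
  measure of \<open>F n\<close> and is trivial.\<close>

lemma shift_close:
  assumes t: "t \<in> W i"
  shows "(\<integral>\<^sup>+u. ennreal (\<bar>indicator (F n) (u - t) - indicator (F n) u\<bar> / m n) \<partial>h) \<le> ennreal (16 * 2^i / 2^n)"
proof -
  define A where "A = F n" define C where "C = A + {t}"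
  have A: "compact A" and C: "compact C" unfolding A_def C_def by (auto intro!: compact_add F_compact)
  have sA [measurable]: "A \<in> sets h" and sC [measurable]: "C \<in> sets h" using compact_sets A C by auto
  have memC: "u \<in> C \<longleftrightarrow> u - t \<in> A" for u
  proof
    assume "u - t \<in> A"
    then have "(u - t) + t \<in> A + {t}" by blast
    then show "u \<in> C" by (simp add: C_def)
  qed (auto simp: C_def set_plus_def)
  have CA: "C = (\<lambda>x. x + t) ` A" by (auto simp: C_def set_plus_def)
  have eq: "emeasure h C = emeasure h A"
    unfolding CA using inv[of A t] sA by (simp add: sets_h)
  have "emeasure h (C - A) + emeasure h (A \<inter> C) = emeasure h (A - C) + emeasure h (A \<inter> C)"
  proof -
    have "emeasure h (C - A) + emeasure h (A \<inter> C) = emeasure h C"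
      by (subst plus_emeasure) (auto intro!: arg_cong[of _ _ "emeasure h"])
    moreover have "emeasure h (A - C) + emeasure h (A \<inter> C) = emeasure h A"
      by (subst plus_emeasure) (auto intro!: arg_cong[of _ _ "emeasure h"])
    ultimately show ?thesis using eq by simp
  qed
  moreover have "emeasure h (A \<inter> C) \<noteq> \<infinity>"
  proof -
    have "emeasure h (A \<inter> C) \<le> emeasure h A" using sA by (intro emeasure_mono) auto
    then show ?thesis using finite_compact[OF A] by (auto simp: top_unique)
  qed
  ultimately have sym: "emeasure h (A - C) = emeasure h (C - A)" by simp
  have bound: "emeasure h (C - A) \<le> ennreal (8 * 2^i / 2^n * m n)"
  proof (cases "i + 3 \<le> n")
    case True
    have "C \<subseteq> F n + W i + W i + W i + W i"
    proof
      fix x assume "x \<in> C"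
      then obtain a where a: "a \<in> F n" "x = a + t" by (auto simp: C_def A_def set_plus_def)
      then have "x = a + t + 0 + 0 + 0" by simp
      then show "x \<in> F n + W i + W i + W i + W i"
        using a t W_zero by (metis set_plus_intro)
    qed
    then have "emeasure h (C - A) \<le> emeasure h ((F n + W i + W i + W i + W i) - F n)"
      by (intro emeasure_mono sets.Diff compact_sets compact_add F_compact W_compact) (auto simp: A_def)
    also have "\<dots> \<le> ennreal (2 ^ (i + 3) / 2 ^ n) * emeasure h (F n)" by (rule W_inv[OF True])
    also have "\<dots> = ennreal (8 * 2^i / 2^n * m n)"
      by (simp add: emeasure_compact[OF F_compact] power_add mult.commute flip: ennreal_mult)
    finally show ?thesis .
  next
    case False
    have "emeasure h (C - A) \<le> emeasure h C" by (intro emeasure_mono) auto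
    also have "\<dots> = ennreal (m n)" using eq by (simp add: A_def emeasure_compact[OF F_compact])
    also have "\<dots> \<le> ennreal (8 * 2^i / 2^n * m n)"
    proof -
      have "(2::real)^n \<le> 2^(i+3)" using False by (intro power_increasing) auto
      then have "1 \<le> 8 * (2::real)^i / 2^n" by (simp add: power_add field_simps)
      then show ?thesis using m_pos[of n] by (intro ennreal_leI) (simp only: mult_le_cancel_right1, simp)
    qed
    finally show ?thesis .
  qed
  have "(\<integral>\<^sup>+u. ennreal (\<bar>indicator A (u - t) - indicator A u\<bar> / m n) \<partial>h)
      = (\<integral>\<^sup>+u. ennreal (1 / m n) * (indicator (C - A) u + indicator (A - C) u) \<partial>h)"
    using memC by (intro nn_integral_cong) (auto simp: indicator_def)
  also have "\<dots> = ennreal (1 / m n) * (emeasure h (C - A) + emeasure h (A - C))"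
    by (subst nn_integral_cmult) (auto simp: nn_integral_add)
  also have "\<dots> \<le> ennreal (1 / m n) * (ennreal (8 * 2^i / 2^n * m n) + ennreal (8 * 2^i / 2^n * m n))"
    unfolding sym by (intro mult_left_mono add_mono bound) auto
  also have "\<dots> = ennreal (16 * 2^i / 2^n)"
    using m_pos[of n] by (simp flip: ennreal_mult ennreal_plus)
  finally show ?thesis by (simp add: A_def)
qed

lemma close_U: "AE t in U i. (\<integral>\<^sup>+u. ennreal (\<bar>indicator (F n) (u - t) - indicator (F n) u\<bar> / m n) \<partial>h) \<le> ennreal (16 * 2^i / 2^n)"
  using U_supp[of i] W_F[of i i] by (auto elim!: eventually_mono intro!: shift_close)

lemma close_negU: "AE t in neg (U i). (\<integral>\<^sup>+u. ennreal (\<bar>indicator (F n) (u - t) - indicator (F n) u\<bar> / m n) \<partial>h) \<le> ennreal (16 * 2^i / 2^n)"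
  using negU_supp[of i] W_negF[of i i] by (auto elim!: eventually_mono intro!: shift_close)

definition T :: "nat \<Rightarrow> ('g \<Rightarrow> real) \<Rightarrow> 'g \<Rightarrow> real" where "T n = av (U n)"
definition T' :: "nat \<Rightarrow> ('g \<Rightarrow> real) \<Rightarrow> 'g \<Rightarrow> real" where "T' n = av (neg (U n))"

lemma cbp_T: "cbp f \<Longrightarrow> cbp (T n f)" and cbp_T': "cbp f \<Longrightarrow> cbp (T' n f)"
  unfolding T_def T'_def by (rule cbp_av[OF cmeasure_U], assumption) (rule cbp_av[OF cmeasure_negU], assumption)

lemma T_T_L1: "cbp f \<Longrightarrow> (\<integral>x. \<bar>T n (T i f) x - T n f x\<bar> \<partial>h) \<le> 16 * 2^i / 2^n * (\<integral>x. \<bar>f x\<bar> \<partial>h)"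
  unfolding T_def by (rule absorb_right_bounds(1)[OF F_compact F_pos cprob_U _ close_U]) auto

lemma T_T'_L1: "cbp f \<Longrightarrow> (\<integral>x. \<bar>T n (T' i f) x - T n f x\<bar> \<partial>h) \<le> 16 * 2^i / 2^n * (\<integral>x. \<bar>f x\<bar> \<partial>h)"
  unfolding T_def T'_def by (rule absorb_right_bounds(1)[OF F_compact F_pos cprob_negU _ close_negU]) auto

lemma T_T'_left_L1: "cbp f \<Longrightarrow> (\<integral>x. \<bar>T i (T' n f) x - T' n f x\<bar> \<partial>h) \<le> 16 * 2^i / 2^n * (\<integral>x. \<bar>f x\<bar> \<partial>h)"
  unfolding T_def T'_def by (rule absorb_left_bound[OF F_compact F_pos cprob_U _ close_negU]) auto

definition Top :: "nat \<Rightarrow> 'g cb \<Rightarrow> 'g cb" where "Top n = avop (U n)"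
definition Top' :: "nat \<Rightarrow> 'g cb \<Rightarrow> 'g cb" where "Top' n = avop (neg (U n))"

lemma cb_fun_Top: "cb_fun (Top n f) = T n (cb_fun f)"
  by (simp add: Top_def T_def cb_fun_avop cmeasure_U)

lemma Top_absorb:
  shows Top_Top: "ip.N (Top n (Top i f) - Top n f) \<le> 16 * 2^i / 2^n * ip.N f"
    and Top_Top': "ip.N (Top n (Top' i f) - Top n f) \<le> 16 * 2^i / 2^n * ip.N f"
proof -
  have *: "(\<integral>x. (T n (T i (cb_fun f)) x - T n (cb_fun f) x)\<^sup>2 \<partial>h) \<le> (16 * 2^i / 2^n)\<^sup>2 * (\<integral>x. (cb_fun f x)\<^sup>2 \<partial>h)"
    unfolding T_def by (rule absorb_right_bounds(2)[OF F_compact F_pos cprob_U _ close_U cb_fun_cbp]) auto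
  have **: "(\<integral>x. (T n (T' i (cb_fun f)) x - T n (cb_fun f) x)\<^sup>2 \<partial>h) \<le> (16 * 2^i / 2^n)\<^sup>2 * (\<integral>x. (cb_fun f x)\<^sup>2 \<partial>h)"
    unfolding T_def T'_def by (rule absorb_right_bounds(2)[OF F_compact F_pos cprob_negU _ close_negU cb_fun_cbp]) auto
  show "ip.N (Top n (Top i f) - Top n f) \<le> 16 * 2^i / 2^n * ip.N f"
    by (rule power2_le_imp_le)
      (use * in \<open>auto simp: power_mult_distrib power_divide N_square_integral minus_cb.rep_eq Top_def cb_fun_avop cmeasure_U T_def\<close>)
  show "ip.N (Top n (Top' i f) - Top n f) \<le> 16 * 2^i / 2^n * ip.N f"
    by (rule power2_le_imp_le)
      (use ** in \<open>auto simp: power_mult_distrib power_divide N_square_integral minus_cb.rep_eq Top_def Top'_def cb_fun_avop cmeasure_U cmeasure_negU T_def T'_def\<close>)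
qed

text \<open>2^10 = 16 * 64, and a single level of distance pays for the factor 16.\<close>

lemma sparse_error: "i < j \<Longrightarrow> 16 * 2^(10 * i) / (2::real)^(10 * j) \<le> (1/64) ^ (j - i)"
proof -
  assume "i < j"
  then obtain d where d: "j = i + Suc d" using less_natE by (metis add_Suc_right)
  have "(16::real) * 1 \<le> 16 * 16 ^ d" by (intro mult_left_mono one_le_power) auto
  then have "(16::real) * 64 ^ Suc d \<le> 16 ^ Suc d * 64 ^ Suc d" by (intro mult_right_mono) auto
  also have "\<dots> = 2 ^ (10 * Suc d)" by (simp only: power_mult power_mult_distrib[symmetric]) simp
  finally show ?thesis unfolding d by (simp add: power_add power_one_over field_simps del: power_Suc)
qed

text \<open>Only every tenth \<open>F n\<close> is used, so that the error \<open>16 * 2^i / 2^n\<close> drops below \<open>64\<^bsup>-(j-i)\<^esup>\<close>,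
  the decay that the recursion in \<open>A_absorb\<close> needs.\<close>

sublocale sp: absorbing ip "\<lambda>j. Top (10 * j)" "\<lambda>j. Top' (10 * j)"
proof (intro absorbing.intro absorbing_axioms.intro ip.semi_inner_axioms)
  show "linear (Top (10 * j))" "linear (Top' (10 * j))" for j
    by (simp_all add: Top_def Top'_def linear_avop cmeasure_U cmeasure_negU)
  show "ip.N (Top (10 * j) x) \<le> ip.N x" for j x
    unfolding Top_def by (rule contraction_avop[OF cprob_U])
  show "ip (Top (10 * j) x) y = ip x (Top' (10 * j) y)" for j x y
    unfolding Top_def Top'_def by (rule adjoint_avop[OF cmeasure_U])
  show "ip.N (Top (10 * j) (Top (10 * i) x) - Top (10 * j) x) \<le> (1/64) ^ (j - i) * ip.N x" if "i < j" for i j x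
    by (rule order_trans[OF Top_Top mult_right_mono[OF sparse_error[OF that]]]) simp
  show "ip.N (Top (10 * j) (Top' (10 * i) x) - Top (10 * j) x) \<le> (1/64) ^ (j - i) * ip.N x" if "i < j" for i j x
    by (rule order_trans[OF Top_Top' mult_right_mono[OF sparse_error[OF that]]]) simp
qed

text \<open>\<open>n\<close> lies between \<open>10 * j\<close> and \<open>10 * j + 9\<close> for
  \<open>j = n div 10\<close>. Against finer levels this only helps; against coarser ones it costs
  at most 2^9, and 8192 = 16 * 2^9 is a generous allowance.\<close>

lemma level_op_Top: "sp.level_op 8192 (n div 10) (Top n) (Top' n)"
  unfolding sp.level_op_def
proof (intro conjI allI impI)
  show "linear (Top n)" "linear (Top' n)"
    by (simp_all add: Top_def Top'_def linear_avop cmeasure_U cmeasure_negU)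
  show "ip.N (Top n x) \<le> ip.N x" for x
    unfolding Top_def by (rule contraction_avop[OF cprob_U])
  show "ip (Top n x) y = ip x (Top' n y)" for x y
    unfolding Top_def Top'_def by (rule adjoint_avop[OF cmeasure_U])
  show "ip.N (Top n (Top' (10 * i) x) - Top n x) \<le> 8 * 4^i / 4^(n div 10) * ip.N x" if i: "i < n div 10" for i x
  proof (rule order_trans[OF Top_Top' mult_right_mono])
    define j where "j = n div 10"
    have "(2::real)^(10 * j) \<le> 2^n" unfolding j_def by (intro power_increasing) auto
    then have "16 * 2^(10 * i) / (2::real)^n \<le> 16 * 2^(10 * i) / 2^(10 * j)" by (intro divide_left_mono) auto
    also have "\<dots> \<le> (1/64) ^ (j - i)" using i by (intro sparse_error) (simp add: j_def)
    also have "\<dots> \<le> (1/4) ^ (j - i)" by (intro power_mono) auto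
    also have "\<dots> = 4^i / 4^j" using i by (simp add: j_def power_diff power_one_over)
    also have "\<dots> \<le> 8 * 4^i / 4^j" by (simp add: divide_right_mono)
    finally show "16 * 2^(10 * i) / (2::real)^n \<le> 8 * 4^i / 4^(n div 10)" by (simp add: j_def)
  qed simp
  show "ip.N (Top (10 * k) (Top' n x) - Top (10 * k) x) \<le> 8192 * (1/64) ^ (k - n div 10) * ip.N x"
    if k: "n div 10 < k" for k x
  proof (rule order_trans[OF Top_Top' mult_right_mono])
    define j where "j = n div 10"
    have "(2::real)^n \<le> 2^(10 * j + 9)" unfolding j_def by (intro power_increasing) auto
    then have "16 * 2^n / (2::real)^(10 * k) \<le> 16 * 2^(10 * j + 9) / 2^(10 * k)" by (intro divide_right_mono) auto
    also have "\<dots> = 512 * (16 * 2^(10 * j) / 2^(10 * k))" by (simp add: power_add)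
    also have "\<dots> \<le> 512 * (1/64) ^ (k - j)" using k by (intro mult_left_mono sparse_error) (auto simp: j_def)
    also have "\<dots> \<le> 8192 * (1/64) ^ (k - j)" by (intro mult_right_mono) auto
    finally show "16 * 2^n / (2::real)^(10 * k) \<le> 8192 * (1/64) ^ (k - n div 10)" by (simp add: j_def)
  qed simp
qed

end

section \<open>Path space and the jump inequality in \<open>L\<^sup>2\<close>\<close>

abbreviation paths :: "(nat \<Rightarrow> 'g::topological_space) measure" where
  "paths \<equiv> PiM UNIV (\<lambda>_. borel)"

text \<open>The value of \<open>x\<close> at the last stopping time, if the sequence is stopped
  whenever it has moved by more than \<open>eta\<close> since the previous stop. The recursion does
  without the stopping times themselves.\<close>

primrec anchor :: "real \<Rightarrow> (nat \<Rightarrow> real) \<Rightarrow> nat \<Rightarrow> real" where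
  "anchor eta x 0 = x 0"
| "anchor eta x (Suc l) = (if \<bar>x (Suc l) - anchor eta x l\<bar> \<le> eta then anchor eta x l else x (Suc l))"

lemma anchor_close: "0 \<le> eta \<Longrightarrow> \<bar>x l - anchor eta x l\<bar> \<le> eta"
  by (cases l) auto

lemma anchor_cong: "(\<And>i. i \<le> l \<Longrightarrow> x i = y i) \<Longrightarrow> anchor eta x l = anchor eta y l"
  by (induction l) auto

text \<open>If the anchor stayed put between the two times, both values would lie within
  \<open>eta\<close> of it. A change of the anchor exceeds \<open>eta\<close> in size. The indices
  \<open>K - k\<close> translate levels into times.\<close>

lemma anchor_jumps:
  fixes x :: "nat \<Rightarrow> real"
  assumes eta: "0 < eta" and gap: "2 * eta < \<bar>x (K - a) - x (K - b)\<bar>" and ab: "a < b" "b \<le> K"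
  shows "1 \<le> (\<Sum>k=a..<b. (anchor eta x (K - k) - anchor eta x (K - Suc k))\<^sup>2 / eta\<^sup>2)"
proof -
  have "\<exists>k\<in>{a..<b}. anchor eta x (K - k) \<noteq> anchor eta x (K - Suc k)"
  proof (rule ccontr)
    assume "\<not> ?thesis"
    then have eq: "anchor eta x (K - k) = anchor eta x (K - Suc k)" if "a \<le> k" "k < b" for k
      using that by auto
    have "anchor eta x (K - a) = anchor eta x (K - k)" if "a \<le> k" "k \<le> b" for k
      using that by (induction k rule: dec_induct) (auto simp: eq)
    then have "anchor eta x (K - a) = anchor eta x (K - b)" using ab by simp
    then show False
      using anchor_close[of eta x "K - a"] anchor_close[of eta x "K - b"] gap eta by linarith
  qed
  then obtain k where k: "k \<in> {a..<b}" "anchor eta x (K - k) \<noteq> anchor eta x (K - Suc k)" by blast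
  have "K - k = Suc (K - Suc k)" using k ab by auto
  then have "eta < \<bar>anchor eta x (K - k) - anchor eta x (K - Suc k)\<bar>" using k(2) by (auto split: if_splits)
  then have "eta\<^sup>2 \<le> (anchor eta x (K - k) - anchor eta x (K - Suc k))\<^sup>2"
    using eta by (auto intro!: abs_le_square_iff[THEN iffD1])
  then have "1 \<le> (anchor eta x (K - k) - anchor eta x (K - Suc k))\<^sup>2 / eta\<^sup>2" using eta by simp
  also have "\<dots> \<le> (\<Sum>k=a..<b. (anchor eta x (K - k) - anchor eta x (K - Suc k))\<^sup>2 / eta\<^sup>2)"
    using k by (intro member_le_sum) auto
  finally show ?thesis .
qed

text \<open>The term of level \<open>k\<close> is charged to the single index at which
  \<open>n div 10\<close> leaves the value \<open>k\<close>.\<close>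

lemma sum_div10:
  fixes r :: "nat \<Rightarrow> real"
  assumes "a \<le> b"
  shows "(\<Sum>n=a..<b. if Suc n div 10 = n div 10 then 0 else r (n div 10)) = (\<Sum>k=a div 10..<b div 10. r k)"
  using assms
proof (induction b rule: dec_induct)
  case (step b)
  have "a div 10 \<le> b div 10" using step by (simp add: div_le_mono)
  moreover have "Suc b div 10 = b div 10 \<or> Suc b div 10 = Suc (b div 10)" by (simp add: div_Suc)
  ultimately show ?case using step by auto
qed simp

lemma sum_div10_le:
  fixes f :: "nat \<Rightarrow> real"
  assumes "\<And>j. 0 \<le> f j"
  shows "(\<Sum>n\<le>L. f (n div 10)) \<le> 10 * (\<Sum>j\<le>L div 10. f j)"
proof -
  have "(\<Sum>n\<le>L. f (n div 10)) \<le> (\<Sum>n<Suc (L div 10) * 10. f (n div 10))"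
  proof (intro sum_mono2 assms)
    show "{..L} \<subseteq> {..<Suc (L div 10) * 10}"
      using dividend_less_div_times[of 10 L] by auto
  qed simp
  also have "\<dots> = (\<Sum>j<Suc (L div 10). \<Sum>n=j*10..<j*10+10. f (n div 10))"
    by (rule sum.nat_group[symmetric])
  also have "\<dots> = (\<Sum>j<Suc (L div 10). \<Sum>n=j*10..<j*10+10. f j)"
  proof (intro sum.cong refl)
    fix j n assume "n \<in> {j*10..<j*10+10::nat}"
    then have "n div 10 = j" by (intro div_nat_eqI) auto
    then show "f (n div 10) = f j" by simp
  qed
  also have "\<dots> = 10 * (\<Sum>j\<le>L div 10. f j)"
    by (simp add: sum_distrib_left lessThan_Suc_atMost)
  finally show ?thesis .
qed

lemma jmax_anchor:
  fixes x :: "nat \<Rightarrow> real"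
  assumes eta: "0 < eta" and K: "K = L div 10"
  shows "real (jmax (2 * eta) L (\<lambda>n. x (K - n div 10)))
    \<le> (\<Sum>l<K. (anchor eta x (Suc l) - anchor eta x l)\<^sup>2) / eta\<^sup>2"
proof -
  define r where "r k = (anchor eta x (K - k) - anchor eta x (K - Suc k))\<^sup>2 / eta\<^sup>2" for k
  have "real (jmax (2 * eta) L (\<lambda>n. x (K - n div 10)))
      \<le> (\<Sum>n<L. if Suc n div 10 = n div 10 then 0 else r (n div 10))"
  proof (rule jmax_interval)
    show "1 \<le> (\<Sum>n=a..<b. if Suc n div 10 = n div 10 then 0 else r (n div 10))"
      if ab: "a < b" "b \<le> L" and gap: "2 * eta < norm (x (K - a div 10) - x (K - b div 10))" for a b
    proof -
      have le: "a div 10 \<le> b div 10" "b div 10 \<le> K" using ab by (auto simp: K div_le_mono)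
      moreover have "a div 10 \<noteq> b div 10" using gap eta by auto
      ultimately have "a div 10 < b div 10" by simp
      then show ?thesis
        using anchor_jumps[OF eta, of x K "a div 10" "b div 10"] gap le ab by (simp add: sum_div10 r_def)
    qed
  qed (auto simp: r_def)
  also have "\<dots> = (\<Sum>k<K. r k)"
    using sum_div10[of 0 L r] by (simp add: K atLeast0LessThan)
  also have "\<dots> = (\<Sum>k<K. (anchor eta x (Suc (K - Suc k)) - anchor eta x (K - Suc k))\<^sup>2 / eta\<^sup>2)"
    by (intro sum.cong refl) (simp add: r_def Suc_diff_Suc)
  also have "\<dots> = (\<Sum>l<K. (anchor eta x (Suc l) - anchor eta x l)\<^sup>2 / eta\<^sup>2)"
    by (rule sum.nat_diff_reindex)
  finally show ?thesis by (simp add: sum_divide_distrib)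
qed

section \<open>Random paths and martingale energy\<close>

context haar_space
begin

text \<open>Paths run from coarse to fine: below, the time \<open>l\<close> of a path belongs to the level \<open>K - l\<close>.\<close>

primrec path :: "(nat \<Rightarrow> 'g measure) \<Rightarrow> nat \<Rightarrow> (nat \<Rightarrow> 'g) measure" where
  "path \<nu> 0 = distr h paths (\<lambda>z _. z)"
| "path \<nu> (Suc l) = distr (path \<nu> l \<Otimes>\<^sub>M \<nu> l) paths (\<lambda>(\<omega>, s). fun_upd \<omega> (Suc l) (\<omega> l + s))"

context
  fixes \<nu> :: "nat \<Rightarrow> 'g measure"
  assumes \<nu>: "\<And>l. cprob (\<nu> l)"
begin

lemma sets_path [measurable_cong]: "sets (path \<nu> l) = sets paths"
  by (cases l) auto

lemma sets_nu [measurable_cong]: "sets (\<nu> l) = sets borel"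
  using \<nu>[of l] by (simp add: cprob_def cmeasure_def)

lemma step_measurable: "(\<lambda>(\<omega>, s). fun_upd \<omega> (Suc l) (\<omega> l + s)) \<in> measurable (path \<nu> l \<Otimes>\<^sub>M \<nu> l) paths"
proof -
  have "(\<lambda>p. fun_upd (fst p) (Suc l) (fst p l + snd p)) \<in> measurable (path \<nu> l \<Otimes>\<^sub>M \<nu> l) paths"
  proof (rule measurable_PiM_single')
    show "(\<lambda>p. (fun_upd (fst p) (Suc l) (fst p l + snd p)) i) \<in> borel_measurable (path \<nu> l \<Otimes>\<^sub>M \<nu> l)" for i
      by (cases "i = Suc l") auto
  qed auto
  then show ?thesis by (simp add: case_prod_beta')
qed

lemma nn_path_0:
  assumes [measurable]: "f \<in> borel_measurable paths"
  shows "(\<integral>\<^sup>+\<omega>. f \<omega> \<partial>path \<nu> 0) = (\<integral>\<^sup>+z. f (\<lambda>_. z) \<partial>h)"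
proof -
  have "(\<lambda>z _. z) \<in> measurable h (paths :: (nat \<Rightarrow> 'g) measure)"
    by (rule measurable_PiM_single') auto
  then show ?thesis by (simp add: nn_integral_distr)
qed

lemma nn_path_Suc:
  assumes [measurable]: "f \<in> borel_measurable paths"
  shows "(\<integral>\<^sup>+\<omega>. f \<omega> \<partial>path \<nu> (Suc l)) = (\<integral>\<^sup>+\<omega>. \<integral>\<^sup>+s. f (fun_upd \<omega> (Suc l) (\<omega> l + s)) \<partial>\<nu> l \<partial>path \<nu> l)"
proof -
  interpret N: finite_measure "\<nu> l" using \<nu>[of l] by (simp add: cprob_def cmeasure_def)
  note [measurable] = step_measurable[of l]
  have "(\<integral>\<^sup>+\<omega>. f \<omega> \<partial>path \<nu> (Suc l)) = (\<integral>\<^sup>+p. f ((\<lambda>(\<omega>, s). fun_upd \<omega> (Suc l) (\<omega> l + s)) p) \<partial>(path \<nu> l \<Otimes>\<^sub>M \<nu> l))"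
    by (simp add: nn_integral_distr)
  also have "\<dots> = (\<integral>\<^sup>+\<omega>. \<integral>\<^sup>+s. f ((\<lambda>(\<omega>, s). fun_upd \<omega> (Suc l) (\<omega> l + s)) (\<omega>, s)) \<partial>\<nu> l \<partial>path \<nu> l)"
    by (rule N.nn_integral_fst[symmetric]) measurable
  finally show ?thesis by simp
qed

text \<open>By right invariance \<open>h\<close> is stationary for multiplication by an independent
  element on the right. So integrals along paths, taken at one time, are integrals over the group,
  although \<open>h\<close> may be infinite.\<close>

lemma path_marginal:
  fixes f :: "'g \<Rightarrow> ennreal"
  assumes [measurable]: "f \<in> borel_measurable borel"
  shows "(\<integral>\<^sup>+\<omega>. f (\<omega> l) \<partial>path \<nu> l) = (\<integral>\<^sup>+z. f z \<partial>h)"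
  using assms
proof (induction l arbitrary: f)
  case 0
  note [measurable] = 0
  show ?case by (subst nn_path_0) auto
next
  case (Suc l)
  note [measurable] = Suc.prems
  interpret N: finite_measure "\<nu> l" using \<nu>[of l] by (simp add: cprob_def cmeasure_def)
  interpret pair_sigma_finite h "\<nu> l" by (rule pair_sigma_finite_cmeasure[OF cprob_cmeasure[OF \<nu>]])
  have "(\<integral>\<^sup>+\<omega>. f (\<omega> (Suc l)) \<partial>path \<nu> (Suc l)) = (\<integral>\<^sup>+\<omega>. \<integral>\<^sup>+s. f (\<omega> l + s) \<partial>\<nu> l \<partial>path \<nu> l)"
    by (subst nn_path_Suc) auto
  also have "\<dots> = (\<integral>\<^sup>+z. \<integral>\<^sup>+s. f (z + s) \<partial>\<nu> l \<partial>h)"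
    by (rule Suc.IH) measurable
  also have "\<dots> = (\<integral>\<^sup>+s. \<integral>\<^sup>+z. f (z + s) \<partial>h \<partial>\<nu> l)"
    by (rule Fubini'[symmetric]) measurable
  also have "\<dots> = (\<integral>\<^sup>+s. \<integral>\<^sup>+z. f z \<partial>h \<partial>\<nu> l)"
    by (subst nn_shift) auto
  finally show ?case using \<nu>[of l] by (simp add: cprob_def cmeasure_space[OF cprob_cmeasure[OF \<nu>]])
qed

lemma path_extend:
  assumes [measurable]: "f \<in> borel_measurable paths"
    and indep: "\<And>\<omega> i y. l < i \<Longrightarrow> f (fun_upd \<omega> (i) (y)) = f \<omega>" and le: "l \<le> k"
  shows "(\<integral>\<^sup>+\<omega>. f \<omega> \<partial>path \<nu> k) = (\<integral>\<^sup>+\<omega>. f \<omega> \<partial>path \<nu> l)"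
  using le
proof (induction k rule: dec_induct)
  case (step k)
  have "(\<integral>\<^sup>+\<omega>. f \<omega> \<partial>path \<nu> (Suc k)) = (\<integral>\<^sup>+\<omega>. \<integral>\<^sup>+s. f \<omega> \<partial>\<nu> k \<partial>path \<nu> k)"
    using step by (subst nn_path_Suc) (auto simp: indep)
  also have "\<dots> = (\<integral>\<^sup>+\<omega>. f \<omega> \<partial>path \<nu> k)"
    using \<nu>[of k] by (simp add: cprob_def cmeasure_space[OF cprob_cmeasure[OF \<nu>]])
  finally show ?case using step by simp
qed simp

lemma path_marginal_le:
  fixes f :: "'g \<Rightarrow> ennreal"
  assumes [measurable]: "f \<in> borel_measurable borel" and "l \<le> k"
  shows "(\<integral>\<^sup>+\<omega>. f (\<omega> l) \<partial>path \<nu> k) = (\<integral>\<^sup>+z. f z \<partial>h)"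
  using path_extend[of "\<lambda>\<omega>. f (\<omega> l)" l k] path_marginal[of f l] assms by simp

context
  fixes v :: "nat \<Rightarrow> 'g \<Rightarrow> real" and K :: nat
  assumes v: "\<And>l. cbp (v l)" and mart: "\<And>l. l < K \<Longrightarrow> av (\<nu> l) (v (Suc l)) = v l"
begin

lemma v_measurable [measurable]: "v l \<in> borel_measurable borel"
  by (rule cbp_measurable[OF v])

text \<open>The identity for conditional variances, arranged as an equality of sums because nothing
  possibly infinite may be subtracted. \<open>p\<close> is any function of the path up to time
  \<open>l\<close>: an earlier value in \<open>martingale_increment\<close>, the anchor in
  \<open>anchor_energy\<close>.\<close>

lemma martingale_step:
  assumes l: "l < K" and [measurable]: "p \<in> borel_measurable paths"
    and indep: "\<And>\<omega> i y. l < i \<Longrightarrow> p (fun_upd \<omega> (i) (y)) = p \<omega>"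
  shows "(\<integral>\<^sup>+\<omega>. ennreal ((v (Suc l) (\<omega> (Suc l)) - p \<omega>)\<^sup>2) \<partial>path \<nu> (Suc l))
      + (\<integral>\<^sup>+z. ennreal ((v l z)\<^sup>2) \<partial>h)
    = (\<integral>\<^sup>+\<omega>. ennreal ((v l (\<omega> l) - p \<omega>)\<^sup>2) \<partial>path \<nu> l) + (\<integral>\<^sup>+z. ennreal ((v (Suc l) z)\<^sup>2) \<partial>h)"
proof -
  interpret N: finite_measure "\<nu> l" using \<nu>[of l] by (simp add: cprob_def cmeasure_def)
  obtain c where c: "0 \<le> c" "\<And>x. \<bar>v (Suc l) x\<bar> \<le> c" using cbp_bounded[OF v] by blast
  have i1: "integrable (\<nu> l) (\<lambda>s. v (Suc l) (a + s))" for a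
    by (rule cbp_integrable_av[OF cprob_cmeasure[OF \<nu>] v])
  have i2: "integrable (\<nu> l) (\<lambda>s. (v (Suc l) (a + s))\<^sup>2)" for a
    by (rule cbp_integrable_av[OF cprob_cmeasure[OF \<nu>] cbp_power2[OF v]])
  have m1: "measure (\<nu> l) (space (\<nu> l)) = 1"
    using cprob_measure[OF \<nu>[of l]] by (simp add: cmeasure_space[OF cprob_cmeasure[OF \<nu>]])
  have pt: "(\<integral>\<^sup>+s. ennreal ((v (Suc l) (a + s) - b)\<^sup>2) \<partial>\<nu> l) + ennreal ((v l a)\<^sup>2)
      = ennreal ((v l a - b)\<^sup>2) + (\<integral>\<^sup>+s. ennreal ((v (Suc l) (a + s))\<^sup>2) \<partial>\<nu> l)" for a b
  proof -
    have e: "(v (Suc l) (a + s) - b)\<^sup>2 = (v (Suc l) (a + s))\<^sup>2 - 2 * b * v (Suc l) (a + s) + b\<^sup>2" for s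
      by (simp add: power2_diff)
    have i3: "integrable (\<nu> l) (\<lambda>s. (v (Suc l) (a + s) - b)\<^sup>2)"
      unfolding e using i1 i2 by simp
    have "(\<integral>s. (v (Suc l) (a + s) - b)\<^sup>2 \<partial>\<nu> l)
        = (\<integral>s. (v (Suc l) (a + s))\<^sup>2 \<partial>\<nu> l) - 2 * b * (\<integral>s. v (Suc l) (a + s) \<partial>\<nu> l) + b\<^sup>2"
      unfolding e using i1[of a] i2[of a] by (simp add: m1)
    also have "(\<integral>s. v (Suc l) (a + s) \<partial>\<nu> l) = v l a"
      using mart[OF l] by (metis av_def)
    finally have "(\<integral>s. (v (Suc l) (a + s) - b)\<^sup>2 \<partial>\<nu> l) + (v l a)\<^sup>2
        = (v l a - b)\<^sup>2 + (\<integral>s. (v (Suc l) (a + s))\<^sup>2 \<partial>\<nu> l)"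
      by (simp add: power2_diff)
    then show ?thesis
      using i2[of a] i3 by (simp add: nn_integral_eq_integral flip: ennreal_plus)
  qed
  have "(\<integral>\<^sup>+\<omega>. ennreal ((v (Suc l) (\<omega> (Suc l)) - p \<omega>)\<^sup>2) \<partial>path \<nu> (Suc l)) + (\<integral>\<^sup>+z. ennreal ((v l z)\<^sup>2) \<partial>h)
      = (\<integral>\<^sup>+\<omega>. \<integral>\<^sup>+s. ennreal ((v (Suc l) (\<omega> l + s) - p \<omega>)\<^sup>2) \<partial>\<nu> l \<partial>path \<nu> l)
        + (\<integral>\<^sup>+\<omega>. ennreal ((v l (\<omega> l))\<^sup>2) \<partial>path \<nu> l)"
    by (subst nn_path_Suc) (auto simp: indep path_marginal[of "\<lambda>z. ennreal ((v l z)\<^sup>2)"])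
  also have "\<dots> = (\<integral>\<^sup>+\<omega>. (\<integral>\<^sup>+s. ennreal ((v (Suc l) (\<omega> l + s) - p \<omega>)\<^sup>2) \<partial>\<nu> l) + ennreal ((v l (\<omega> l))\<^sup>2) \<partial>path \<nu> l)"
    by (rule nn_integral_add[symmetric]) measurable
  also have "\<dots> = (\<integral>\<^sup>+\<omega>. ennreal ((v l (\<omega> l) - p \<omega>)\<^sup>2) + (\<integral>\<^sup>+s. ennreal ((v (Suc l) (\<omega> l + s))\<^sup>2) \<partial>\<nu> l) \<partial>path \<nu> l)"
    unfolding pt ..
  also have "\<dots> = (\<integral>\<^sup>+\<omega>. ennreal ((v l (\<omega> l) - p \<omega>)\<^sup>2) \<partial>path \<nu> l)
      + (\<integral>\<^sup>+\<omega>. \<integral>\<^sup>+s. ennreal ((v (Suc l) (\<omega> l + s))\<^sup>2) \<partial>\<nu> l \<partial>path \<nu> l)"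
    by (rule nn_integral_add) measurable
  also have "(\<integral>\<^sup>+\<omega>. \<integral>\<^sup>+s. ennreal ((v (Suc l) (\<omega> l + s))\<^sup>2) \<partial>\<nu> l \<partial>path \<nu> l)
      = (\<integral>\<^sup>+\<omega>. ennreal ((v (Suc l) (\<omega> (Suc l)))\<^sup>2) \<partial>path \<nu> (Suc l))"
    by (subst nn_path_Suc) auto
  also have "\<dots> = (\<integral>\<^sup>+z. ennreal ((v (Suc l) z)\<^sup>2) \<partial>h)"
    by (rule path_marginal) measurable
  finally show ?thesis .
qed

lemma square_finite: "(\<integral>\<^sup>+z. ennreal ((v l z)\<^sup>2) \<partial>h) = ennreal (\<integral>z. (v l z)\<^sup>2 \<partial>h)"
  by (intro nn_integral_eq_integral cbp_integrable cbp_power2 v) auto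

lemma martingale_increment:
  assumes "i \<le> l" "l \<le> K"
  shows "(\<integral>\<^sup>+\<omega>. ennreal ((v l (\<omega> l) - v i (\<omega> i))\<^sup>2) \<partial>path \<nu> l) + (\<integral>\<^sup>+z. ennreal ((v i z)\<^sup>2) \<partial>h)
    = (\<integral>\<^sup>+z. ennreal ((v l z)\<^sup>2) \<partial>h)"
  using assms
proof (induction l rule: dec_induct)
  case (step l)
  define X where "X l = (\<integral>\<^sup>+z. ennreal ((v l z)\<^sup>2) \<partial>h)" for l
  define e where "e l = (\<integral>\<^sup>+\<omega>. ennreal ((v l (\<omega> l) - v i (\<omega> i))\<^sup>2) \<partial>path \<nu> l)" for l
  have "e (Suc l) + X l = e l + X (Suc l)"
    unfolding e_def X_def using step by (intro martingale_step) auto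
  moreover have "e l + X i = X l" unfolding e_def X_def using step by simp
  ultimately have "X l + (e (Suc l) + X i) = X l + X (Suc l)"
    by (metis add.assoc add.commute)
  moreover have "X l \<noteq> \<infinity>" by (simp add: X_def square_finite)
  ultimately have "e (Suc l) + X i = X (Suc l)" by simp
  then show ?case by (simp add: e_def X_def)
qed simp

text \<open>Increments of a martingale between stopping times are orthogonal. In the induction the
  residual \<open>v l - anchor\<close> gains exactly the energy of the next step, whether or not the
  path stops there.\<close>

lemma anchor_energy:
  assumes "l \<le> K"
  shows "(\<integral>\<^sup>+\<omega>. ennreal ((\<Sum>i<l. (anchor eta (\<lambda>j. v j (\<omega> j)) (Suc i) - anchor eta (\<lambda>j. v j (\<omega> j)) i)\<^sup>2)
      + (v l (\<omega> l) - anchor eta (\<lambda>j. v j (\<omega> j)) l)\<^sup>2) \<partial>path \<nu> l) \<le> (\<integral>\<^sup>+z. ennreal ((v l z)\<^sup>2) \<partial>h)"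
  using assms
proof (induction l)
  case (Suc l)
  define p where "p i \<omega> = anchor eta (\<lambda>j. v j (\<omega> j)) i" for i \<omega>
  define C where "C l \<omega> = (\<Sum>i<l. (p (Suc i) \<omega> - p i \<omega>)\<^sup>2)" for l \<omega>
  define X where "X l = (\<integral>\<^sup>+z. ennreal ((v l z)\<^sup>2) \<partial>h)" for l
  have [measurable]: "p i \<in> borel_measurable paths" for i
  proof (induction i)
    case 0
    show ?case unfolding p_def by simp
  next
    case (Suc i)
    note [measurable] = Suc
    have "p (Suc i) = (\<lambda>\<omega>. if \<bar>v (Suc i) (\<omega> (Suc i)) - p i \<omega>\<bar> \<le> eta then p i \<omega> else v (Suc i) (\<omega> (Suc i)))"
      by (simp add: p_def fun_eq_iff)
    then show ?case by simp
  qed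
  have [measurable]: "C i \<in> borel_measurable paths" for i
    unfolding C_def[abs_def] by measurable
  have p_indep: "p i (fun_upd \<omega> (j) (y)) = p i \<omega>" if "i < j" for i j \<omega> y
    unfolding p_def using that by (intro anchor_cong) auto
  have C_indep: "C i (fun_upd \<omega> (j) (y)) = C i \<omega>" if "i < j" for i j \<omega> y
    unfolding C_def using that by (intro sum.cong) (auto simp: p_indep)
  have C_nonneg: "0 \<le> C i \<omega>" for i \<omega> unfolding C_def by (intro sum_nonneg) auto
  \<comment> \<open>If the anchor stays, nothing changes; if it moves, the new residual is 0 and the
    square of the old one has entered \<open>C\<close>.\<close>
  have upd: "C (Suc l) \<omega> + (v (Suc l) (\<omega> (Suc l)) - p (Suc l) \<omega>)\<^sup>2 = C l \<omega> + (v (Suc l) (\<omega> (Suc l)) - p l \<omega>)\<^sup>2" for \<omega>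
    by (simp add: C_def p_def)
  have C_same: "(\<integral>\<^sup>+\<omega>. ennreal (C l \<omega>) \<partial>path \<nu> (Suc l)) = (\<integral>\<^sup>+\<omega>. ennreal (C l \<omega>) \<partial>path \<nu> l)"
    by (rule path_extend) (auto simp: C_indep)
  have "(\<integral>\<^sup>+\<omega>. ennreal (C (Suc l) \<omega> + (v (Suc l) (\<omega> (Suc l)) - p (Suc l) \<omega>)\<^sup>2) \<partial>path \<nu> (Suc l)) + X l
      = (\<integral>\<^sup>+\<omega>. ennreal (C l \<omega>) \<partial>path \<nu> l)
        + ((\<integral>\<^sup>+\<omega>. ennreal ((v (Suc l) (\<omega> (Suc l)) - p l \<omega>)\<^sup>2) \<partial>path \<nu> (Suc l)) + X l)"
    unfolding upd C_same[symmetric] add.assoc[symmetric]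
    by (subst nn_integral_add[symmetric]) (auto simp: C_nonneg)
  also have "(\<integral>\<^sup>+\<omega>. ennreal ((v (Suc l) (\<omega> (Suc l)) - p l \<omega>)\<^sup>2) \<partial>path \<nu> (Suc l)) + X l
      = (\<integral>\<^sup>+\<omega>. ennreal ((v l (\<omega> l) - p l \<omega>)\<^sup>2) \<partial>path \<nu> l) + X (Suc l)"
    unfolding X_def using Suc.prems by (intro martingale_step) (auto simp: p_indep)
  also have "(\<integral>\<^sup>+\<omega>. ennreal (C l \<omega>) \<partial>path \<nu> l) + ((\<integral>\<^sup>+\<omega>. ennreal ((v l (\<omega> l) - p l \<omega>)\<^sup>2) \<partial>path \<nu> l) + X (Suc l))
      = (\<integral>\<^sup>+\<omega>. ennreal (C l \<omega> + (v l (\<omega> l) - p l \<omega>)\<^sup>2) \<partial>path \<nu> l) + X (Suc l)"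
    unfolding add.assoc[symmetric]
    by (subst nn_integral_add[symmetric]) (auto simp: C_nonneg)
  also have "\<dots> \<le> X l + X (Suc l)"
    using Suc by (intro add_right_mono) (simp add: X_def C_def p_def)
  finally have "X l + (\<integral>\<^sup>+\<omega>. ennreal (C (Suc l) \<omega> + (v (Suc l) (\<omega> (Suc l)) - p (Suc l) \<omega>)\<^sup>2) \<partial>path \<nu> (Suc l))
      \<le> X l + X (Suc l)" by (simp add: add.commute)
  moreover have "X l \<noteq> \<infinity>" by (simp add: X_def square_finite)
  ultimately show ?case
    unfolding X_def C_def p_def by (subst (asm) ennreal_add_left_cancel_le) simp
qed (simp add: zero_ennreal_def[symmetric])

end

end

declare sets_path [measurable_cong del] sets_nu [measurable_cong del] v_measurable [measurable del]

end

lemma nn_integral_cmult_add4: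
  fixes k :: ennreal
  assumes [measurable]: "a \<in> borel_measurable M" "b \<in> borel_measurable M" "c \<in> borel_measurable M" "d \<in> borel_measurable M"
  shows "(\<integral>\<^sup>+x. k * (a x + b x + c x + d x) \<partial>M)
    = k * ((\<integral>\<^sup>+x. a x \<partial>M) + (\<integral>\<^sup>+x. b x \<partial>M) + (\<integral>\<^sup>+x. c x \<partial>M) + (\<integral>\<^sup>+x. d x \<partial>M))"
proof -
  have "(\<integral>\<^sup>+x. a x + b x + c x + d x \<partial>M)
      = (\<integral>\<^sup>+x. a x \<partial>M) + (\<integral>\<^sup>+x. b x \<partial>M) + (\<integral>\<^sup>+x. c x \<partial>M) + (\<integral>\<^sup>+x. d x \<partial>M)"
    by (simp add: nn_integral_add)
  then show ?thesis by (simp add: nn_integral_cmult)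
qed

section \<open>Comparison of the averages with the martingale\<close>

context folner_inv
begin

text \<open>With \<open>g = lo + hi\<close> split at level \<open>j\<close>, the vectors
  \<open>Top n lo\<close>, \<open>sp.A j lo\<close> and \<open>Top n hi - hi\<close> are each
  evaluated at one time, where the path has law \<open>h\<close>, so their norms suffice. Only
  \<open>hi\<close> is compared at two times, and the mean square of this martingale increment is
  the defect of \<open>sp.A j\<close> at \<open>hi\<close>. The factor is 16 = 4 * 4: four terms,
  squared with constant 4.\<close>

lemma level_remainder:
  assumes K: "n div 10 \<le> K" and \<nu>: "\<And>l. l < K \<Longrightarrow> \<nu> l = U (10 * (K - Suc l))" and \<nu>1: "\<And>l. cprob (\<nu> l)"
    and a: "ip.N (Top n (g - sp.Aad (n div 10) (sp.A (n div 10) g))) \<le> a"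
    and b: "ip.N (sp.A (n div 10) (g - sp.Aad (n div 10) (sp.A (n div 10) g))) \<le> a"
    and c: "ip.N (Top n (sp.Aad (n div 10) (sp.A (n div 10) g)) - sp.Aad (n div 10) (sp.A (n div 10) g)) \<le> a"
    and d: "sqrt (ip (sp.Aad (n div 10) (sp.A (n div 10) g)) (sp.Aad (n div 10) (sp.A (n div 10) g))
        - ip (sp.A (n div 10) (sp.Aad (n div 10) (sp.A (n div 10) g))) (sp.A (n div 10) (sp.Aad (n div 10) (sp.A (n div 10) g)))) \<le> a"
  shows "(\<integral>\<^sup>+\<omega>. ennreal ((T n (cb_fun g) (\<omega> K) - cb_fun (sp.A (n div 10) g) (\<omega> (K - n div 10)))\<^sup>2) \<partial>path \<nu> K)
    \<le> ennreal (16 * a\<^sup>2)"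
proof -
  define j where "j = n div 10"
  define hi where "hi = sp.Aad j (sp.A j g)"
  define lo where "lo = g - hi"
  have a0: "0 \<le> a" using a ip.N_nonneg order_trans by blast
  have mart: "av (\<nu> l) (cb_fun (sp.A (K - Suc l) f)) = cb_fun (sp.A (K - l) f)" if "l < K" for l f
  proof -
    have "K - l = Suc (K - Suc l)" using that by simp
    then show ?thesis using that by (simp add: \<nu> cb_fun_Top T_def)
  qed
  have [measurable]: "cb_fun f \<in> borel_measurable borel" for f :: "'g cb"
    by (rule cbp_measurable[OF cb_fun_cbp])
  have sq: "(\<integral>\<^sup>+z. ennreal ((cb_fun f z)\<^sup>2) \<partial>h) = ennreal ((ip.N f)\<^sup>2)" for f :: "'g cb"
    unfolding N_square_integral by (intro nn_integral_eq_integral cbp_integrable cbp_power2 cb_fun_cbp) auto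
  have mg: "(\<integral>\<^sup>+\<omega>. ennreal ((cb_fun f (\<omega> l))\<^sup>2) \<partial>path \<nu> K) \<le> ennreal (a\<^sup>2)" if "ip.N f \<le> a" "l \<le> K" for f l
  proof -
    have "(\<integral>\<^sup>+\<omega>. ennreal ((cb_fun f (\<omega> l))\<^sup>2) \<partial>path \<nu> K) = ennreal ((ip.N f)\<^sup>2)"
      using path_marginal_le[of \<nu> "\<lambda>z. ennreal ((cb_fun f z)\<^sup>2)" l K, OF \<nu>1] that by (simp add: sq)
    also have "\<dots> \<le> ennreal (a\<^sup>2)" using that by (intro ennreal_leI power_mono) auto
    finally show ?thesis .
  qed
  have inc: "(\<integral>\<^sup>+\<omega>. ennreal ((cb_fun hi (\<omega> K) - cb_fun (sp.A j hi) (\<omega> (K - j)))\<^sup>2) \<partial>path \<nu> K) \<le> ennreal (a\<^sup>2)"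
  proof -
    have "(\<integral>\<^sup>+\<omega>. ennreal ((cb_fun (sp.A (K - K) hi) (\<omega> K) - cb_fun (sp.A (K - (K - j)) hi) (\<omega> (K - j)))\<^sup>2) \<partial>path \<nu> K)
        + (\<integral>\<^sup>+z. ennreal ((cb_fun (sp.A (K - (K - j)) hi) z)\<^sup>2) \<partial>h) = (\<integral>\<^sup>+z. ennreal ((cb_fun (sp.A (K - K) hi) z)\<^sup>2) \<partial>h)"
      by (rule martingale_increment[OF \<nu>1, where v = "\<lambda>l. cb_fun (sp.A (K - l) hi)" and K = K])
        (auto simp: mart cb_fun_cbp)
    moreover have "K - (K - j) = j" using K by (simp add: j_def)
    ultimately have eq: "(\<integral>\<^sup>+\<omega>. ennreal ((cb_fun hi (\<omega> K) - cb_fun (sp.A j hi) (\<omega> (K - j)))\<^sup>2) \<partial>path \<nu> K)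
        + ennreal ((ip.N (sp.A j hi))\<^sup>2) = ennreal ((ip.N hi)\<^sup>2)" by (simp add: sq)
    have "(ip.N hi)\<^sup>2 - (ip.N (sp.A j hi))\<^sup>2 \<le> a\<^sup>2"
    proof -
      have "sqrt ((ip.N hi)\<^sup>2 - (ip.N (sp.A j hi))\<^sup>2) \<le> a"
        using d by (simp add: ip.N_square hi_def j_def)
      then show ?thesis by (rule sqrt_le_D)
    qed
    then have "ennreal ((ip.N hi)\<^sup>2) \<le> ennreal (a\<^sup>2) + ennreal ((ip.N (sp.A j hi))\<^sup>2)"
      by (simp flip: ennreal_plus add: ennreal_leI)
    then have "ennreal ((ip.N (sp.A j hi))\<^sup>2) + (\<integral>\<^sup>+\<omega>. ennreal ((cb_fun hi (\<omega> K) - cb_fun (sp.A j hi) (\<omega> (K - j)))\<^sup>2) \<partial>path \<nu> K)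
        \<le> ennreal ((ip.N (sp.A j hi))\<^sup>2) + ennreal (a\<^sup>2)" unfolding eq[symmetric] by (simp add: add.commute)
    then show ?thesis by (subst (asm) ennreal_add_left_cancel_le) simp
  qed
  have pt: "(T n (cb_fun g) x - cb_fun (sp.A j g) y)\<^sup>2 \<le> 4 * ((cb_fun (Top n lo) x)\<^sup>2 + (cb_fun (sp.A j lo) y)\<^sup>2
      + (cb_fun (Top n hi - hi) x)\<^sup>2 + (cb_fun hi x - cb_fun (sp.A j hi) y)\<^sup>2)" for x y
  proof -
    have g: "g = lo + hi" by (simp add: lo_def)
    have lin: "linear (Top n)" by (simp add: Top_def linear_avop cmeasure_U)
    have "T n (cb_fun g) x = cb_fun (Top n lo) x + cb_fun (Top n hi) x"
      unfolding cb_fun_Top[symmetric] by (simp add: g linear_add[OF lin] plus_cb.rep_eq)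
    moreover have "cb_fun (sp.A j g) y = cb_fun (sp.A j lo) y + cb_fun (sp.A j hi) y"
      by (simp add: g linear_add[OF sp.linear_A] plus_cb.rep_eq)
    moreover have "(p + q + r + s)\<^sup>2 \<le> 4 * (p\<^sup>2 + q\<^sup>2 + r\<^sup>2 + s\<^sup>2)" for p q r s :: real
      using zero_le_power2[of "p - q"] zero_le_power2[of "p - r"] zero_le_power2[of "p - s"]
        zero_le_power2[of "q - r"] zero_le_power2[of "q - s"] zero_le_power2[of "r - s"]
      by (simp add: power2_eq_square algebra_simps)
    note this[of "cb_fun (Top n lo) x" "- cb_fun (sp.A j lo) y" "cb_fun (Top n hi - hi) x" "cb_fun hi x - cb_fun (sp.A j hi) y"]
    ultimately show ?thesis by (simp add: minus_cb.rep_eq algebra_simps)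
  qed
  have "(\<integral>\<^sup>+\<omega>. ennreal ((T n (cb_fun g) (\<omega> K) - cb_fun (sp.A j g) (\<omega> (K - j)))\<^sup>2) \<partial>path \<nu> K)
      \<le> (\<integral>\<^sup>+\<omega>. ennreal 4 * (ennreal ((cb_fun (Top n lo) (\<omega> K))\<^sup>2) + ennreal ((cb_fun (sp.A j lo) (\<omega> (K - j)))\<^sup>2)
      + ennreal ((cb_fun (Top n hi - hi) (\<omega> K))\<^sup>2) + ennreal ((cb_fun hi (\<omega> K) - cb_fun (sp.A j hi) (\<omega> (K - j)))\<^sup>2)) \<partial>path \<nu> K)"
  proof (rule nn_integral_mono, goal_cases)
    case (1 \<omega>)
    show ?case
      by (rule order_trans[OF ennreal_leI[OF pt[of "\<omega> K" "\<omega> (K - j)"]]])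
        (simp only: ennreal_mult ennreal_plus zero_le_power2 add_nonneg_nonneg order_refl zero_le_numeral)
  qed
  also have "\<dots> = ennreal 4 * ((\<integral>\<^sup>+\<omega>. ennreal ((cb_fun (Top n lo) (\<omega> K))\<^sup>2) \<partial>path \<nu> K) + (\<integral>\<^sup>+\<omega>. ennreal ((cb_fun (sp.A j lo) (\<omega> (K - j)))\<^sup>2) \<partial>path \<nu> K)
      + (\<integral>\<^sup>+\<omega>. ennreal ((cb_fun (Top n hi - hi) (\<omega> K))\<^sup>2) \<partial>path \<nu> K)
      + (\<integral>\<^sup>+\<omega>. ennreal ((cb_fun hi (\<omega> K) - cb_fun (sp.A j hi) (\<omega> (K - j)))\<^sup>2) \<partial>path \<nu> K))"
  proof -
    note [measurable_cong] = sets_path[of \<nu> K, OF \<nu>1]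
    have [measurable]: "(\<lambda>\<omega>. cb_fun f (\<omega> i)) \<in> borel_measurable (path \<nu> K)" for f :: "'g cb" and i
      by measurable
    show ?thesis
      by (rule nn_integral_cmult_add4) measurable
  qed
  also have "\<dots> \<le> ennreal 4 * (ennreal (a\<^sup>2) + ennreal (a\<^sup>2) + ennreal (a\<^sup>2) + ennreal (a\<^sup>2))"
    using a b c by (intro mult_left_mono add_mono mg inc) (auto simp: j_def lo_def hi_def)
  also have "\<dots> = ennreal (4 * (a\<^sup>2 + a\<^sup>2 + a\<^sup>2 + a\<^sup>2))"
    by (simp only: ennreal_mult ennreal_plus zero_le_power2 add_nonneg_nonneg zero_le_numeral)
  also have "\<dots> = ennreal (16 * a\<^sup>2)" by simp
  finally show ?thesis by (simp add: j_def)
qed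

theorem L2_jump_inequality:
  fixes g :: "'g cb"
  assumes lam: "0 < lam" and M: "0 < M"
  shows "emeasure h {x. M \<le> real (jmax lam L (\<lambda>n. T n (cb_fun g) x))}
    \<le> ennreal (10^15 * (ip.N g)\<^sup>2 / (lam\<^sup>2 * M))"
proof -
  define K where "K = L div 10"
  define \<nu> where "\<nu> l = U (10 * (K - Suc l))" for l
  define v where "v l = cb_fun (sp.A (K - l) g)" for l
  define R where "R n \<omega> = T n (cb_fun g) (\<omega> K) - cb_fun (sp.A (n div 10) g) (\<omega> (K - n div 10))" for n \<omega>
  \<comment> \<open>\<open>lam\<close> is divided into \<open>2 * eta\<close> for the martingale and
    \<open>6 * eta\<close> for the remainder.\<close>
  define eta where "eta = lam / 8"
  define C where "C \<omega> = (\<Sum>i<K. (anchor eta (\<lambda>j. v j (\<omega> j)) (Suc i) - anchor eta (\<lambda>j. v j (\<omega> j)) i)\<^sup>2)" for \<omega>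
  define S where "S \<omega> = (\<Sum>n\<le>L. (R n \<omega>)\<^sup>2)" for \<omega>
  have \<nu>1: "cprob (\<nu> l)" for l by (simp add: \<nu>_def cprob_U)
  have mart: "av (\<nu> l) (v (Suc l)) = v l" if "l < K" for l
  proof -
    have "K - l = Suc (K - Suc l)" using that by simp
    then show ?thesis using that by (simp add: \<nu>_def v_def cb_fun_Top T_def)
  qed
  note [measurable_cong] = sets_path[of \<nu> K, OF \<nu>1]
  have [measurable]: "cb_fun f \<in> borel_measurable borel" for f :: "'g cb"
    by (rule cbp_measurable[OF cb_fun_cbp])
  have [measurable]: "T n (cb_fun g) \<in> borel_measurable borel" for n
    by (rule cbp_measurable[OF cbp_T[OF cb_fun_cbp]])
  have Rm [measurable]: "R n \<in> borel_measurable paths" for n unfolding R_def[abs_def] by measurable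
  have Sm [measurable]: "S \<in> borel_measurable paths" unfolding S_def[abs_def] by measurable
  have eta: "0 < eta" using lam by (simp add: eta_def)
  obtain H :: "nat \<Rightarrow> real" where H: "\<And>j. 0 \<le> H j" "(\<Sum>j\<le>K. (H j)\<^sup>2) \<le> 9 * (ip.N g)\<^sup>2"
    "\<And>j T T'. j \<le> K \<Longrightarrow> sp.level_op 8192 j T T' \<Longrightarrow> ip.N (T (g - sp.Aad j (sp.A j g))) \<le> 8 * 8192 * H j"
    "\<And>j. j \<le> K \<Longrightarrow> ip.N (sp.A j (g - sp.Aad j (sp.A j g))) \<le> 8 * 8192 * H j"
    "\<And>j T T'. j \<le> K \<Longrightarrow> sp.level_op 8192 j T T' \<Longrightarrow> ip.N (T (sp.Aad j (sp.A j g)) - sp.Aad j (sp.A j g)) \<le> 8 * 8192 * H j"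
    "\<And>j. j \<le> K \<Longrightarrow> sqrt (ip (sp.Aad j (sp.A j g)) (sp.Aad j (sp.A j g)) - ip (sp.A j (sp.Aad j (sp.A j g))) (sp.A j (sp.Aad j (sp.A j g)))) \<le> 8 * 8192 * H j"
    using sp.almost_orthogonality[of 8192 K g] by (metis one_le_numeral)
  have R: "(\<integral>\<^sup>+\<omega>. ennreal ((R n \<omega>)\<^sup>2) \<partial>path \<nu> K) \<le> ennreal (16 * (8 * 8192 * H (n div 10))\<^sup>2)" if "n \<le> L" for n
  proof -
    have j: "n div 10 \<le> K" using that by (simp add: K_def div_le_mono)
    show ?thesis unfolding R_def
      by (rule level_remainder[OF j _ \<nu>1 H(3)[OF j level_op_Top] H(4)[OF j] H(5)[OF j level_op_Top] H(6)[OF j]])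
        (simp add: \<nu>_def)
  qed
  \<comment> \<open>The constant is 9 * 10 * 16 * (8 * 8192)^2: the bound on the squares of
    \<open>H\<close>, ten indices per level, and \<open>level_remainder\<close>.\<close>
  have intS: "(\<integral>\<^sup>+\<omega>. ennreal (S \<omega>) \<partial>path \<nu> K) \<le> ennreal (6184752906240 * (ip.N g)\<^sup>2)"
  proof -
    have "(\<integral>\<^sup>+\<omega>. ennreal (S \<omega>) \<partial>path \<nu> K) = (\<Sum>n\<le>L. \<integral>\<^sup>+\<omega>. ennreal ((R n \<omega>)\<^sup>2) \<partial>path \<nu> K)"
    proof -
      have "ennreal (S \<omega>) = (\<Sum>n\<le>L. ennreal ((R n \<omega>)\<^sup>2))" for \<omega>
        unfolding S_def by (rule sum_ennreal[symmetric]) simp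
      then have "(\<integral>\<^sup>+\<omega>. ennreal (S \<omega>) \<partial>path \<nu> K) = (\<integral>\<^sup>+\<omega>. (\<Sum>n\<le>L. ennreal ((R n \<omega>)\<^sup>2)) \<partial>path \<nu> K)"
        by presburger
      also have "\<dots> = (\<Sum>n\<le>L. \<integral>\<^sup>+\<omega>. ennreal ((R n \<omega>)\<^sup>2) \<partial>path \<nu> K)"
        by (rule nn_integral_sum) measurable
      finally show ?thesis .
    qed
    also have "\<dots> \<le> (\<Sum>n\<le>L. ennreal (16 * (8 * 8192 * H (n div 10))\<^sup>2))"
      by (intro sum_mono R) auto
    also have "\<dots> = ennreal (\<Sum>n\<le>L. 16 * (8 * 8192 * H (n div 10))\<^sup>2)"
      by (rule sum_ennreal) auto
    also have "\<dots> \<le> ennreal (10 * (\<Sum>j\<le>K. 16 * (8 * 8192 * H j)\<^sup>2))"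
      unfolding K_def by (intro ennreal_leI sum_div10_le[of "\<lambda>j. 16 * (8 * 8192 * H j)\<^sup>2"]) auto
    also have "10 * (\<Sum>j\<le>K. 16 * (8 * 8192 * H j)\<^sup>2) = 687194767360 * (\<Sum>j\<le>K. (H j)\<^sup>2)"
      by (simp add: sum_distrib_left power_mult_distrib)
    also have "ennreal (687194767360 * (\<Sum>j\<le>K. (H j)\<^sup>2)) \<le> ennreal (687194767360 * (9 * (ip.N g)\<^sup>2))"
      by (intro ennreal_leI mult_left_mono H(2)) auto
    finally show ?thesis by simp
  qed
  have intC: "(\<integral>\<^sup>+\<omega>. ennreal (C \<omega>) \<partial>path \<nu> K) \<le> ennreal ((ip.N g)\<^sup>2)"
  proof -
    have "(\<integral>\<^sup>+\<omega>. ennreal (C \<omega>) \<partial>path \<nu> K) \<le> (\<integral>\<^sup>+\<omega>. ennreal (C \<omega> + (v K (\<omega> K) - anchor eta (\<lambda>j. v j (\<omega> j)) K)\<^sup>2) \<partial>path \<nu> K)"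
      by (intro nn_integral_mono ennreal_leI) auto
    also have "\<dots> \<le> (\<integral>\<^sup>+z. ennreal ((v K z)\<^sup>2) \<partial>h)"
      unfolding C_def by (rule anchor_energy[OF \<nu>1, where K = K]) (auto simp: mart, simp add: v_def cb_fun_cbp)
    also have "\<dots> = ennreal ((ip.N g)\<^sup>2)"
      unfolding v_def N_square_integral by (simp, intro nn_integral_eq_integral cbp_integrable cbp_power2 cb_fun_cbp) auto
    finally show ?thesis .
  qed
  have Cm [measurable]: "C \<in> borel_measurable paths"
  proof -
    have [measurable]: "(\<lambda>\<omega>. anchor eta (\<lambda>j. v j (\<omega> j)) i) \<in> borel_measurable paths" for i
      by (induction i) (auto simp: v_def)
    show ?thesis unfolding C_def[abs_def] by measurable
  qed
  have C0: "0 \<le> C \<omega>" for \<omega> unfolding C_def by (intro sum_nonneg) auto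
  have S0: "0 \<le> S \<omega>" for \<omega> unfolding S_def by (intro sum_nonneg) auto
  have jump: "real (jmax lam L (\<lambda>n. T n (cb_fun g) (\<omega> K))) \<le> 64 / lam\<^sup>2 * C \<omega> + 64 / lam\<^sup>2 * S \<omega>" for \<omega>
  proof -
    have "jmax lam L (\<lambda>n. T n (cb_fun g) (\<omega> K)) = jmax (2 * eta + 6 * eta) L (\<lambda>n. v (K - n div 10) (\<omega> (K - n div 10)) + R n \<omega>)"
    proof -
      have "2 * eta + 6 * eta = lam" by (simp add: eta_def)
      moreover have "K - (K - n div 10) = n div 10" if "n \<le> L" for n
        using that by (simp add: K_def div_le_mono)
      ultimately show ?thesis by (simp, intro jmax_cong) (simp add: v_def R_def)
    qed
    also have "\<dots> \<le> jmax (2 * eta) L (\<lambda>n. v (K - n div 10) (\<omega> (K - n div 10))) + jmax (6 * eta) L (\<lambda>n. R n \<omega>)"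
      by (rule jmax_add)
    finally have "real (jmax lam L (\<lambda>n. T n (cb_fun g) (\<omega> K)))
        \<le> real (jmax (2 * eta) L (\<lambda>n. v (K - n div 10) (\<omega> (K - n div 10)))) + real (jmax (6 * eta) L (\<lambda>n. R n \<omega>))"
      by linarith
    also have "real (jmax (2 * eta) L (\<lambda>n. v (K - n div 10) (\<omega> (K - n div 10)))) \<le> C \<omega> / eta\<^sup>2"
      unfolding C_def by (rule jmax_anchor[OF eta K_def])
    also have "real (jmax (6 * eta) L (\<lambda>n. R n \<omega>)) \<le> 4 / (6 * eta)\<^sup>2 * S \<omega>"
      unfolding S_def using eta by (intro jmax_square_sum) auto
    also have "C \<omega> / eta\<^sup>2 + 4 / (6 * eta)\<^sup>2 * S \<omega> \<le> 64 / lam\<^sup>2 * C \<omega> + 64 / lam\<^sup>2 * S \<omega>"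
      using lam C0[of \<omega>] S0[of \<omega>] by (intro add_mono mult_right_mono) (auto simp: eta_def power_divide power_mult_distrib field_simps)
    finally show ?thesis by simp
  qed
  define A where "A = {x. M \<le> real (jmax lam L (\<lambda>n. T n (cb_fun g) x))}"
  have A [measurable]: "A \<in> sets borel"
  proof -
    have "{x \<in> space borel. M \<le> real (jmax lam L (\<lambda>n. T n (cb_fun g) x))} \<in> sets borel" by measurable
    then show ?thesis by (simp add: A_def)
  qed
  have "emeasure h A = (\<integral>\<^sup>+\<omega>. indicator A (\<omega> K) \<partial>path \<nu> K)"
    using path_marginal[of \<nu> "indicator A" K, OF \<nu>1] A by (simp add: sets_h)
  also have "\<dots> \<le> (\<integral>\<^sup>+\<omega>. ennreal (64 / (lam\<^sup>2 * M)) * (ennreal (C \<omega>) + ennreal (S \<omega>)) \<partial>path \<nu> K)"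
  proof (rule nn_integral_mono)
    fix \<omega>
    have "1 \<le> 64 / (lam\<^sup>2 * M) * (C \<omega> + S \<omega>)" if "\<omega> K \<in> A"
    proof -
      have "M \<le> 64 / lam\<^sup>2 * (C \<omega> + S \<omega>)" using that jump[of \<omega>] by (simp add: A_def distrib_left)
      then have "M / M \<le> 64 / lam\<^sup>2 * (C \<omega> + S \<omega>) / M" using M by (intro divide_right_mono) auto
      then show ?thesis using M by simp
    qed
    then show "indicator A (\<omega> K) \<le> ennreal (64 / (lam\<^sup>2 * M)) * (ennreal (C \<omega>) + ennreal (S \<omega>))"
      using M C0 S0 by (auto simp: indicator_def simp flip: ennreal_plus ennreal_mult ennreal_1 intro!: ennreal_leI)
  qed
  also have "\<dots> = ennreal (64 / (lam\<^sup>2 * M)) * ((\<integral>\<^sup>+\<omega>. ennreal (C \<omega>) \<partial>path \<nu> K) + (\<integral>\<^sup>+\<omega>. ennreal (S \<omega>) \<partial>path \<nu> K))"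
    by (simp add: nn_integral_cmult nn_integral_add)
  also have "\<dots> \<le> ennreal (64 / (lam\<^sup>2 * M)) * (ennreal ((ip.N g)\<^sup>2) + ennreal (6184752906240 * (ip.N g)\<^sup>2))"
    by (intro mult_left_mono add_mono intS intC) auto
  also have "\<dots> = ennreal (64 / (lam\<^sup>2 * M) * (6184752906241 * (ip.N g)\<^sup>2))"
    using M by (simp flip: ennreal_plus ennreal_mult)
  also have "\<dots> \<le> ennreal (10^15 * (ip.N g)\<^sup>2 / (lam\<^sup>2 * M))"
    using M by (intro ennreal_leI) (simp add: divide_right_mono)
  finally show ?thesis unfolding A_def by simp
qed

end

section \<open>Covering by translates\<close>

text \<open>A selection without disjointness. Among the families \<open>J\<close> satisfying the
  first inequality one is built that cannot be enlarged with a gain in \<open>M'\<close>. An index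
  violating the second inequality could be added to \<open>J\<close>: the first inequality would
  persist and the covered mass would grow. Near-maximal choices with error 1/(n+1) keep the family
  countable.\<close>

lemma greedy_cover:
  fixes A A' :: "'i \<Rightarrow> 'a set" and M M' :: "'a measure"
  assumes "finite_measure M'" and sets: "sets M' = sets M"
    and A: "\<And>i. i \<in> I \<Longrightarrow> A i \<in> sets M" and A': "\<And>i. i \<in> I \<Longrightarrow> A' i \<in> sets M"
  obtains J where "J \<subseteq> I" "countable J"
    "ennreal \<beta> * emeasure M (\<Union>i\<in>J. A' i) \<le> emeasure M' (\<Union>i\<in>J. A i)"
    "\<And>i. i \<in> I \<Longrightarrow> emeasure M' (A i - (\<Union>i\<in>J. A i)) \<le> ennreal \<beta> * emeasure M (A' i)"
proof -
  interpret M': finite_measure M' by fact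
  define U U' where "U J = (\<Union>i\<in>J. A i)" and "U' J = (\<Union>i\<in>J. A' i)" for J
  define good where "good J \<longleftrightarrow> J \<subseteq> I \<and> countable J \<and> ennreal \<beta> * emeasure M (U' J) \<le> emeasure M' (U J)" for J
  have UM: "U J \<in> sets M" "U' J \<in> sets M" if "J \<subseteq> I" "countable J" for J
    unfolding U_def U'_def using that A A' by (auto intro!: sets.countable_UN')
  have UM': "U J \<in> sets M'" if "J \<subseteq> I" "countable J" for J using UM[OF that] sets by simp
  have mono: "measure M' (U J) \<le> measure M' (U J')" if "J \<subseteq> J'" "J' \<subseteq> I" "countable J'" for J J'
    using that by (intro M'.finite_measure_mono UM') (auto simp: U_def)
  have ex: "\<exists>J'. good J' \<and> J \<subseteq> J' \<and> (\<forall>J''. good J'' \<and> J' \<subseteq> J'' \<longrightarrow> measure M' (U J'') \<le> measure M' (U J') + 1 / real (Suc n))"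
    if "good J" for J n
  proof (rule ccontr)
    assume no: "\<not> ?thesis"
    \<comment> \<open>Each failure of near-maximality gains more than 1/(n+1), so repeating it would
      exceed the total mass.\<close>
    have "\<exists>J'. good J' \<and> J \<subseteq> J' \<and> measure M' (U J') \<ge> real k / real (Suc n)" for k
    proof (induction k)
      case 0
      then show ?case using that by auto
    next
      case (Suc k)
      then obtain J' where J': "good J'" "J \<subseteq> J'" "measure M' (U J') \<ge> real k / real (Suc n)" by blast
      then obtain J'' where "good J''" "J' \<subseteq> J''" "measure M' (U J'') > measure M' (U J') + 1 / real (Suc n)"
        using no by (meson not_le)
      moreover have "real (Suc k) / real (Suc n) = real k / real (Suc n) + 1 / real (Suc n)"
        by (simp add: add_divide_distrib)
      ultimately show ?case using J' by (intro exI[of _ J'']) auto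
    qed
    moreover obtain k :: nat where "real k / real (Suc n) > measure M' (space M')"
    proof -
      obtain k :: nat where "real k > measure M' (space M') * real (Suc n)" using reals_Archimedean2 by blast
      then show ?thesis by (intro that[of k]) (simp add: pos_less_divide_eq)
    qed
    ultimately show False using M'.bounded_measure by (meson not_le order_less_le_trans)
  qed
  have "\<exists>f. \<forall>n. good (f n) \<and> (f n \<subseteq> f (Suc n) \<and>
      (\<forall>J''. good J'' \<and> f (Suc n) \<subseteq> J'' \<longrightarrow> measure M' (U J'') \<le> measure M' (U (f (Suc n))) + 1 / real (Suc n)))"
  proof (rule dependent_nat_choice)
    show "\<exists>J. good J" by (intro exI[of _ "{}"]) (simp add: good_def U_def U'_def)
  qed (use ex in blast)
  then obtain f where f: "\<And>n. good (f n)" "\<And>n. f n \<subseteq> f (Suc n)"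
    "\<And>n J''. good J'' \<Longrightarrow> f (Suc n) \<subseteq> J'' \<Longrightarrow> measure M' (U J'') \<le> measure M' (U (f (Suc n))) + 1 / real (Suc n)"
    by blast
  define J where "J = (\<Union>n. f n)"
  have JI: "J \<subseteq> I" "countable J" using f(1) unfolding J_def good_def by auto
  have inc: "incseq f" using f(2) by (rule incseq_SucI)
  have "emeasure M (U' J) = (SUP n. emeasure M (U' (f n)))"
  proof -
    have "U' J = (\<Union>n. U' (f n))" unfolding U'_def J_def by auto
    moreover have "incseq (\<lambda>n. U' (f n))" using inc unfolding U'_def incseq_def by blast
    moreover have "range (\<lambda>n. U' (f n)) \<subseteq> sets M" using f(1) UM unfolding good_def by auto
    ultimately show ?thesis by (simp add: SUP_emeasure_incseq)
  qed
  then have "ennreal \<beta> * emeasure M (U' J) = (SUP n. ennreal \<beta> * emeasure M (U' (f n)))"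
    by (simp add: SUP_mult_left_ennreal)
  also have "\<dots> \<le> emeasure M' (U J)"
  proof (rule SUP_least)
    fix n
    have "ennreal \<beta> * emeasure M (U' (f n)) \<le> emeasure M' (U (f n))" using f(1)[of n] by (simp add: good_def)
    also have "\<dots> \<le> emeasure M' (U J)" by (intro emeasure_mono UM' JI) (auto simp: U_def J_def)
    finally show "ennreal \<beta> * emeasure M (U' (f n)) \<le> emeasure M' (U J)" .
  qed
  finally have gJ: "good J" using JI by (simp add: good_def)
  show ?thesis
  proof (rule that)
    show "J \<subseteq> I" "countable J" by fact+
    show "ennreal \<beta> * emeasure M (\<Union>i\<in>J. A' i) \<le> emeasure M' (\<Union>i\<in>J. A i)"
      using gJ by (simp add: good_def U_def U'_def)
    show "emeasure M' (A i - (\<Union>i\<in>J. A i)) \<le> ennreal \<beta> * emeasure M (A' i)" if i: "i \<in> I" for i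
    proof (rule ccontr)
      assume "\<not> ?thesis"
      then have viol: "ennreal \<beta> * emeasure M (A' i) < emeasure M' (A i - U J)" by (simp add: U_def)
      have sAi: "A i - U J \<in> sets M'" "A' i \<in> sets M" using A A' i UM'[OF JI] sets by auto
      have eU: "U (insert i J) = U J \<union> (A i - U J)" "U' (insert i J) = U' J \<union> A' i" by (auto simp: U_def U'_def)
      have "emeasure M (U' (insert i J)) \<le> emeasure M (U' J) + emeasure M (A' i)"
        unfolding eU by (intro emeasure_subadditive UM JI sAi)
      then have "ennreal \<beta> * emeasure M (U' (insert i J)) \<le> ennreal \<beta> * emeasure M (U' J) + ennreal \<beta> * emeasure M (A' i)"
        by (metis distrib_left mult_left_mono zero_le)
      also have "\<dots> \<le> emeasure M' (U J) + emeasure M' (A i - U J)"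
        using gJ viol by (intro add_mono) (auto simp: good_def)
      also have "\<dots> = emeasure M' (U (insert i J))"
        unfolding eU by (intro plus_emeasure UM' JI sAi) auto
      finally have g: "good (insert i J)" using JI i by (simp add: good_def)
      have add: "measure M' (U (insert i J)) = measure M' (U J) + measure M' (A i - U J)"
        unfolding eU by (intro M'.finite_measure_Union UM' JI sAi) auto
      have pos: "0 < measure M' (A i - U J)"
        using viol M'.emeasure_eq_measure[of "A i - U J"] by (simp add: less_le) (metis ennreal_0 measure_nonneg not_less_zero order_le_less)
      then obtain n where n: "1 / real (Suc n) < measure M' (A i - U J)"
        using reals_Archimedean[OF pos] by (auto simp: inverse_eq_divide)
      have "measure M' (U (insert i J)) \<le> measure M' (U (f (Suc n))) + 1 / real (Suc n)"
        by (rule f(3)[OF g]) (auto simp: J_def)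
      also have "measure M' (U (f (Suc n))) \<le> measure M' (U J)"
        by (intro mono JI) (auto simp: J_def)
      finally show False using add n by linarith
    qed
  qed
qed

section \<open>Left translates under a right Haar measure\<close>

context haar_space
begin

text \<open>Fubini twice, with right invariance once in each inner variable, decouples
  \<open>E\<close> from \<open>B\<close>.\<close>

lemma translate_integral:
  assumes [measurable]: "E \<in> sets borel" "B \<in> sets borel"
  shows "(\<integral>\<^sup>+x. indicator B x * emeasure h {s. x + s \<in> E} \<partial>h) = emeasure h E * emeasure h {s. - s \<in> B}"
proof -
  have mset: "{s. x + s \<in> E} \<in> sets h" for x
  proof -
    have "{s \<in> space h. x + s \<in> E} \<in> sets h" by measurable
    then show ?thesis by simp
  qed
  have mneg: "{s. - s \<in> B} \<in> sets h"
  proof -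
    have "{s \<in> space h. - s \<in> B} \<in> sets h" by measurable
    then show ?thesis by simp
  qed
  interpret hh: pair_sigma_finite h h ..
  have "(\<integral>\<^sup>+x. indicator B x * emeasure h {s. x + s \<in> E} \<partial>h)
      = (\<integral>\<^sup>+x. \<integral>\<^sup>+s. indicator B x * indicator E (x + s) \<partial>h \<partial>h)"
  proof (rule nn_integral_cong)
    fix x
    have "emeasure h {s. x + s \<in> E} = (\<integral>\<^sup>+s. indicator {s. x + s \<in> E} s \<partial>h)" using mset by simp
    also have "\<dots> = (\<integral>\<^sup>+s. indicator E (x + s) \<partial>h)" by (intro nn_integral_cong) (simp add: indicator_def)
    finally show "indicator B x * emeasure h {s. x + s \<in> E} = (\<integral>\<^sup>+s. indicator B x * indicator E (x + s) \<partial>h)"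
      by (simp add: nn_integral_cmult)
  qed
  also have "\<dots> = (\<integral>\<^sup>+s. \<integral>\<^sup>+x. indicator B x * indicator E (x + s) \<partial>h \<partial>h)"
    by (rule hh.Fubini') measurable
  also have "\<dots> = (\<integral>\<^sup>+s. \<integral>\<^sup>+x. indicator B (x - s) * indicator E x \<partial>h \<partial>h)"
  proof (rule nn_integral_cong)
    fix s
    show "(\<integral>\<^sup>+x. indicator B x * indicator E (x + s) \<partial>h) = (\<integral>\<^sup>+x. indicator B (x - s) * indicator E x \<partial>h)"
      using nn_shift[of "\<lambda>x. indicator B (x - s) * indicator E x" s] by simp
  qed
  also have "\<dots> = (\<integral>\<^sup>+x. \<integral>\<^sup>+s. indicator B (x - s) * indicator E x \<partial>h \<partial>h)"
    by (rule hh.Fubini') measurable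
  also have "\<dots> = (\<integral>\<^sup>+x. emeasure h {s. - s \<in> B} * indicator E x \<partial>h)"
  proof (rule nn_integral_cong)
    fix x
    have "(\<integral>\<^sup>+s. indicator B (x - s) \<partial>h) = (\<integral>\<^sup>+s. indicator B (x - (s + x)) \<partial>h)"
      using nn_shift[of "\<lambda>s. indicator B (x - s)" x] by simp
    also have "\<dots> = (\<integral>\<^sup>+s. indicator {s. - s \<in> B} s \<partial>h)"
    proof (rule nn_integral_cong)
      fix s
      have "x - (s + x) = - s"
        by (simp add: diff_conv_add_uminus minus_add add.assoc[symmetric] del: add_uminus_conv_diff)
      then show "indicator B (x - (s + x)) = indicator {s. - s \<in> B} s" by (simp add: indicator_def)
    qed
    also have "\<dots> = emeasure h {s. - s \<in> B}" using mneg by simp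
    finally show "(\<integral>\<^sup>+s. indicator B (x - s) * indicator E x \<partial>h) = emeasure h {s. - s \<in> B} * indicator E x"
      by (simp add: nn_integral_multc)
  qed
  also have "\<dots> = emeasure h E * emeasure h {s. - s \<in> B}"
    by (subst nn_integral_cmult) (auto simp: mult.commute sets_h)
  finally show ?thesis .
qed

text \<open>By uniqueness of Haar measure every point has this property; almost every point is enough here.\<close>

definition modular_point :: "'g \<Rightarrow> bool" where
  "modular_point x \<longleftrightarrow> (\<exists>c>0. \<forall>E\<in>sets borel. emeasure h {s. x + s \<in> E} = ennreal c * emeasure h E)"

text \<open>By \<open>translate_integral\<close> both sides have the same integral over every Borel
  set \<open>B\<close>, namely the product of the measures of \<open>E\<close>, \<open>D\<close> and
  the reflected \<open>B\<close>.\<close>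

lemma AE_modular_pair:
  assumes E: "E \<in> sets borel" and D: "D \<in> sets borel"
  shows "AE x in h. emeasure h {s. x + s \<in> E} * emeasure h D = emeasure h {s. x + s \<in> D} * emeasure h E"
proof -
  have meas [measurable]: "(\<lambda>x. emeasure h {s. x + s \<in> E}) \<in> borel_measurable h" if [measurable]: "E \<in> sets borel" for E
  proof -
    have "(\<lambda>x. emeasure h {s. x + s \<in> E}) = (\<lambda>x. \<integral>\<^sup>+s. indicator E (x + s) \<partial>h)"
    proof
      fix x
      have "{s \<in> space h. x + s \<in> E} \<in> sets h" by measurable
      then have "emeasure h {s. x + s \<in> E} = (\<integral>\<^sup>+s. indicator {s. x + s \<in> E} s \<partial>h)" by simp
      also have "\<dots> = (\<integral>\<^sup>+s. indicator E (x + s) \<partial>h)" by (intro nn_integral_cong) (simp add: indicator_def)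
      finally show "emeasure h {s. x + s \<in> E} = (\<integral>\<^sup>+s. indicator E (x + s) \<partial>h)" .
    qed
    then show ?thesis by simp
  qed
  show ?thesis
  proof (rule density_unique)
    show "density h (\<lambda>x. emeasure h {s. x + s \<in> E} * emeasure h D) = density h (\<lambda>x. emeasure h {s. x + s \<in> D} * emeasure h E)"
    proof (rule measure_eqI)
      fix B assume "B \<in> sets (density h (\<lambda>x. emeasure h {s. x + s \<in> E} * emeasure h D))"
      then have B: "B \<in> sets borel" by (simp add: sets_h)
      have *: "emeasure (density h (\<lambda>x. emeasure h {s. x + s \<in> E} * emeasure h D)) B
          = emeasure h E * emeasure h {s. - s \<in> B} * emeasure h D" if E: "E \<in> sets borel" for E D
      proof -
        note [measurable] = E B
        have "emeasure (density h (\<lambda>x. emeasure h {s. x + s \<in> E} * emeasure h D)) B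
            = (\<integral>\<^sup>+x. emeasure h {s. x + s \<in> E} * emeasure h D * indicator B x \<partial>h)"
          by (subst emeasure_density) (auto simp: sets_h)
        also have "\<dots> = (\<integral>\<^sup>+x. indicator B x * emeasure h {s. x + s \<in> E} * emeasure h D \<partial>h)"
          by (intro nn_integral_cong) (simp add: ac_simps)
        also have "\<dots> = (\<integral>\<^sup>+x. indicator B x * emeasure h {s. x + s \<in> E} \<partial>h) * emeasure h D"
          by (rule nn_integral_multc) measurable
        finally show ?thesis by (simp add: translate_integral[OF E B])
      qed
      show "emeasure (density h (\<lambda>x. emeasure h {s. x + s \<in> E} * emeasure h D)) B
          = emeasure (density h (\<lambda>x. emeasure h {s. x + s \<in> D} * emeasure h E)) B"
        unfolding *[OF E] *[OF D] by (simp add: ac_simps)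
    qed simp
  qed (use E D in measurable)
qed

text \<open>The exceptional null set must not depend on \<open>E\<close>. So proportionality,
  normalised by \<open>E0\<close>, is first required only on a countable intersection-stable
  generator cut by countably many pieces of finite measure; uniqueness of measures extends it to all
  Borel sets.\<close>

lemma AE_modular_point:
  assumes E0: "compact E0" "0 < emeasure h E0"
  shows "AE x in h. modular_point x"
proof -
  have sE0: "E0 \<in> sets borel" using E0 borel_compact by auto
  obtain B :: "'g set set" where B: "countable B" "topological_basis B" using ex_countable_basis by blast
  define G where "G = {\<Inter>X |X. X \<subseteq> B \<and> finite X}"
  have cG: "countable G"
  proof -
    have "G = Inter ` {X. X \<subseteq> B \<and> finite X}" by (auto simp: G_def)
    then show ?thesis using countable_Collect_finite_subset[OF B(1)] by (simp add: conj_commute)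
  qed
  have B_borel: "X \<in> sets borel" if "X \<in> B" for X
    using topological_basis_open[OF B(2) that] by simp
  have G_borel: "X \<in> sets borel" if "X \<in> G" for X
  proof -
    obtain Y where Y: "X = \<Inter>Y" "Y \<subseteq> B" "finite Y" using \<open>X \<in> G\<close> unfolding G_def by blast
    have "open (\<Inter>Y)" using Y topological_basis_open[OF B(2)] by (intro open_Inter) auto
    then show ?thesis using Y by simp
  qed
  have UG: "UNIV \<in> G" unfolding G_def by (intro CollectI exI[of _ "{}"]) auto
  have stable: "Int_stable G"
    unfolding Int_stable_def G_def
  proof (intro ballI)
    fix a b assume "a \<in> {\<Inter>X |X. X \<subseteq> B \<and> finite X}" "b \<in> {\<Inter>X |X. X \<subseteq> B \<and> finite X}"
    then obtain X Y where "a = \<Inter>X" "X \<subseteq> B" "finite X" "b = \<Inter>Y" "Y \<subseteq> B" "finite Y" by blast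
    then show "a \<inter> b \<in> {\<Inter>X |X. X \<subseteq> B \<and> finite X}"
      by (intro CollectI exI[of _ "X \<union> Y"]) auto
  qed
  have gen: "sets borel = sigma_sets UNIV G"
  proof
    show "sigma_sets UNIV G \<subseteq> sets borel"
      using G_borel sets.sigma_sets_subset[of G borel] by auto
    have "B \<subseteq> G"
    proof
      fix X assume "X \<in> B"
      then show "X \<in> G" unfolding G_def by (intro CollectI exI[of _ "{X}"]) auto
    qed
    then show "sets borel \<subseteq> sigma_sets UNIV G"
      unfolding borel_eq_countable_basis[OF B] by (simp add: sigma_sets_mono')
  qed
  obtain A :: "nat \<Rightarrow> 'g set" where A: "range A \<subseteq> sets h" "(\<Union>i. A i) = space h"
    "\<And>i. emeasure h (A i) \<noteq> \<infinity>" "disjoint_family A" using sigma_finite_disjoint by metis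
  have sA: "A i \<in> sets borel" for i using A(1) sets_h by blast
  have "AE x in h. \<forall>i. \<forall>D\<in>G. emeasure h {s. x + s \<in> D \<inter> A i} * emeasure h E0 = emeasure h {s. x + s \<in> E0} * emeasure h (D \<inter> A i)"
    unfolding AE_all_countable
    by (intro allI AE_ball_countable[THEN iffD2] cG ballI AE_modular_pair sets.Int G_borel sA sE0)
  then show ?thesis
  proof eventually_elim
    case (elim x)
    have meas_shift [measurable]: "(\<lambda>s. x + s) \<in> measurable h borel" by measurable
    define D1 where "D1 = distr h borel (\<lambda>s. x + s)"
    have D1: "emeasure D1 E = emeasure h {s. x + s \<in> E}" if "E \<in> sets borel" for E
      unfolding D1_def using that by (subst emeasure_distr) (auto intro!: arg_cong[of _ _ "emeasure h"])
    have fin0: "emeasure h {s. x + s \<in> E0} \<noteq> \<infinity>"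
    proof -
      have "{s. x + s \<in> E0} = {- x} + E0"
      proof -
        have "s \<in> {- x} + E0" if "x + s \<in> E0" for s
        proof -
          have "- x + (x + s) \<in> {- x} + E0" using that by blast
          then show ?thesis by (simp add: add.assoc[symmetric])
        qed
        moreover have "x + s \<in> E0" if "s \<in> {- x} + E0" for s
          using that by (auto simp: set_plus_def add.assoc[symmetric])
        ultimately show ?thesis by auto
      qed
      moreover have "compact ({- x} + E0)" by (intro compact_add E0) auto
      ultimately show ?thesis using finite_compact by (metis less_irrefl)
    qed
    have on_G: "emeasure D1 (D \<inter> A i) * emeasure h E0 = emeasure h {s. x + s \<in> E0} * emeasure h (D \<inter> A i)"
      if "D \<in> G" for D i
      using elim that unfolding D1[OF sets.Int[OF G_borel[OF that] sA]] by blast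
    have piece: "emeasure D1 (E \<inter> A i) * emeasure h E0 = emeasure h {s. x + s \<in> E0} * emeasure h (E \<inter> A i)"
      if E: "E \<in> sets borel" for E i
    proof -
      define M1 where "M1 = density D1 (\<lambda>s. indicator (A i) s * emeasure h E0)"
      define M2 where "M2 = density h (\<lambda>s. indicator (A i) s * emeasure h {s. x + s \<in> E0})"
      note [measurable] = sA
      have M1: "emeasure M1 E = emeasure D1 (E \<inter> A i) * emeasure h E0" if "E \<in> sets borel" for E
      proof -
        have "emeasure M1 E = (\<integral>\<^sup>+s. indicator (E \<inter> A i) s * emeasure h E0 \<partial>D1)"
          unfolding M1_def using that by (subst emeasure_density) (auto simp: D1_def indicator_def intro!: nn_integral_cong)
        also have "\<dots> = emeasure D1 (E \<inter> A i) * emeasure h E0"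
          using that by (subst nn_integral_multc) (auto simp: D1_def)
        finally show ?thesis .
      qed
      have M2: "emeasure M2 E = emeasure h {s. x + s \<in> E0} * emeasure h (E \<inter> A i)" if "E \<in> sets borel" for E
      proof -
        have "emeasure M2 E = (\<integral>\<^sup>+s. indicator (E \<inter> A i) s * emeasure h {s. x + s \<in> E0} \<partial>h)"
          unfolding M2_def using that by (subst emeasure_density) (auto simp: sets_h indicator_def intro!: nn_integral_cong)
        also have "\<dots> = emeasure h (E \<inter> A i) * emeasure h {s. x + s \<in> E0}"
          using that by (subst nn_integral_multc) (auto simp: sets_h)
        finally show ?thesis by (simp add: mult.commute)
      qed
      have "M1 = M2"
      proof (rule measure_eqI_generator_eq[where E = G and \<Omega> = UNIV and A = "\<lambda>_. UNIV"])
        show "emeasure M1 X = emeasure M2 X" if "X \<in> G" for X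
          using on_G[OF that] that by (simp add: M1 M2 G_borel)
        show "sets M1 = sigma_sets UNIV G" by (simp add: M1_def D1_def gen)
        show "sets M2 = sigma_sets UNIV G" by (simp add: M2_def sets_h gen)
        show "emeasure M1 UNIV \<noteq> \<infinity>" for j :: nat
        proof -
          have "emeasure M1 UNIV = emeasure M2 UNIV"
            using on_G[OF UG, of i] by (simp add: M1 M2)
          also have "\<dots> \<noteq> \<infinity>" using fin0 A(3)[of i] A(3) by (simp add: M2 ennreal_mult_eq_top_iff)
          finally show ?thesis .
        qed
      qed (use stable UG in auto)
      then show ?thesis using M1[OF E] M2[OF E] by simp
    qed
    have all: "emeasure h {s. x + s \<in> E} * emeasure h E0 = emeasure h {s. x + s \<in> E0} * emeasure h E"
      if E: "E \<in> sets borel" for E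
    proof -
      have UE: "(\<Union>i. E \<inter> A i) = E" using A(2) by auto
      have dis: "disjoint_family (\<lambda>i. E \<inter> A i)" using A(4) by (auto simp: disjoint_family_on_def)
      have "emeasure D1 E = (\<Sum>i. emeasure D1 (E \<inter> A i))"
        using suminf_emeasure[of "\<lambda>i. E \<inter> A i" D1, OF _ dis] E sA UE by (simp add: D1_def image_subset_iff)
      moreover have "emeasure h E = (\<Sum>i. emeasure h (E \<inter> A i))"
        using suminf_emeasure[of "\<lambda>i. E \<inter> A i" h, OF _ dis] E sA UE by (simp add: sets_h image_subset_iff)
      ultimately have "emeasure D1 E * emeasure h E0 = emeasure h {s. x + s \<in> E0} * emeasure h E"
        using piece[OF E] by (simp flip: ennreal_suminf_cmult ennreal_suminf_multc)
      then show ?thesis using D1[OF E] by simp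
    qed
    define c where "c = measure h {s. x + s \<in> E0} / measure h E0"
    have m0: "0 < measure h E0" by (rule measure_pos[OF E0])
    have e0: "emeasure h {s. x + s \<in> E0} = ennreal (measure h {s. x + s \<in> E0})"
      using fin0 by (intro emeasure_eq_ennreal_measure) auto
    have cE: "emeasure h {s. x + s \<in> E} = ennreal c * emeasure h E" if E: "E \<in> sets borel" for E
    proof -
      have "emeasure h {s. x + s \<in> E} * ennreal (measure h E0) = (ennreal c * emeasure h E) * ennreal (measure h E0)"
      proof -
        have "ennreal (measure h {s. x + s \<in> E0}) = ennreal c * ennreal (measure h E0)"
          using m0 by (simp add: c_def flip: ennreal_mult')
        then show ?thesis using all[OF E] by (simp add: e0 emeasure_compact[OF E0(1)] ac_simps)
      qed
      then show ?thesis using m0 ennreal_mult_cancel_left[of "ennreal (measure h E0)"] by (simp add: mult.commute)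
    qed
    have "c \<noteq> 0"
    proof
      assume "c = 0"
      then have "emeasure h {s. x + s \<in> UNIV} = 0" using cE[of UNIV] by simp
      then have "emeasure h UNIV = 0" by simp
      then have "emeasure h E0 = 0" using emeasure_mono[of E0 UNIV h] by (metis le_zero_eq sets.top space_h subset_UNIV)
      then show False using E0 by simp
    qed
    then have "0 < c" using measure_nonneg m0 by (simp add: c_def less_le)
    then show ?case using cE by (auto simp: modular_point_def)
  qed
qed

end

section \<open>The Calderon--Zygmund decomposition\<close>

context haar_space
begin

text \<open>\<nu> may be singular, so a bound valid almost everywhere does not pass to the average
  pointwise. But the excess over \<open>c\<close> has integral 0, and averaging preserves
  this.\<close>

lemma av_AE_le:
  assumes \<nu>: "cprob \<nu>" and f: "cbp f" and c: "0 \<le> c" and le: "AE x in h. f x \<le> c"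
  shows "AE x in h. av \<nu> f x \<le> c"
proof -
  define p where "p x = max (f x - c) 0" for x
  note \<nu>n = cprob_cmeasure[OF \<nu>]
  note [measurable] = cbp_measurable[OF f]
  have p: "cbp p"
  proof -
    obtain d where d: "0 \<le> d" "\<And>x. \<bar>f x\<bar> \<le> d" using cbp_bounded[OF f] by blast
    obtain K where K: "compact K" "\<And>x. x \<notin> K \<Longrightarrow> f x = 0" using cbp_support[OF f] by blast
    show ?thesis unfolding p_def
    proof (rule cbpI[OF _ _ K(1), where c = d])
      show "\<bar>max (f x - c) 0\<bar> \<le> d" for x using d(1) d(2)[of x] c by auto
    qed (use K(2) c in auto)
  qed
  have p0: "AE x in h. p x = 0" using le by eventually_elim (simp add: p_def)
  have "(\<integral>x. av \<nu> p x \<partial>h) = 0"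
    using integral_eq_zero_AE[OF p0] by (simp add: integral_av[OF \<nu>n p])
  moreover have "0 \<le> av \<nu> p x" for x by (rule av_nonneg) (simp add: p_def)
  ultimately have "AE x in h. av \<nu> p x = 0"
    using integral_nonneg_eq_0_iff_AE[OF cbp_integrable[OF cbp_av[OF \<nu>n p]]] by simp
  then show ?thesis
  proof eventually_elim
    case (elim x)
    interpret finite_measure \<nu> by (rule cmeasure_finite[OF \<nu>n])
    have "av \<nu> f x \<le> (\<integral>s. p (x + s) + c \<partial>\<nu>)"
      unfolding av_def
      by (intro integral_mono Bochner_Integration.integrable_add[OF cbp_integrable_av integrable_const]
          cbp_integrable_av \<nu>n f p) (auto simp: p_def)
    also have "\<dots> = av \<nu> p x + c"
      using cbp_integrable_av[OF \<nu>n p, of x] cprob_measure[OF \<nu>] by (simp add: av_def cmeasure_space[OF \<nu>n])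
    finally show ?case using elim by simp
  qed
qed

end

section \<open>Removal of mass at one level\<close>

context folner_inv
begin

text \<open>For \<open>i = k - 3\<close> the ratio in \<open>W_inv\<close> is 1, whence
  \<open>Fx_measure\<close>. \<open>D k\<close> contains \<open>F n\<close> and its inverses for
  \<open>n + 3 \<le> k\<close>. In \<open>Fh\<close> two factors make room for two finer averages,
  see \<open>T_T'_T_le_avhat\<close>; the third factor in \<open>Fx\<close> makes room for the
  enlargement of \<open>S\<close> to \<open>S'\<close>.\<close>

definition D :: "nat \<Rightarrow> 'g set" where "D k = (if 3 \<le> k then W (k - 3) else {0})"
definition Fh :: "nat \<Rightarrow> 'g set" where "Fh k = F k + D k + D k"
definition Fx :: "nat \<Rightarrow> 'g set" where "Fx k = F k + D k + D k + D k"

lemma compact_D: "compact (D k)" by (simp add: D_def W_compact)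

lemma zero_D: "0 \<in> D k" by (simp add: D_def W_zero)

lemma compact_Fh: "compact (Fh k)" and compact_Fx: "compact (Fx k)"
  unfolding Fh_def Fx_def by (intro compact_add F_compact compact_D)+

lemma F_Fh: "F k \<subseteq> Fh k"
proof
  fix x assume "x \<in> F k"
  then have "x + 0 + 0 \<in> Fh k" unfolding Fh_def using zero_D by (intro set_plus_intro)
  then show "x \<in> Fh k" by simp
qed

lemma Fx_measure: "emeasure h (Fx k) \<le> ennreal (2 * m k)"
proof (cases "3 \<le> k")
  case True
  have "Fx k \<subseteq> F k \<union> ((F k + W (k - 3) + W (k - 3) + W (k - 3) + W (k - 3)) - F k)"
  proof
    fix x assume "x \<in> Fx k"
    then have "x \<in> F k + W (k - 3) + W (k - 3) + W (k - 3)" using True by (simp add: Fx_def D_def)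
    then have "x + 0 \<in> F k + W (k - 3) + W (k - 3) + W (k - 3) + W (k - 3)" using W_zero by (intro set_plus_intro)
    then show "x \<in> F k \<union> ((F k + W (k - 3) + W (k - 3) + W (k - 3) + W (k - 3)) - F k)" by auto
  qed
  then have "emeasure h (Fx k) \<le> emeasure h (F k \<union> ((F k + W (k - 3) + W (k - 3) + W (k - 3) + W (k - 3)) - F k))"
    by (intro emeasure_mono sets.Un sets.Diff compact_sets compact_add F_compact W_compact)
  also have "\<dots> \<le> emeasure h (F k) + emeasure h ((F k + W (k - 3) + W (k - 3) + W (k - 3) + W (k - 3)) - F k)"
    by (intro emeasure_subadditive sets.Diff compact_sets compact_add F_compact W_compact)
  also have "\<dots> \<le> emeasure h (F k) + ennreal (2 ^ (k - 3 + 3) / 2 ^ k) * emeasure h (F k)"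
    using True by (intro add_left_mono W_inv) auto
  also have "\<dots> = ennreal (2 * m k)"
    using True m_pos[of k] by (simp add: emeasure_compact[OF F_compact] flip: ennreal_plus)
  finally show ?thesis .
next
  case False
  have "Fx k = F k" using False by (simp add: Fx_def D_def set_plus_def)
  then show ?thesis using m_pos[of k] by (simp add: emeasure_compact[OF F_compact] ennreal_leI)
qed

text \<open>Normalised by the measure of \<open>F k\<close> and not of \<open>Fh k\<close>, so that
  it dominates \<open>T k\<close> on nonnegative functions.\<close>

definition avhat :: "nat \<Rightarrow> ('g \<Rightarrow> real) \<Rightarrow> 'g \<Rightarrow> real" where
  "avhat k f x = (1 / m k) * (\<integral>s. indicator (Fh k) s * f (x + s) \<partial>h)"

lemma avhat_integrable:
  assumes f: "cbp f" and A: "compact A" shows "integrable h (\<lambda>s. indicator A s * f (x + s))"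
proof -
  note [measurable] = cbp_measurable[OF f]
  have [measurable]: "A \<in> sets borel" using A borel_compact by auto
  obtain c where c: "\<And>x. \<bar>f x\<bar> \<le> c" using cbp_bounded[OF f] by metis
  show ?thesis
    by (rule integrableI_bounded_set[where A = A and B = c])
      (use A c compact_sets finite_compact in auto)
qed

lemma avhat_mono: "cbp f \<Longrightarrow> cbp g \<Longrightarrow> (\<And>x. f x \<le> g x) \<Longrightarrow> avhat k f x \<le> avhat k g x"
  unfolding avhat_def using m_pos[of k]
  by (intro mult_left_mono integral_mono avhat_integrable compact_Fh) (auto simp: indicator_def)

lemma avhat_sum: "(\<And>i. i \<in> I \<Longrightarrow> cbp (f i)) \<Longrightarrow> avhat k (\<lambda>x. \<Sum>i\<in>I. f i x) x = (\<Sum>i\<in>I. avhat k (f i) x)"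
proof -
  assume f: "\<And>i. i \<in> I \<Longrightarrow> cbp (f i)"
  have "(\<integral>s. indicator (Fh k) s * (\<Sum>i\<in>I. f i (x + s)) \<partial>h) = (\<integral>s. (\<Sum>i\<in>I. indicator (Fh k) s * f i (x + s)) \<partial>h)"
    by (simp add: sum_distrib_left)
  also have "\<dots> = (\<Sum>i\<in>I. \<integral>s. indicator (Fh k) s * f i (x + s) \<partial>h)"
    by (intro Bochner_Integration.integral_sum avhat_integrable compact_Fh f)
  finally show ?thesis unfolding avhat_def by (simp add: sum_divide_distrib)
qed

lemma T_le_avhat:
  assumes f: "cbp f" "\<And>x. 0 \<le> f x" shows "T k f x \<le> avhat k f x"
proof -
  note [measurable] = cbp_measurable[OF f(1)]
  have "T k f x = (1 / m k) * (\<integral>s. indicator (F k) s * f (x + s) \<partial>h)"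
    unfolding T_def av_def by (rule integral_unif) (auto simp: compact_sets F_compact)
  also have "\<dots> \<le> avhat k f x"
    unfolding avhat_def using m_pos[of k] f F_Fh
    by (intro mult_left_mono integral_mono avhat_integrable compact_Fh F_compact) (auto simp: indicator_def)
  finally show ?thesis .
qed

text \<open>\<open>greedy_cover\<close> is applied to the left translates of \<open>Fh k\<close> and
  \<open>Fx k\<close> by modular points, with the mass of \<open>f\<close> against Haar measure. At
  such a point the same factor \<open>c\<close> relates mass and measure on the translate to those
  on the original set, so it cancels. The 2 in \<open>2 * \<beta>\<close> is that of
  \<open>Fx_measure\<close>.\<close>

lemma level_cut:
  assumes f: "cbp f" "\<And>x. 0 \<le> f x" and \<beta>: "0 < \<beta>"
  obtains S S' where "S \<in> sets borel" "S' \<in> sets borel"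
    "ennreal \<beta> * emeasure h S' \<le> ennreal (\<integral>x. f x * indicator S x \<partial>h)"
    "AE x in h. avhat k (\<lambda>y. f y * indicator (- S) y) x \<le> 2 * \<beta>"
    "\<And>y t. y \<in> S \<Longrightarrow> t \<in> D k \<Longrightarrow> y + t \<in> S'"
proof -
  note [measurable] = cbp_measurable[OF f(1)]
  define M' where "M' = density h (\<lambda>x. ennreal (f x))"
  have fi: "integrable h f" by (rule cbp_integrable[OF f(1)])
  have sets': "sets M' = sets h" by (simp add: M'_def)
  have M': "emeasure M' E = ennreal (\<integral>x. f x * indicator E x \<partial>h)" if [measurable]: "E \<in> sets borel" for E
  proof -
    have "emeasure M' E = (\<integral>\<^sup>+x. ennreal (f x * indicator E x) \<partial>h)"
      unfolding M'_def by (subst emeasure_density) (auto simp: sets_h indicator_def intro!: nn_integral_cong)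
    also have "\<dots> = ennreal (\<integral>x. f x * indicator E x \<partial>h)"
      by (intro nn_integral_eq_integral cbp_integrable cbp_indicator_mult f) (auto simp: f)
    finally show ?thesis .
  qed
  have fin: "finite_measure M'"
    by (intro finite_measureI) (use M'[of UNIV] in \<open>simp add: M'_def\<close>)
  define A where "A x = {x} + Fh k" for x
  define A' where "A' x = {x} + Fx k" for x
  have cA: "compact (A x)" "compact (A' x)" for x
    unfolding A_def A'_def by (intro compact_add compact_Fh compact_Fx; simp)+
  obtain J where J: "J \<subseteq> Collect modular_point" "countable J"
    "ennreal \<beta> * emeasure h (\<Union>x\<in>J. A' x) \<le> emeasure M' (\<Union>x\<in>J. A x)"
    "\<And>x. x \<in> Collect modular_point \<Longrightarrow> emeasure M' (A x - (\<Union>x\<in>J. A x)) \<le> ennreal \<beta> * emeasure h (A' x)"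
    using greedy_cover[OF fin sets', of "Collect modular_point" A A' \<beta>] compact_sets[OF cA(1)] compact_sets[OF cA(2)] by metis
  define S S' where "S = (\<Union>x\<in>J. A x)" and "S' = (\<Union>x\<in>J. A' x)"
  have S: "S \<in> sets borel" "S' \<in> sets borel"
    unfolding S_def S'_def using J(2) borel_compact[OF cA(1)] borel_compact[OF cA(2)] by (auto intro: sets.countable_UN')
  show ?thesis
  proof (rule that[OF S])
    show "ennreal \<beta> * emeasure h S' \<le> ennreal (\<integral>x. f x * indicator S x \<partial>h)"
      using J(3) M'[OF S(1)] by (simp add: S_def S'_def)
    show "y + t \<in> S'" if y: "y \<in> S" and t: "t \<in> D k" for y t
    proof -
      obtain x u where xu: "x \<in> J" "y = x + u" "u \<in> Fh k"
        using y unfolding S_def A_def by (auto elim!: set_plus_elim)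
      have "u + t \<in> Fx k" using xu(3) t unfolding Fx_def Fh_def by (intro set_plus_intro)
      then have "x + (u + t) \<in> A' x" unfolding A'_def by (intro set_plus_intro) auto
      then show ?thesis using xu by (auto simp: S'_def add.assoc)
    qed
    have "AE x in h. modular_point x" by (rule AE_modular_point[OF F_compact F_pos])
    then show "AE x in h. avhat k (\<lambda>y. f y * indicator (- S) y) x \<le> 2 * \<beta>"
    proof eventually_elim
      case (elim x)
      then obtain c where c: "0 < c" "\<And>E. E \<in> sets borel \<Longrightarrow> emeasure h {s. x + s \<in> E} = ennreal c * emeasure h E"
        by (auto simp: modular_point_def)
      have sA: "A x \<in> sets borel" "A' x \<in> sets borel" using cA borel_compact by auto
      have in_A: "x + s \<in> {x} + E \<longleftrightarrow> s \<in> E" for s E by (auto simp: set_plus_def)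
      define g where "g y = f y * indicator (A x - S) y" for y
      have g: "cbp g" "\<And>y. 0 \<le> g y" unfolding g_def using f sA S by (auto intro!: cbp_indicator_mult)
      note [measurable] = cbp_measurable[OF g(1)]
      have shift: "(\<integral>\<^sup>+s. ennreal (g (x + s)) \<partial>h) = ennreal c * (\<integral>\<^sup>+y. ennreal (g y) \<partial>h)"
      proof -
        have "distr h borel (\<lambda>s. x + s) = density h (\<lambda>_. ennreal c)"
        proof (rule measure_eqI)
          fix E assume "E \<in> sets (distr h borel (\<lambda>s. x + s))"
          then have E: "E \<in> sets borel" by simp
          have "emeasure (distr h borel (\<lambda>s. x + s)) E = emeasure h {s. x + s \<in> E}"
            using E by (subst emeasure_distr) (auto intro!: arg_cong[of _ _ "emeasure h"])
          then show "emeasure (distr h borel (\<lambda>s. x + s)) E = emeasure (density h (\<lambda>_. ennreal c)) E"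
            using c(2)[OF E] E by (simp add: emeasure_density_const sets_h)
        qed (simp add: sets_h)
        then have "(\<integral>\<^sup>+y. ennreal (g y) \<partial>distr h borel (\<lambda>s. x + s)) = (\<integral>\<^sup>+y. ennreal (g y) \<partial>density h (\<lambda>_. ennreal c))"
          by simp
        then show ?thesis
          by (simp add: nn_integral_distr nn_integral_density nn_integral_cmult)
      qed
      have "ennreal (avhat k (\<lambda>y. f y * indicator (- S) y) x) = ennreal (1 / m k) * (\<integral>\<^sup>+s. ennreal (g (x + s)) \<partial>h)"
      proof -
        have eq: "indicator (Fh k) s * (f (x + s) * indicator (- S) (x + s)) = g (x + s)" for s
          using in_A[of s "Fh k"] by (auto simp: g_def A_def indicator_def)
        have "cbp (\<lambda>y. f y * indicator (- S) y)" using S by (intro cbp_indicator_mult f) auto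
        from avhat_integrable[OF this compact_Fh, of k x]
        have "integrable h (\<lambda>s. g (x + s))" unfolding eq .
        then have "(\<integral>\<^sup>+s. ennreal (g (x + s)) \<partial>h) = ennreal (\<integral>s. g (x + s) \<partial>h)"
          by (intro nn_integral_eq_integral) (auto simp: g)
        moreover have "avhat k (\<lambda>y. f y * indicator (- S) y) x = (1 / m k) * (\<integral>s. g (x + s) \<partial>h)"
          unfolding avhat_def eq ..
        moreover have "ennreal ((1 / m k) * (\<integral>s. g (x + s) \<partial>h)) = ennreal (1 / m k) * ennreal (\<integral>s. g (x + s) \<partial>h)"
          using m_pos[of k] by (intro ennreal_mult) (auto intro: Bochner_Integration.integral_nonneg g)
        ultimately show ?thesis by simp
      qed
      also have "\<dots> = ennreal (1 / m k) * (ennreal c * emeasure M' (A x - S))"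
      proof -
        have "(\<integral>\<^sup>+y. ennreal (g y) \<partial>h) = emeasure M' (A x - S)"
          unfolding M'[OF sets.Diff[OF sA(1) S(1)]] g_def[symmetric]
          by (intro nn_integral_eq_integral cbp_integrable g) (auto simp: g)
        then show ?thesis by (simp add: shift)
      qed
      also have "\<dots> \<le> ennreal (1 / m k) * (ennreal c * (ennreal \<beta> * emeasure h (A' x)))"
        using J(4)[of x] elim by (intro mult_left_mono) (auto simp: S_def)
      also have "ennreal c * (ennreal \<beta> * emeasure h (A' x)) = ennreal \<beta> * emeasure h (Fx k)"
      proof -
        have "ennreal c * emeasure h (A' x) = emeasure h (Fx k)"
          using c(2)[OF sA(2)] by (simp add: A'_def in_A)
        then show ?thesis by (metis mult.left_commute)
      qed
      also have "ennreal (1 / m k) * (ennreal \<beta> * emeasure h (Fx k)) \<le> ennreal (1 / m k) * (ennreal \<beta> * ennreal (2 * m k))"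
        by (intro mult_left_mono Fx_measure) auto
      also have "\<dots> = ennreal (2 * \<beta>)"
        using m_pos[of k] \<beta> by (simp flip: ennreal_mult')
      finally show ?case using \<beta> by (simp add: ennreal_le_iff)
    qed
  qed
qed

text \<open>Both sets of finer shifts lie in \<open>D (Suc k) = W (k - 2)\<close>, because
  \<open>Suc j \<le> k - 2\<close>.\<close>

lemma T_T'_T_le_avhat:
  assumes f: "cbp f" "\<And>x. 0 \<le> f x" and j: "j + 3 \<le> k"
  shows "T (Suc k) (T' (Suc j) (T j f)) x \<le> avhat (Suc k) f x"
proof -
  have eq: "T' (Suc j) (T j f) = av (conv (neg (U (Suc j))) (U j)) f"
    unfolding T_def T'_def by (rule ext) (rule av_conv[OF cmeasure_negU cmeasure_U f(1), symmetric])
  have supp: "AE t in conv (neg (U (Suc j))) (U j). t \<in> uminus ` F (Suc j) + F j"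
    by (intro AE_conv cmeasure_negU cmeasure_U compact_neg F_compact negU_supp U_supp)
  have sub: "F (Suc k) + (uminus ` F (Suc j) + F j) \<subseteq> Fh (Suc k)"
  proof -
    have "uminus ` F (Suc j) \<subseteq> D (Suc k)" "F j \<subseteq> D (Suc k)"
      using j W_negF[of "Suc j" "Suc k - 3"] W_F[of j "Suc k - 3"] by (simp_all add: D_def)
    then have "F (Suc k) + (uminus ` F (Suc j) + F j) \<subseteq> F (Suc k) + (D (Suc k) + D (Suc k))"
      by (intro set_plus_mono2 order_refl)
    also have "\<dots> = Fh (Suc k)" by (simp add: Fh_def add.assoc)
    finally show ?thesis .
  qed
  show ?thesis
    unfolding eq unfolding T_def avhat_def
    by (rule av_dominate[OF F_compact F_pos cprob_conv[OF cprob_negU cprob_U] f supp sub compact_Fh])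
qed

lemma markov_cbp:
  assumes p: "cbp p" "\<And>x. 0 \<le> p x" and t: "0 < t"
  shows "emeasure h {x. t \<le> p x} \<le> ennreal ((\<integral>x. p x \<partial>h) / t)"
proof -
  note [measurable] = cbp_measurable[OF p(1)]
  have m: "{x. t \<le> p x} \<in> sets h"
  proof -
    have "{x \<in> space h. t \<le> p x} \<in> sets h" by measurable
    then show ?thesis by simp
  qed
  have "emeasure h {x. t \<le> p x} = (\<integral>\<^sup>+x. indicator {x. t \<le> p x} x \<partial>h)" using m by simp
  also have "\<dots> \<le> (\<integral>\<^sup>+x. ennreal (p x / t) \<partial>h)"
    using p t by (intro nn_integral_mono) (auto simp: indicator_def simp flip: ennreal_1 intro!: ennreal_leI)
  also have "\<dots> = ennreal (\<integral>x. p x / t \<partial>h)"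
    using p t by (intro nn_integral_eq_integral) (auto intro: cbp_integrable)
  finally show ?thesis by simp
qed

lemma square_sum_le:
  fixes v :: "nat \<Rightarrow> real"
  assumes "\<And>k. 0 \<le> v k"
  shows "(\<Sum>k\<le>n. v k)\<^sup>2 \<le> 2 * (\<Sum>k\<le>n. (\<Sum>j\<le>k. v j) * v k)"
proof (induction n)
  case (Suc n)
  have "(\<Sum>k\<le>Suc n. v k)\<^sup>2 = (\<Sum>k\<le>n. v k)\<^sup>2 + 2 * (\<Sum>k\<le>n. v k) * v (Suc n) + (v (Suc n))\<^sup>2"
    by (simp add: power2_eq_square algebra_simps)
  also have "\<dots> \<le> 2 * (\<Sum>k\<le>n. (\<Sum>j\<le>k. v j) * v k) + 2 * (\<Sum>k\<le>n. v k) * v (Suc n) + 2 * (v (Suc n))\<^sup>2"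
    using Suc by (intro add_mono) auto
  also have "\<dots> = 2 * (\<Sum>k\<le>Suc n. (\<Sum>j\<le>k. v j) * v k)"
    by (simp add: power2_eq_square algebra_simps)
  finally show ?case .
qed (simp add: power2_eq_square assms)

lemma geometric_above: "(\<Sum>n\<le>L. if k \<le> n + 3 then 2 ^ k / 2 ^ n else 0) \<le> (16::real)"
proof -
  \<comment> \<open>The last summand is counted once more because in a series of ratio 1/2 it bounds
    the whole tail; this makes the induction close.\<close>
  have "(if k \<le> L + 3 then (\<Sum>n\<le>L. if k \<le> n + 3 then 2 ^ k / 2 ^ n else 0) + 2 ^ k / 2 ^ L \<le> (16::real)
    else (\<Sum>n\<le>L. if k \<le> n + 3 then 2 ^ k / (2::real) ^ n else 0) = 0)"
  proof (induction L)
    case 0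
    have "k \<le> 3 \<Longrightarrow> (2::real) ^ k \<le> 2 ^ 3" by (intro power_increasing) auto
    then show ?case by auto
  next
    case (Suc L)
    consider "k \<le> L + 3" | "k = L + 4" | "k > L + 4" by linarith
    then show ?case
    proof cases
      case 1
      then show ?thesis using Suc by simp
    next
      case 2
      then show ?thesis using Suc by (simp add: power_add)
    next
      case 3
      then show ?thesis using Suc by simp
    qed
  qed
  moreover have "0 \<le> (2::real) ^ k / 2 ^ L" by simp
  ultimately show ?thesis by (smt (verit))
qed

lemma geometric_below: "(\<Sum>n\<le>L. if n + 3 < k then 2 ^ n / 2 ^ k else 0) \<le> (1::real)"
proof -
  have s: "(\<Sum>n<k. 2 ^ n) = (2::real) ^ k - 1" by (induction k) auto
  have "(\<Sum>n\<le>L. if n + 3 < k then 2 ^ n / 2 ^ k else 0) = (\<Sum>n\<in>{n. n \<le> L \<and> n + 3 < k}. 2 ^ n / (2::real) ^ k)"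
    by (subst sum.inter_filter[symmetric]) (auto intro!: sum.cong)
  also have "\<dots> \<le> (\<Sum>n<k. 2 ^ n / (2::real) ^ k)" by (intro sum_mono2) auto
  also have "\<dots> \<le> 1" using s by (simp add: sum_divide_distrib[symmetric])
  finally show ?thesis .
qed

end

section \<open>Decomposition into pieces and their smoothing\<close>

context folner_inv
begin

text \<open>The part \<open>b (Suc k)\<close> is the mass removed at level \<open>k\<close>, the part \<open>b 0\<close> is never removed, and
  \<open>p k\<close> is the mass that remains when all levels from \<open>k\<close> on have been treated.\<close>

lemma Calderon_Zygmund:
  fixes f :: "'g \<Rightarrow> real" and K :: nat
  assumes f: "cbp f" "\<And>x. 0 \<le> f x" and \<beta>: "0 < \<beta>"
  obtains p b :: "nat \<Rightarrow> 'g \<Rightarrow> real" and S S' :: "nat \<Rightarrow> 'g set" where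
    "\<And>k. cbp (p k)" "\<And>k x. 0 \<le> p k x" "\<And>j k x. j \<le> k \<Longrightarrow> k \<le> K \<Longrightarrow> p j x \<le> p k x" "p K = f"
    "\<And>k. cbp (b k)" "\<And>k x. k \<le> K \<Longrightarrow> 0 \<le> b k x" "\<And>k x. (\<Sum>j\<le>k. b j x) = p k x"
    "\<And>k x. k < K \<Longrightarrow> x \<notin> S k \<Longrightarrow> b (Suc k) x = 0"
    "\<And>k. k < K \<Longrightarrow> S' k \<in> sets borel"
    "\<And>k. k < K \<Longrightarrow> ennreal \<beta> * emeasure h (S' k) \<le> ennreal (\<integral>x. b (Suc k) x \<partial>h)"
    "\<And>k. k < K \<Longrightarrow> AE x in h. avhat k (p k) x \<le> 2 * \<beta>"
    "\<And>k y t. k < K \<Longrightarrow> y \<in> S k \<Longrightarrow> t \<in> D k \<Longrightarrow> y + t \<in> S' k"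
proof -
  \<comment> \<open>\<open>level_cut\<close> in the form of a total relation, guarded by its
    hypotheses, so that the cuts can be chosen as a function \<open>sel\<close> of level and
    remaining mass.\<close>
  define Q where "Q k \<psi> s \<longleftrightarrow> (cbp \<psi> \<and> (\<forall>x. 0 \<le> \<psi> x) \<longrightarrow>
      fst s \<in> sets borel \<and> snd s \<in> sets borel \<and>
      ennreal \<beta> * emeasure h (snd s) \<le> ennreal (\<integral>x. \<psi> x * indicator (fst s) x \<partial>h) \<and>
      (AE x in h. avhat k (\<lambda>y. \<psi> y * indicator (- fst s) y) x \<le> 2 * \<beta>) \<and>
      (\<forall>y t. y \<in> fst s \<longrightarrow> t \<in> D k \<longrightarrow> y + t \<in> snd s))" for k \<psi> s
  have "\<forall>k \<psi>. \<exists>s. Q k \<psi> s"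
  proof (intro allI)
    fix k \<psi>
    show "\<exists>s. Q k \<psi> s"
    proof (cases "cbp \<psi> \<and> (\<forall>x. 0 \<le> \<psi> x)")
      case True
      then have \<psi>: "cbp \<psi>" "\<And>x. 0 \<le> \<psi> x" by auto
      obtain S S' where "S \<in> sets borel" "S' \<in> sets borel"
        "ennreal \<beta> * emeasure h S' \<le> ennreal (\<integral>x. \<psi> x * indicator S x \<partial>h)"
        "AE x in h. avhat k (\<lambda>y. \<psi> y * indicator (- S) y) x \<le> 2 * \<beta>"
        "\<And>y t. y \<in> S \<Longrightarrow> t \<in> D k \<Longrightarrow> y + t \<in> S'" using level_cut[where k = k, OF \<psi> \<beta>] by blast
      then show ?thesis unfolding Q_def by (intro exI[of _ "(S, S')"]) auto
    qed (auto simp: Q_def)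
  qed
  then obtain sel where Q: "\<And>k \<psi>. Q k \<psi> (sel k \<psi>)" by metis
  have selI: "fst (sel k \<psi>) \<in> sets borel \<and> snd (sel k \<psi>) \<in> sets borel \<and>
      ennreal \<beta> * emeasure h (snd (sel k \<psi>)) \<le> ennreal (\<integral>x. \<psi> x * indicator (fst (sel k \<psi>)) x \<partial>h) \<and>
      (AE x in h. avhat k (\<lambda>y. \<psi> y * indicator (- fst (sel k \<psi>)) y) x \<le> 2 * \<beta>) \<and>
      (\<forall>y t. y \<in> fst (sel k \<psi>) \<longrightarrow> t \<in> D k \<longrightarrow> y + t \<in> snd (sel k \<psi>))"
    if "cbp \<psi>" "\<And>x. 0 \<le> \<psi> x" for k \<psi>
    using mp[OF Q[of k \<psi>, unfolded Q_def]] that by simp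
  note sel = selI[THEN conjunct1] selI[THEN conjunct2, THEN conjunct1]
    selI[THEN conjunct2, THEN conjunct2, THEN conjunct1]
    selI[THEN conjunct2, THEN conjunct2, THEN conjunct2, THEN conjunct1]
    selI[THEN conjunct2, THEN conjunct2, THEN conjunct2, THEN conjunct2, rule_format]
  \<comment> \<open>What is left after the levels \<open>K - 1\<close> down to \<open>K - i\<close>.
    Each cut depends on all coarser ones.\<close>
  define Phi where "Phi = rec_nat f (\<lambda>i \<psi> y. \<psi> y * indicator (- fst (sel (K - Suc i) \<psi>)) y)"
  have Phi_0: "Phi 0 = f" and Phi_Suc: "Phi (Suc i) = (\<lambda>y. Phi i y * indicator (- fst (sel (K - Suc i) (Phi i))) y)" for i
    by (simp_all add: Phi_def)
  have Phi: "cbp (Phi i)" "0 \<le> Phi i x" for i x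
  proof -
    have "cbp (Phi i) \<and> (\<forall>x. 0 \<le> Phi i x)"
    proof (induction i)
      case (Suc i)
      then have "fst (sel (K - Suc i) (Phi i)) \<in> sets borel" by (intro sel(1)) auto
      then show ?case using Suc unfolding Phi_Suc by (auto intro!: cbp_indicator_mult)
    qed (simp add: Phi_0 f)
    then show "cbp (Phi i)" "0 \<le> Phi i x" by auto
  qed
  define p where "p k = Phi (K - k)" for k
  define S where "S k = fst (sel k (p (Suc k)))" for k
  define S' where "S' k = snd (sel k (p (Suc k)))" for k
  define b where "b k = (case k of 0 \<Rightarrow> p 0 | Suc i \<Rightarrow> (\<lambda>x. p (Suc i) x - p i x))" for k
  have p: "cbp (p k)" "0 \<le> p k x" for k x by (simp_all add: p_def Phi)
  have p_step: "p k = (\<lambda>y. p (Suc k) y * indicator (- S k) y)" if "k < K" for k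
  proof -
    have "K - k = Suc (K - Suc k)" "K - Suc (K - Suc k) = k" using that by auto
    then show ?thesis unfolding p_def S_def by (simp add: Phi_Suc)
  qed
  have p_le: "p k x \<le> p (Suc k) x" if "k < K" for k x
    using p(2)[of "Suc k" x] by (subst p_step[OF that]) (auto simp: indicator_def)
  have b_step: "b (Suc k) x = p (Suc k) x * indicator (S k) x" if "k < K" for k x
    unfolding b_def by (simp, subst p_step[OF that]) (auto simp: indicator_def)
  show ?thesis
  proof (rule that)
    show "cbp (p k)" "0 \<le> p k x" for k x by (rule p)+
    show "p j x \<le> p k x" if "j \<le> k" "k \<le> K" for j k x
      using that by (induction k rule: dec_induct) (auto intro: order_trans[OF _ p_le])
    show "p K = f" by (simp add: p_def Phi_0)
    show "cbp (b k)" for k by (cases k) (auto simp: b_def p cbp_diff)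
    show "0 \<le> b k x" if "k \<le> K" for k x
      using that p p_le by (cases k) (auto simp: b_def)
    show "(\<Sum>j\<le>k. b j x) = p k x" for k x
      by (induction k) (auto simp: b_def)
    show "b (Suc k) x = 0" if "k < K" "x \<notin> S k" for k x
      using that by (simp add: b_step)
    show "S' k \<in> sets borel" for k unfolding S'_def by (intro sel(2) p)
    show "ennreal \<beta> * emeasure h (S' k) \<le> ennreal (\<integral>x. b (Suc k) x \<partial>h)" if "k < K" for k
      unfolding b_step[OF that] S'_def S_def by (intro sel(3) p)
    show "AE x in h. avhat k (p k) x \<le> 2 * \<beta>" if "k < K" for k
      by (subst p_step[OF that]) (unfold S_def, intro sel(4) p)
    show "y + t \<in> S' k" if "y \<in> S k" "t \<in> D k" for k y t
      using that unfolding S_def S'_def by (intro sel(5) p)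
  qed
qed

lemma T_nonneg: "(\<And>x. 0 \<le> f x) \<Longrightarrow> 0 \<le> T n f x" and T'_nonneg: "(\<And>x. 0 \<le> f x) \<Longrightarrow> 0 \<le> T' n f x"
  by (simp_all add: T_def T'_def av_nonneg)

lemma integral_T: "cbp f \<Longrightarrow> (\<integral>x. T n f x \<partial>h) = (\<integral>x. f x \<partial>h)"
  by (simp add: T_def integral_av[OF cmeasure_U] cprob_measure[OF cprob_U])

lemma integral_T': "cbp f \<Longrightarrow> (\<integral>x. T' n f x \<partial>h) = (\<integral>x. f x \<partial>h)"
  by (simp add: T'_def integral_av[OF cmeasure_negU] cprob_measure[OF cprob_negU])

lemma T_sum: "(\<And>i. i \<in> I \<Longrightarrow> cbp (f i)) \<Longrightarrow> T n (\<lambda>x. \<Sum>i\<in>I. f i x) x = (\<Sum>i\<in>I. T n (f i) x)"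
  unfolding T_def by (rule av_sum[OF cmeasure_U])

lemma integral_T'_right: "cbp f \<Longrightarrow> cbp g \<Longrightarrow> (\<integral>x. f x * T' n g x \<partial>h) = (\<integral>x. T n f x * g x \<partial>h)"
  unfolding T_def T'_def by (rule av_adjoint[OF cmeasure_U, symmetric])

text \<open>Each smoothing factor has its purpose. \<open>b k\<close> is part of \<open>p k\<close>,
  on which the means at level \<open>k\<close> are already small, so \<open>T k (b k)\<close> is
  bounded by \<open>2 * \<beta>\<close>. In a product with pieces of much lower index,
  \<open>T' (Suc k)\<close> passes to the other side as \<open>T (Suc k)\<close>, where it averages
  those pieces at a level whose means are small as well.\<close>

lemma good_part_L2:
  assumes p: "\<And>k. cbp (p k)" "\<And>j k x. j \<le> k \<Longrightarrow> k \<le> K \<Longrightarrow> p j x \<le> p k x"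
    and b: "\<And>k. cbp (b k)" "\<And>k x. k \<le> K \<Longrightarrow> 0 \<le> b k x" "\<And>k x. (\<Sum>j\<le>k. b j x) = p k x"
    and small: "\<And>k. k < K \<Longrightarrow> AE x in h. avhat k (p k) x \<le> 2 * \<beta>" and \<beta>: "0 < \<beta>" and N: "Suc N < K"
  shows "(\<integral>x. (\<Sum>k\<le>N. T' (Suc k) (T k (b k)) x)\<^sup>2 \<partial>h) \<le> 16 * \<beta> * (\<Sum>k\<le>N. \<integral>x. b k x \<partial>h)"
proof -
  define v where "v k = (if k \<le> N then T' (Suc k) (T k (b k)) else (\<lambda>_. 0))" for k
  have v: "cbp (v k)" "0 \<le> v k x" for k x
    unfolding v_def using b N by (auto intro!: cbp_T cbp_T' T_nonneg T'_nonneg cbp_zero)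
  have b_le: "b k x \<le> p k x" if "k \<le> K" for k x
    unfolding b(3)[symmetric] using that by (intro member_le_sum b(2)) auto
  have Tb_le: "AE x in h. T k (b k) x \<le> 2 * \<beta>" if "k \<le> N" for k
  proof -
    have k: "k \<le> K" "k < K" using that N by auto
    show ?thesis using small[OF k(2)]
    proof eventually_elim
      case (elim x)
      have "T k (b k) x \<le> avhat k (b k) x" by (rule T_le_avhat[OF b(1)]) (rule b(2)[OF k(1)])
      also have "\<dots> \<le> avhat k (p k) x" by (rule avhat_mono[OF b(1) p(1)]) (rule b_le[OF k(1)])
      finally show ?case using elim by simp
    qed
  qed
  have v_le: "AE x in h. v k x \<le> 2 * \<beta>" for k
  proof (cases "k \<le> N")
    case True
    then show ?thesis unfolding v_def T'_def
      using \<beta> by (simp, intro av_AE_le cprob_negU cbp_T b Tb_le) auto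
  qed (use \<beta> in \<open>simp add: v_def\<close>)
  have int_v: "(\<integral>x. v k x \<partial>h) = (\<integral>x. b k x \<partial>h)" if "k \<le> N" for k
    using that by (simp add: v_def integral_T integral_T' cbp_T b)
  have bound: "(\<integral>x. (\<Sum>j\<le>k. v j x) * v k x \<partial>h) \<le> 8 * \<beta> * (\<integral>x. b k x \<partial>h)" if k: "k \<le> N" for k
  proof -
    \<comment> \<open>At most three indices \<open>j\<close> are close to \<open>k\<close>; they are
      bounded pointwise and contribute \<open>6 * \<beta>\<close>. The others contribute
      \<open>2 * \<beta>\<close>, and \<open>square_sum_le\<close> doubles the total to
      \<open>16 * \<beta>\<close>.\<close>
    define lo hi where "lo = {j. j + 3 \<le> k}" and "hi = {j. j \<le> k \<and> k < j + 3}"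
    have fin: "finite lo" "finite hi" and dis: "lo \<inter> hi = {}" and un: "{..k} = lo \<union> hi"
      by (auto simp: lo_def hi_def intro: finite_subset[of _ "{..k}"])
    have card: "card hi \<le> 3"
    proof -
      have "hi \<subseteq> {k - 2..k}" by (auto simp: hi_def)
      then have "card hi \<le> card {k - 2..k}" by (intro card_mono) auto
      then show ?thesis by simp
    qed
    have clo: "cbp (\<lambda>x. \<Sum>j\<in>lo. v j x)" and chi: "cbp (\<lambda>x. \<Sum>j\<in>hi. v j x)" by (auto intro!: cbp_sum v)
    have "(\<integral>x. (\<Sum>j\<le>k. v j x) * v k x \<partial>h) = (\<integral>x. (\<Sum>j\<in>lo. v j x) * v k x + (\<Sum>j\<in>hi. v j x) * v k x \<partial>h)"
      unfolding un by (simp add: sum.union_disjoint[OF fin dis] distrib_right)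
    also have "\<dots> = (\<integral>x. (\<Sum>j\<in>lo. v j x) * v k x \<partial>h) + (\<integral>x. (\<Sum>j\<in>hi. v j x) * v k x \<partial>h)"
      by (intro Bochner_Integration.integral_add cbp_integrable cbp_mult clo chi v)
    also have "(\<integral>x. (\<Sum>j\<in>hi. v j x) * v k x \<partial>h) \<le> (\<integral>x. 6 * \<beta> * v k x \<partial>h)"
    proof (rule integral_mono_AE)
      have "AE x in h. \<forall>j\<in>hi. v j x \<le> 2 * \<beta>" using fin(2) v_le by (auto intro!: AE_finite_allI)
      then show "AE x in h. (\<Sum>j\<in>hi. v j x) * v k x \<le> 6 * \<beta> * v k x"
      proof eventually_elim
        case (elim x)
        have "(\<Sum>j\<in>hi. v j x) \<le> real (card hi) * (2 * \<beta>)" using elim by (intro sum_bounded_above) auto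
        also have "\<dots> \<le> 3 * (2 * \<beta>)" using card \<beta> by (intro mult_right_mono) auto
        finally show ?case using v(2)[of k x] by (intro mult_right_mono) auto
      qed
    qed (intro cbp_integrable cbp_mult cbp_scale chi v)+
    also have "(\<integral>x. 6 * \<beta> * v k x \<partial>h) = 6 * \<beta> * (\<integral>x. b k x \<partial>h)" by (simp add: int_v[OF k])
    \<comment> \<open>The outer adjoint in \<open>v k\<close> is moved onto the sum of lower
      pieces.\<close>
    also have "(\<integral>x. (\<Sum>j\<in>lo. v j x) * v k x \<partial>h) = (\<integral>x. T (Suc k) (\<lambda>x. \<Sum>j\<in>lo. v j x) x * T k (b k) x \<partial>h)"
      using k by (simp add: v_def[of k] integral_T'_right clo cbp_T b)
    also have "\<dots> \<le> (\<integral>x. 2 * \<beta> * T k (b k) x \<partial>h)"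
    proof (rule integral_mono_AE)
      have Sk: "Suc k < K" "Suc k \<le> K" using k N by auto
      show "AE x in h. T (Suc k) (\<lambda>x. \<Sum>j\<in>lo. v j x) x * T k (b k) x \<le> 2 * \<beta> * T k (b k) x"
        using small[OF Sk(1)]
      proof eventually_elim
        case (elim x)
        have "T (Suc k) (\<lambda>x. \<Sum>j\<in>lo. v j x) x = (\<Sum>j\<in>lo. T (Suc k) (v j) x)" by (intro T_sum v)
        also have "\<dots> \<le> (\<Sum>j\<in>lo. avhat (Suc k) (b j) x)"
        proof (rule sum_mono)
          fix j assume "j \<in> lo"
          then have j: "j + 3 \<le> k" "j \<le> N" "j \<le> K" using k N by (auto simp: lo_def)
          show "T (Suc k) (v j) x \<le> avhat (Suc k) (b j) x"
            using T_T'_T_le_avhat[OF b(1) b(2)[OF j(3)] j(1), of x] j by (simp add: v_def)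
        qed
        also have "\<dots> = avhat (Suc k) (\<lambda>x. \<Sum>j\<in>lo. b j x) x" by (rule avhat_sum[symmetric]) (rule b)
        also have "\<dots> \<le> avhat (Suc k) (p (Suc k)) x"
        proof (rule avhat_mono[OF cbp_sum[OF b(1)] p(1)])
          fix y
          have "(\<Sum>j\<in>lo. b j y) \<le> (\<Sum>j\<le>Suc k. b j y)"
            using Sk by (intro sum_mono2 b(2)) (auto simp: lo_def)
          then show "(\<Sum>j\<in>lo. b j y) \<le> p (Suc k) y" by (simp only: b(3))
        qed
        finally have "T (Suc k) (\<lambda>x. \<Sum>j\<in>lo. v j x) x \<le> 2 * \<beta>" using elim by simp
        then show ?case using k N by (intro mult_right_mono T_nonneg b(2)) auto
      qed
    qed (intro cbp_integrable cbp_mult cbp_scale cbp_T clo b)+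
    also have "\<dots> = 2 * \<beta> * (\<integral>x. b k x \<partial>h)" by (simp add: integral_T b)
    finally show ?thesis by (simp add: algebra_simps)
  qed
  have "(\<integral>x. (\<Sum>k\<le>N. T' (Suc k) (T k (b k)) x)\<^sup>2 \<partial>h) = (\<integral>x. (\<Sum>k\<le>N. v k x)\<^sup>2 \<partial>h)"
    by (simp add: v_def)
  also have "\<dots> \<le> (\<integral>x. 2 * (\<Sum>k\<le>N. (\<Sum>j\<le>k. v j x) * v k x) \<partial>h)"
    by (intro integral_mono square_sum_le v cbp_integrable cbp_power2 cbp_sum cbp_scale cbp_mult)
  also have "\<dots> = 2 * (\<Sum>k\<le>N. \<integral>x. (\<Sum>j\<le>k. v j x) * v k x \<partial>h)"
    by (simp add: Bochner_Integration.integral_sum cbp_integrable cbp_mult cbp_sum v)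
  also have "\<dots> \<le> 2 * (\<Sum>k\<le>N. 8 * \<beta> * (\<integral>x. b k x \<partial>h))"
    by (intro mult_left_mono sum_mono bound) auto
  finally show ?thesis by (simp add: sum_distrib_left mult.assoc)
qed

text \<open>A coarse \<open>T n\<close> absorbs first \<open>T' (Suc k)\<close> and then
  \<open>T k\<close>: 48 = 32 + 16. A fine \<open>T n\<close> is absorbed from the left by
  \<open>T' (Suc k)\<close>: 8 = 16 / 2.\<close>

lemma smoothing_error:
  assumes b: "cbp b" "\<And>x. 0 \<le> b x"
  shows "(\<integral>x. \<bar>T n b x - T n (T' (Suc k) (T k b)) x\<bar> \<partial>h) \<le> 48 * (2 ^ k / 2 ^ n) * (\<integral>x. b x \<partial>h)"
    and "(\<integral>x. \<bar>T n (T' (Suc k) (T k b)) x - T' (Suc k) (T k b) x\<bar> \<partial>h) \<le> 8 * (2 ^ n / 2 ^ k) * (\<integral>x. b x \<partial>h)"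
proof -
  have absb: "(\<integral>x. \<bar>b x\<bar> \<partial>h) = (\<integral>x. b x \<partial>h)" using b(2) by simp
  have absT: "(\<integral>x. \<bar>T k b x\<bar> \<partial>h) = (\<integral>x. b x \<partial>h)"
    using T_nonneg[of b k, OF b(2)] integral_T[OF b(1), of k] by simp
  have "(\<integral>x. \<bar>T n b x - T n (T' (Suc k) (T k b)) x\<bar> \<partial>h)
      \<le> (\<integral>x. \<bar>T n (T k b) x - T n b x\<bar> + \<bar>T n (T' (Suc k) (T k b)) x - T n (T k b) x\<bar> \<partial>h)"
    by (intro integral_mono cbp_integrable cbp_abs cbp_add cbp_diff cbp_T cbp_T' b) auto
  also have "\<dots> = (\<integral>x. \<bar>T n (T k b) x - T n b x\<bar> \<partial>h) + (\<integral>x. \<bar>T n (T' (Suc k) (T k b)) x - T n (T k b) x\<bar> \<partial>h)"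
    by (intro Bochner_Integration.integral_add cbp_integrable cbp_abs cbp_diff cbp_T cbp_T' b)
  also have "\<dots> \<le> 16 * 2 ^ k / 2 ^ n * (\<integral>x. b x \<partial>h) + 16 * 2 ^ Suc k / 2 ^ n * (\<integral>x. b x \<partial>h)"
    using T_T_L1[OF b(1), of n k] T_T'_L1[OF cbp_T[OF b(1), of k], of n "Suc k"] unfolding absb absT
    by (intro add_mono)
  also have "\<dots> = 48 * (2 ^ k / 2 ^ n) * (\<integral>x. b x \<partial>h)" by (simp add: field_simps)
  finally show "(\<integral>x. \<bar>T n b x - T n (T' (Suc k) (T k b)) x\<bar> \<partial>h) \<le> 48 * (2 ^ k / 2 ^ n) * (\<integral>x. b x \<partial>h)" .
  show "(\<integral>x. \<bar>T n (T' (Suc k) (T k b)) x - T' (Suc k) (T k b) x\<bar> \<partial>h) \<le> 8 * (2 ^ n / 2 ^ k) * (\<integral>x. b x \<partial>h)"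
    using T_T'_left_L1[OF cbp_T[OF b(1), of k], of n "Suc k"] unfolding absT by (simp add: field_simps)
qed

end

section \<open>The weak type inequality on the group\<close>

text \<open>The threshold is split as lam/2 + lam/4 + lam/4 and the number of jumps in thirds. For
  the monotone \<open>w\<close> and the summable \<open>e\<close> the counts are at most
  \<open>4 * V / lam\<close> and \<open>8 * E / lam\<close>, which gives the constants 12 and
  24.\<close>

lemma jmax_three:
  fixes u v w e :: "nat \<Rightarrow> real"
  assumes eq: "\<And>n. n \<le> L \<Longrightarrow> u n = v n + (e n - w n)" and lam: "0 < lam"
    and w: "\<And>n. w (Suc n) \<le> w n" "\<And>n. 0 \<le> w n" "w 0 \<le> V"
    and e: "(\<Sum>n\<le>L. \<bar>e n\<bar>) \<le> E" and M: "M \<le> real (jmax lam L u)"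
  shows "M / 3 \<le> real (jmax (lam / 2) L v) \<or> lam * M / 12 \<le> V \<or> lam * M / 24 \<le> E"
proof (rule ccontr)
  assume "\<not> ?thesis"
  then have n: "real (jmax (lam / 2) L v) < M / 3" "V < lam * M / 12" "E < lam * M / 24" by auto
  have "jmax lam L u = jmax (lam / 2 + (lam / 4 + lam / 4)) L (\<lambda>n. v n + (e n + - w n))"
    by (simp, rule jmax_cong) (simp add: eq)
  also have "\<dots> \<le> jmax (lam / 2) L v + jmax (lam / 4 + lam / 4) L (\<lambda>n. e n + - w n)" by (rule jmax_add)
  also have "\<dots> \<le> jmax (lam / 2) L v + (jmax (lam / 4) L e + jmax (lam / 4) L (\<lambda>n. - w n))"
    by (intro add_left_mono jmax_add)
  finally have "real (jmax lam L u) \<le> real (jmax (lam / 2) L v) + real (jmax (lam / 4) L e) + real (jmax (lam / 4) L (\<lambda>n. - w n))"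
    by linarith
  moreover have "real (jmax (lam / 4) L (\<lambda>n. - w n)) \<le> V / (lam / 4)"
  proof -
    have "jmax (lam / 4) L (\<lambda>n. - w n) \<le> jmax (lam / 4) L w" by (rule jmax_weaken) (simp add: abs_minus_commute)
    moreover have "real (jmax (lam / 4) L w) \<le> V / (lam / 4)"
      using lam by (intro jmax_monotone w) auto
    ultimately show ?thesis by linarith
  qed
  moreover have "real (jmax (lam / 4) L e) \<le> 8 / lam * E"
  proof -
    have "real (jmax (lam / 4) L e) \<le> 2 / (lam / 4) * (\<Sum>n\<le>L. norm (e n))"
      using lam by (intro jmax_abs_sum) auto
    also have "\<dots> \<le> 2 / (lam / 4) * E" using lam e by (intro mult_left_mono) auto
    finally show ?thesis by simp
  qed
  moreover have "8 / lam * E < M / 3" using n(3) lam by (simp add: field_simps)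
  moreover have "V / (lam / 4) < M / 3" using n(2) lam by (simp add: field_simps)
  ultimately show False using n(1) M by linarith
qed

context folner_inv
begin

theorem weak_type_jumps_cbp:
  fixes f :: "'g \<Rightarrow> real"
  assumes f: "cbp f" "\<And>x. 0 \<le> f x" and lam: "0 < lam" and M: "1 \<le> M"
  shows "emeasure h {x. M \<le> real (jmax lam L (\<lambda>n. T n f x))} \<le> ennreal (10^18 / (lam * sqrt M) * (\<integral>x. f x \<partial>h))"
proof -
  define \<beta> where "\<beta> = lam * sqrt M"
  define K where "K = L + 5"
  \<comment> \<open>With \<open>L + 3\<close> the range \<open>{n + 3<..N}\<close> is empty at
    \<open>n = L\<close>, and \<open>K = L + 5\<close> provides the bound \<open>Suc N < K\<close>
    of \<open>good_part_L2\<close>.\<close>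
  define N where "N = L + 3"
  define I where "I = (\<integral>x. f x \<partial>h)"
  have \<beta>: "0 < \<beta>" using lam M by (simp add: \<beta>_def)
  have I0: "0 \<le> I" unfolding I_def by (rule Bochner_Integration.integral_nonneg) (rule f)
  obtain p b S S' where CZ: "\<And>k. cbp (p k)" "\<And>k x. 0 \<le> p k x" "\<And>j k x. j \<le> k \<Longrightarrow> k \<le> K \<Longrightarrow> p j x \<le> p k x" "p K = f"
    "\<And>k. cbp (b k)" "\<And>k x. k \<le> K \<Longrightarrow> 0 \<le> b k x" "\<And>k x. (\<Sum>j\<le>k. b j x) = p k x"
    "\<And>k x. k < K \<Longrightarrow> x \<notin> S k \<Longrightarrow> b (Suc k) x = 0"
    "\<And>k. k < K \<Longrightarrow> S' k \<in> sets borel"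
    "\<And>k. k < K \<Longrightarrow> ennreal \<beta> * emeasure h (S' k) \<le> ennreal (\<integral>x. b (Suc k) x \<partial>h)"
    "\<And>k. k < K \<Longrightarrow> AE x in h. avhat k (p k) x \<le> 2 * \<beta>"
    "\<And>k y t. k < K \<Longrightarrow> y \<in> S k \<Longrightarrow> t \<in> D k \<Longrightarrow> y + t \<in> S' k"
    using Calderon_Zygmund[where K = K, OF f \<beta>] by blast
  define B where "B k = (\<integral>x. b k x \<partial>h)" for k
  have B0: "0 \<le> B k" if "k \<le> K" for k
    unfolding B_def using CZ(6)[OF that] by (intro Bochner_Integration.integral_nonneg)
  have BK: "(\<Sum>k\<le>K. B k) = I"
  proof -
    have "(\<Sum>k\<le>K. B k) = (\<integral>x. (\<Sum>k\<le>K. b k x) \<partial>h)"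
      unfolding B_def by (rule Bochner_Integration.integral_sum[symmetric]) (rule cbp_integrable[OF CZ(5)])
    then show ?thesis by (simp only: CZ(7) CZ(4) I_def)
  qed
  have BN: "(\<Sum>k\<le>N. B k) \<le> I"
    unfolding BK[symmetric] by (intro sum_mono2 B0) (auto simp: N_def K_def)
  define v where "v k = T' (Suc k) (T k (b k))" for k
  have v: "cbp (v k)" for k unfolding v_def by (intro cbp_T' cbp_T CZ)
  have v0: "0 \<le> v k x" if "k \<le> N" for k x
    unfolding v_def using that CZ(6)[of k] by (intro T'_nonneg T_nonneg) (simp add: N_def K_def)
  have int_v: "(\<integral>x. v k x \<partial>h) = B k" for k
    unfolding v_def B_def by (simp add: integral_T integral_T' cbp_T CZ)
  define g where "g x = (\<Sum>k\<le>N. v k x)" for x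
  have g: "cbp g" unfolding g_def by (intro cbp_sum v)
  have g0: "0 \<le> g x" for x unfolding g_def by (intro sum_nonneg v0) auto
  have int_g: "(\<integral>x. g x \<partial>h) \<le> I"
    unfolding g_def by (simp add: Bochner_Integration.integral_sum cbp_integrable v int_v BN)
  have g2: "(\<integral>x. (g x)\<^sup>2 \<partial>h) \<le> 16 * \<beta> * I"
  proof -
    have "(\<integral>x. (g x)\<^sup>2 \<partial>h) \<le> 16 * \<beta> * (\<Sum>k\<le>N. B k)"
      unfolding g_def v_def B_def by (rule good_part_L2[where p = p and K = K]) (use CZ \<beta> in \<open>auto simp: N_def K_def\<close>)
    also have "\<dots> \<le> 16 * \<beta> * I" using \<beta> BN by (intro mult_left_mono) auto
    finally show ?thesis .
  qed
  \<comment> \<open>The smoothed pieces that are coarse relative to \<open>n\<close>. Outside the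
    exceptional set the averages of the corresponding original pieces vanish, while
    \<open>T n g\<close> contains nearly these terms, so they have to be subtracted. Fewer remain as
    \<open>n\<close> grows, which makes \<open>w\<close> monotone.\<close>
  define w where "w n x = (\<Sum>k\<in>{n + 3<..N}. v k x)" for n x
  define Er where "Er n x = (\<Sum>k\<le>n + 3. \<bar>T n (b k) x - T n (v k) x\<bar>) + (\<Sum>k\<in>{n + 3<..N}. \<bar>T n (v k) x - v k x\<bar>)" for n x
  define Et where "Et x = (\<Sum>n\<le>L. Er n x)" for x
  have Er: "cbp (Er n)" "0 \<le> Er n x" for n x
    unfolding Er_def by (intro cbp_add cbp_sum cbp_abs cbp_diff cbp_T v CZ) (intro add_nonneg_nonneg sum_nonneg abs_ge_zero)
  have Et: "cbp Et" "0 \<le> Et x" for x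
    unfolding Et_def by (intro cbp_sum Er) (intro sum_nonneg Er)
  have int_Et: "(\<integral>x. Et x \<partial>h) \<le> 776 * I"
  proof -
    have Er_le: "(\<integral>x. Er n x \<partial>h) \<le> (\<Sum>k\<le>N. (48 * (if k \<le> n + 3 then 2 ^ k / 2 ^ n else 0) + 8 * (if n + 3 < k then 2 ^ n / 2 ^ k else 0)) * B k)"
      if n: "n \<le> L" for n
    proof -
      have "(\<integral>x. Er n x \<partial>h) = (\<Sum>k\<le>n + 3. \<integral>x. \<bar>T n (b k) x - T n (v k) x\<bar> \<partial>h) + (\<Sum>k\<in>{n + 3<..N}. \<integral>x. \<bar>T n (v k) x - v k x\<bar> \<partial>h)"
      proof -
        have "(\<integral>x. Er n x \<partial>h) = (\<integral>x. (\<Sum>k\<le>n + 3. \<bar>T n (b k) x - T n (v k) x\<bar>) \<partial>h) + (\<integral>x. (\<Sum>k\<in>{n + 3<..N}. \<bar>T n (v k) x - v k x\<bar>) \<partial>h)"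
          unfolding Er_def by (intro Bochner_Integration.integral_add cbp_integrable cbp_sum cbp_abs cbp_diff cbp_T v CZ)
        also have "(\<integral>x. (\<Sum>k\<le>n + 3. \<bar>T n (b k) x - T n (v k) x\<bar>) \<partial>h) = (\<Sum>k\<le>n + 3. \<integral>x. \<bar>T n (b k) x - T n (v k) x\<bar> \<partial>h)"
          by (intro Bochner_Integration.integral_sum cbp_integrable cbp_abs cbp_diff cbp_T v CZ)
        also have "(\<integral>x. (\<Sum>k\<in>{n + 3<..N}. \<bar>T n (v k) x - v k x\<bar>) \<partial>h) = (\<Sum>k\<in>{n + 3<..N}. \<integral>x. \<bar>T n (v k) x - v k x\<bar> \<partial>h)"
          by (intro Bochner_Integration.integral_sum cbp_integrable cbp_abs cbp_diff cbp_T v CZ)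
        finally show ?thesis .
      qed
      also have "\<dots> \<le> (\<Sum>k\<le>n + 3. 48 * (2 ^ k / 2 ^ n) * B k) + (\<Sum>k\<in>{n + 3<..N}. 8 * (2 ^ n / 2 ^ k) * B k)"
        unfolding v_def B_def using n
        by (intro add_mono sum_mono smoothing_error CZ) (auto simp: N_def K_def)
      also have "\<dots> = (\<Sum>k\<in>{..n + 3} \<union> {n + 3<..N}. (48 * (if k \<le> n + 3 then 2 ^ k / 2 ^ n else 0) + 8 * (if n + 3 < k then 2 ^ n / 2 ^ k else 0)) * B k)"
        by (subst sum.union_disjoint) (auto intro!: arg_cong2[of _ _ _ _ "(+)"] sum.cong)
      also have "{..n + 3} \<union> {n + 3<..N} = {..N}" using n by (auto simp: N_def)
      finally show ?thesis .
    qed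
    have "(\<integral>x. Et x \<partial>h) = (\<Sum>n\<le>L. \<integral>x. Er n x \<partial>h)"
      unfolding Et_def by (intro Bochner_Integration.integral_sum cbp_integrable Er)
    also have "\<dots> \<le> (\<Sum>n\<le>L. \<Sum>k\<le>N. (48 * (if k \<le> n + 3 then 2 ^ k / 2 ^ n else 0) + 8 * (if n + 3 < k then 2 ^ n / 2 ^ k else 0)) * B k)"
      by (intro sum_mono Er_le) auto
    also have "\<dots> = (\<Sum>k\<le>N. (48 * (\<Sum>n\<le>L. if k \<le> n + 3 then 2 ^ k / 2 ^ n else 0) + 8 * (\<Sum>n\<le>L. if n + 3 < k then 2 ^ n / 2 ^ k else 0)) * B k)"
      by (subst sum.swap) (simp only: sum_distrib_left sum_distrib_right sum.distrib[symmetric])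
    also have "\<dots> \<le> (\<Sum>k\<le>N. (48 * 16 + 8 * 1) * B k)"
      by (intro sum_mono mult_right_mono add_mono mult_left_mono geometric_above geometric_below B0) (auto simp: N_def K_def)
    also have "\<dots> = 776 * (\<Sum>k\<le>N. B k)" by (simp add: sum_distrib_left)
    also have "\<dots> \<le> 776 * I" using BN by simp
    finally show ?thesis .
  qed
  define Om where "Om = (\<Union>k<K. S' k)"
  have Om: "Om \<in> sets h" unfolding Om_def sets_h by (intro sets.finite_UN CZ) auto
  have Om_le: "emeasure h Om \<le> ennreal (I / \<beta>)"
  proof -
    have "emeasure h Om \<le> (\<Sum>k<K. emeasure h (S' k))"
      unfolding Om_def by (intro emeasure_subadditive_finite) (auto simp: sets_h CZ)
    then have "ennreal \<beta> * emeasure h Om \<le> ennreal \<beta> * (\<Sum>k<K. emeasure h (S' k))" by (intro mult_left_mono) auto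
    also have "\<dots> = (\<Sum>k<K. ennreal \<beta> * emeasure h (S' k))" by (simp add: sum_distrib_left)
    also have "\<dots> \<le> (\<Sum>k<K. ennreal (B (Suc k)))" unfolding B_def by (intro sum_mono CZ) auto
    also have "\<dots> = ennreal (\<Sum>k<K. B (Suc k))" by (rule sum_ennreal) (auto intro: B0)
    also have "(\<Sum>k<K. B (Suc k)) \<le> I"
      unfolding BK[symmetric] lessThan_Suc_atMost[symmetric] sum.lessThan_Suc_shift[of B K] using B0[of 0] by simp
    finally have "ennreal \<beta> * emeasure h Om \<le> ennreal I" by (simp add: ennreal_leI order_trans)
    then have "ennreal (1 / \<beta>) * (ennreal \<beta> * emeasure h Om) \<le> ennreal (1 / \<beta>) * ennreal I" by (intro mult_left_mono) auto
    moreover have "ennreal (1 / \<beta>) * (ennreal \<beta> * emeasure h Om) = emeasure h Om"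
      using \<beta> by (simp add: mult.assoc[symmetric] flip: ennreal_mult)
    moreover have "ennreal (1 / \<beta>) * ennreal I = ennreal (I / \<beta>)"
      using \<beta> I0 by (simp flip: ennreal_mult)
    ultimately show ?thesis by simp
  qed
  \<comment> \<open>The piece lives on \<open>S k\<close>, and a point from which an element of
    \<open>F n\<close> leads into \<open>S k\<close> belongs to \<open>S' k\<close>, because
    \<open>D k\<close> contains the inverses.\<close>
  have local: "T n (b (Suc k)) x = 0" if x: "x \<notin> Om" and k: "n + 3 \<le> k" "k < K" for n k x
  proof -
    have "AE s in U n. b (Suc k) (x + s) = 0"
      using U_supp
    proof eventually_elim
      case (elim s)
      have "x + s \<notin> S k"
      proof
        assume "x + s \<in> S k"
        moreover have "- s \<in> D k" using elim k W_negF[of n "k - 3"] by (auto simp: D_def image_subset_iff)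
        ultimately have "(x + s) + - s \<in> S' k" using CZ(12)[OF k(2)] by blast
        then have "x \<in> S' k" by (simp add: add.assoc)
        then show False using x k by (auto simp: Om_def)
      qed
      then show ?case by (rule CZ(8)[OF k(2)])
    qed
    then show ?thesis unfolding T_def av_def by (rule integral_eq_zero_AE)
  qed
  have sub: "{x. M \<le> real (jmax lam L (\<lambda>n. T n f x))} \<subseteq> Om \<union> {x. M / 3 \<le> real (jmax (lam / 2) L (\<lambda>n. T n g x))}
      \<union> {x. lam * M / 12 \<le> g x} \<union> {x. lam * M / 24 \<le> Et x}"
  proof
    fix x assume "x \<in> {x. M \<le> real (jmax lam L (\<lambda>n. T n f x))}"
    then have Mx: "M \<le> real (jmax lam L (\<lambda>n. T n f x))" by simp
    show "x \<in> Om \<union> {x. M / 3 \<le> real (jmax (lam / 2) L (\<lambda>n. T n g x))}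
      \<union> {x. lam * M / 12 \<le> g x} \<union> {x. lam * M / 24 \<le> Et x}"
    proof (cases "x \<in> Om")
      case False
      define e where "e n = T n f x - T n g x + w n x" for n
      have Tf: "T n f x = (\<Sum>k\<le>n + 3. T n (b k) x)" if n: "n \<le> L" for n
      proof -
        have "T n f x = T n (\<lambda>x. \<Sum>k\<le>K. b k x) x" by (simp only: CZ(7) CZ(4))
        also have "\<dots> = (\<Sum>k\<le>K. T n (b k) x)" by (rule T_sum) (rule CZ)
        also have "\<dots> = (\<Sum>k\<le>n + 3. T n (b k) x)"
        proof (rule sum.mono_neutral_right)
          show "\<forall>k\<in>{..K} - {..n + 3}. T n (b k) x = 0"
          proof
            fix k assume "k \<in> {..K} - {..n + 3}"
            then obtain k' where "k = Suc k'" "n + 3 \<le> k'" "k' < K" by (cases k) auto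
            then show "T n (b k) x = 0" using local[OF False] by simp
          qed
        qed (use n in \<open>auto simp: K_def\<close>)
        finally show ?thesis .
      qed
      have e_le: "\<bar>e n\<bar> \<le> Er n x" if n: "n \<le> L" for n
      proof -
        have "T n g x = (\<Sum>k\<le>N. T n (v k) x)" unfolding g_def by (rule T_sum) (rule v)
        also have "\<dots> = (\<Sum>k\<le>n + 3. T n (v k) x) + (\<Sum>k\<in>{n + 3<..N}. T n (v k) x)"
        proof -
          have "{..N} = {..n + 3} \<union> {n + 3<..N}" using n by (auto simp: N_def)
          then show ?thesis by (simp only:) (subst sum.union_disjoint, auto)
        qed
        finally have "e n = (\<Sum>k\<le>n + 3. T n (b k) x - T n (v k) x) - (\<Sum>k\<in>{n + 3<..N}. T n (v k) x - v k x)"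
          unfolding e_def Tf[OF n] w_def sum_subtractf by linarith
        then show ?thesis
          unfolding Er_def using sum_abs[of "\<lambda>k. T n (b k) x - T n (v k) x" "{..n + 3}"]
            sum_abs[of "\<lambda>k. T n (v k) x - v k x" "{n + 3<..N}"] by linarith
      qed
      have "M / 3 \<le> real (jmax (lam / 2) L (\<lambda>n. T n g x)) \<or> lam * M / 12 \<le> g x \<or> lam * M / 24 \<le> Et x"
      proof (rule jmax_three[OF _ lam, where e = e and w = "\<lambda>n. w n x"])
        show "T n f x = T n g x + (e n - w n x)" for n by (simp add: e_def)
        show "w (Suc n) x \<le> w n x" for n unfolding w_def by (intro sum_mono2 v0) auto
        show "0 \<le> w n x" for n unfolding w_def by (intro sum_nonneg v0) auto
        show "w 0 x \<le> g x" unfolding w_def g_def by (intro sum_mono2 v0) auto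
        show "(\<Sum>n\<le>L. \<bar>e n\<bar>) \<le> Et x" unfolding Et_def by (intro sum_mono e_le) auto
      qed (rule Mx)
      then show ?thesis by auto
    qed auto
  qed
  have m2: "{x. M / 3 \<le> real (jmax (lam / 2) L (\<lambda>n. T n g x))} \<in> sets h"
  proof -
    have [measurable]: "T n g \<in> borel_measurable borel" for n by (rule cbp_measurable[OF cbp_T[OF g]])
    have "{x \<in> space h. M / 3 \<le> real (jmax (lam / 2) L (\<lambda>n. T n g x))} \<in> sets h" by measurable
    then show ?thesis by simp
  qed
  have m3: "{x. lam * M / 12 \<le> g x} \<in> sets h" "{x. lam * M / 24 \<le> Et x} \<in> sets h"
  proof -
    note [measurable] = cbp_measurable[OF g] cbp_measurable[OF Et(1)]
    have "{x \<in> space h. lam * M / 12 \<le> g x} \<in> sets h" "{x \<in> space h. lam * M / 24 \<le> Et x} \<in> sets h" by measurable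
    then show "{x. lam * M / 12 \<le> g x} \<in> sets h" "{x. lam * M / 24 \<le> Et x} \<in> sets h" by simp_all
  qed
  \<comment> \<open>Here \<open>1 \<le> M\<close> enters: the terms from Markov's inequality have
    \<open>lam * M\<close> in place of \<open>\<beta>\<close>.\<close>
  have MM: "1 / (lam * M) \<le> 1 / \<beta>"
  proof -
    have "sqrt M * 1 \<le> sqrt M * sqrt M" using M by (intro mult_left_mono) auto
    then have "\<beta> \<le> lam * M" using lam M by (simp add: \<beta>_def)
    then show ?thesis using \<beta> lam M by (intro divide_left_mono) auto
  qed
  have l2: "emeasure h {x. M / 3 \<le> real (jmax (lam / 2) L (\<lambda>n. T n g x))} \<le> ennreal (192 * 10^15 * (I / \<beta>))"
  proof -
    have "emeasure h {x. M / 3 \<le> real (jmax (lam / 2) L (\<lambda>n. T n g x))} \<le> ennreal (10^15 * (\<integral>x. (g x)\<^sup>2 \<partial>h) / ((lam / 2)\<^sup>2 * (M / 3)))"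
      using L2_jump_inequality[of "lam / 2" "M / 3" L "Abs_cb g"] lam M by (simp add: cb_fun_Abs g N_square_integral)
    also have "\<dots> \<le> ennreal (10^15 * (16 * \<beta> * I) / ((lam / 2)\<^sup>2 * (M / 3)))"
      using g2 M by (intro ennreal_leI divide_right_mono mult_left_mono) auto
    also have "10^15 * (16 * \<beta> * I) / ((lam / 2)\<^sup>2 * (M / 3)) = 192 * 10^15 * (\<beta> * I / (lam\<^sup>2 * M))"
      by (simp add: power2_eq_square field_simps)
    also have "\<beta> * I / (lam\<^sup>2 * M) = I / \<beta>"
    proof -
      \<comment> \<open>This is the balance for which \<open>\<beta>\<close> was chosen.\<close>
      have "\<beta> * \<beta> = lam\<^sup>2 * M" using M by (simp add: \<beta>_def power2_eq_square)
      then show ?thesis using \<beta> by (metis divide_divide_eq_left mult.commute nonzero_mult_div_cancel_right less_irrefl)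
    qed
    finally show ?thesis .
  qed
  have l3: "emeasure h {x. lam * M / 12 \<le> g x} \<le> ennreal (12 * (I / \<beta>))"
  proof -
    have "emeasure h {x. lam * M / 12 \<le> g x} \<le> ennreal ((\<integral>x. g x \<partial>h) / (lam * M / 12))"
      using lam M by (intro markov_cbp g g0) auto
    also have "\<dots> \<le> ennreal (I / (lam * M / 12))" using lam M int_g by (intro ennreal_leI divide_right_mono) auto
    also have "I / (lam * M / 12) = 12 * I * (1 / (lam * M))" by simp
    also have "ennreal \<dots> \<le> ennreal (12 * I * (1 / \<beta>))" using I0 by (intro ennreal_leI mult_left_mono MM) auto
    finally show ?thesis by simp
  qed
  have l4: "emeasure h {x. lam * M / 24 \<le> Et x} \<le> ennreal (18624 * (I / \<beta>))"
  proof -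
    have "emeasure h {x. lam * M / 24 \<le> Et x} \<le> ennreal ((\<integral>x. Et x \<partial>h) / (lam * M / 24))"
      using lam M by (intro markov_cbp Et) auto
    also have "\<dots> \<le> ennreal (776 * I / (lam * M / 24))" using lam M int_Et by (intro ennreal_leI divide_right_mono) auto
    also have "776 * I / (lam * M / 24) = 18624 * I * (1 / (lam * M))" by simp
    also have "ennreal \<dots> \<le> ennreal (18624 * I * (1 / \<beta>))" using I0 by (intro ennreal_leI mult_left_mono MM) auto
    finally show ?thesis by simp
  qed
  have "emeasure h {x. M \<le> real (jmax lam L (\<lambda>n. T n f x))} \<le> emeasure h (Om \<union> {x. M / 3 \<le> real (jmax (lam / 2) L (\<lambda>n. T n g x))}
      \<union> {x. lam * M / 12 \<le> g x} \<union> {x. lam * M / 24 \<le> Et x})"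
    by (intro emeasure_mono sub sets.Un Om m2 m3)
  also have "\<dots> \<le> emeasure h Om + emeasure h {x. M / 3 \<le> real (jmax (lam / 2) L (\<lambda>n. T n g x))}
      + emeasure h {x. lam * M / 12 \<le> g x} + emeasure h {x. lam * M / 24 \<le> Et x}"
    by (intro order_trans[OF emeasure_subadditive] add_right_mono emeasure_subadditive sets.Un Om m2 m3)
  also have "\<dots> \<le> ennreal (I / \<beta>) + ennreal (192 * 10^15 * (I / \<beta>)) + ennreal (12 * (I / \<beta>)) + ennreal (18624 * (I / \<beta>))"
    by (intro add_mono Om_le l2 l3 l4)
  also have "\<dots> = ennreal (192000000000018637 * (I / \<beta>))"
    using I0 \<beta> by (simp flip: ennreal_plus)
  also have "\<dots> \<le> ennreal (10^18 * (I / \<beta>))"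
    using I0 \<beta> by (intro ennreal_leI mult_right_mono) auto
  also have "10^18 * (I / \<beta>) = 10^18 / (lam * sqrt M) * (\<integral>x. f x \<partial>h)" by (simp add: I_def \<beta>_def)
  finally show ?thesis .
qed

end

section \<open>Transference\<close>

text \<open>Jumps are defined by a strict inequality, hence persist under small perturbations, and
  one optimal chain for the limit is enough.\<close>

lemma jmax_limit:
  fixes u :: "nat \<Rightarrow> real" and v :: "nat \<Rightarrow> nat \<Rightarrow> real"
  assumes "\<And>n. n \<le> L \<Longrightarrow> (\<lambda>j. v j n) \<longlonglongrightarrow> u n"
  shows "\<forall>\<^sub>F j in sequentially. jmax lam L u \<le> jmax lam L (v j)"
proof -
  have jumps: "\<forall>\<^sub>F j in sequentially. jumps lam u ns \<le> jumps lam (v j) ns" if "set ns \<subseteq> {..L}" for ns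
    using that
  proof (induction ns rule: induct_list012)
    case (3 x y zs)
    have IH: "\<forall>\<^sub>F j in sequentially. jumps lam u (y # zs) \<le> jumps lam (v j) (y # zs)" using 3 by auto
    have "\<forall>\<^sub>F j in sequentially. lam < norm (u x - u y) \<longrightarrow> lam < norm (v j x - v j y)"
    proof (cases "lam < norm (u x - u y)")
      case True
      have "(\<lambda>j. norm (v j x - v j y)) \<longlonglongrightarrow> norm (u x - u y)"
        using 3(3) by (intro tendsto_intros assms) auto
      from order_tendstoD(1)[OF this True] show ?thesis by eventually_elim simp
    qed simp
    with IH show ?case by eventually_elim auto
  qed auto
  have "jmax lam L u \<in> jumps lam u ` jump_chains L"
    unfolding jmax_def using Nil_in_jump_chains[of L] by (intro Max_in) (auto simp: finite_jump_chains)
  then obtain ns where ns: "ns \<in> jump_chains L" "jmax lam L u = jumps lam u ns" by auto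
  have "\<forall>\<^sub>F j in sequentially. jumps lam u ns \<le> jumps lam (v j) ns"
    using ns(1) by (intro jumps) (simp add: jump_chains_def)
  then show ?thesis
    by eventually_elim (use jumps_le_jmax[OF ns(1)] ns(2) in \<open>auto intro: order_trans\<close>)
qed

locale folner_action = folner_inv h F W + M: sigma_finite_measure M
  for h :: "'g::{topological_group_add, t2_space, second_countable_topology} measure" and F W
    and M :: "'x measure" +
  fixes a :: "'g \<Rightarrow> 'x \<Rightarrow> 'x"
  assumes action: "measure_preserving_action M a"
begin

lemma action_measurable [measurable (raw)]:
  assumes "u \<in> borel_measurable N" "v \<in> measurable N M"
  shows "(\<lambda>x. a (u x) (v x)) \<in> measurable N M"
proof -
  have "(\<lambda>x. (u x, v x)) \<in> measurable N (borel \<Otimes>\<^sub>M M)" using assms by measurable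
  moreover have "(\<lambda>(g, x). a g x) \<in> measurable (borel \<Otimes>\<^sub>M M) M"
    using action by (simp add: measure_preserving_action_def)
  ultimately show ?thesis using measurable_compose by fastforce
qed

lemma action_space: "x \<in> space M \<Longrightarrow> a g x \<in> space M"
  using measurable_space[OF action_measurable[of "\<lambda>_. g" M "\<lambda>x. x"]] by auto

lemma action_add: "x \<in> space M \<Longrightarrow> a (g + g') x = a g (a g' x)"
  using action by (simp add: measure_preserving_action_def)

lemma nn_action:
  assumes [measurable]: "f \<in> borel_measurable M"
  shows "(\<integral>\<^sup>+x. f (a g x) \<partial>M) = (\<integral>\<^sup>+x. f x \<partial>M)"
proof -
  have "distr M M (a g) = M" using action by (simp add: measure_preserving_action_def)
  moreover have "(\<integral>\<^sup>+x. f x \<partial>distr M M (a g)) = (\<integral>\<^sup>+x. f (a g x) \<partial>M)"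
    by (intro nn_integral_distr) measurable
  ultimately show ?thesis by simp
qed

definition orbit_average :: "nat \<Rightarrow> ('x \<Rightarrow> 'b::{banach, second_countable_topology}) \<Rightarrow> 'x \<Rightarrow> 'b" where
  "orbit_average n f x = (\<integral>s. f (a (- s) x) \<partial>U n)"

lemma orbit_average_measurable [measurable (raw)]:
  fixes f :: "'x \<Rightarrow> 'b::{banach, second_countable_topology}"
  assumes [measurable]: "f \<in> borel_measurable M"
  shows "orbit_average n f \<in> borel_measurable M"
proof -
  interpret Un: finite_measure "U n" by (rule cmeasure_finite[OF cmeasure_U])
  have [measurable_cong]: "sets (U n) = sets borel" by (rule cmeasure_sets[OF cmeasure_U])
  show ?thesis unfolding orbit_average_def by measurable
qed

text \<open>The Bochner integral is 0 where integrability fails, so additivity and dominated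
  convergence for \<open>orbit_average\<close> are available only for almost every
  \<open>x\<close>.\<close>

lemma AE_orbit_average_integrable:
  fixes f :: "'x \<Rightarrow> 'b::{banach, second_countable_topology}"
  assumes f: "integrable M f"
  shows "AE x in M. integrable (U n) (\<lambda>s. f (a (- s) x))"
proof -
  interpret Un: finite_measure "U n" by (rule cmeasure_finite[OF cmeasure_U])
  interpret MU: pair_sigma_finite M "U n" ..
  have [measurable_cong]: "sets (U n) = sets borel" by (rule cmeasure_sets[OF cmeasure_U])
  have [measurable]: "f \<in> borel_measurable M" using f by auto
  have "integrable (M \<Otimes>\<^sub>M U n) (\<lambda>p. f (a (- snd p) (fst p)))"
  proof (rule integrableI_bounded)
    have "(\<integral>\<^sup>+p. ennreal (norm (f (a (- snd p) (fst p)))) \<partial>(M \<Otimes>\<^sub>M U n))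
        = (\<integral>\<^sup>+s. \<integral>\<^sup>+x. ennreal (norm (f (a (- s) x))) \<partial>M \<partial>U n)"
      by (subst MU.nn_integral_snd[symmetric]) (auto simp: case_prod_beta)
    also have "\<dots> = (\<integral>\<^sup>+s. \<integral>\<^sup>+x. ennreal (norm (f x)) \<partial>M \<partial>U n)"
      by (subst nn_action[where f = "\<lambda>x. ennreal (norm (f x))"]) auto
    also have "\<dots> = (\<integral>\<^sup>+x. ennreal (norm (f x)) \<partial>M)"
      using cprob_U[of n] by (simp add: cprob_def cmeasure_space[OF cmeasure_U])
    also have "\<dots> < \<infinity>" using f by (simp add: integrable_iff_bounded)
    finally show "(\<integral>\<^sup>+p. ennreal (norm (f (a (- snd p) (fst p)))) \<partial>(M \<Otimes>\<^sub>M U n)) < \<infinity>" .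
  qed measurable
  from MU.AE_integrable_fst'[OF this] show ?thesis by simp
qed

text \<open>On the orbit of \<open>x\<close>, cut off outside a slightly larger compact set \<open>G\<close>, the
  averages are convolutions on the group.\<close>

lemma weak_type_bounded:
  fixes f :: "'x \<Rightarrow> real"
  assumes f: "integrable M f" "\<And>x. 0 \<le> f x" "\<And>x. f x \<le> c" and lam: "0 < lam" and t: "0 < t"
  shows "emeasure M {x \<in> space M. t < real (jmax lam L (\<lambda>n. orbit_average n f x))}
    \<le> ennreal (2 * 10^18 / (lam * sqrt t) * (\<integral>x. f x \<partial>M))"
proof -
  interpret hM: pair_sigma_finite h M ..
  have [measurable]: "f \<in> borel_measurable M" using f by auto
  \<comment> \<open>\<open>W_inv\<close> with \<open>i = L\<close> has ratio 1 at
    \<open>L + 3\<close>, so the enlargement \<open>G\<close> has at most twice the measure of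
    \<open>E\<close>. Any \<open>n \<le> L\<close> moves points of \<open>E\<close> only within
    \<open>G\<close>.\<close>
  define E where "E = F (L + 3)"
  define G where "G = E + W L"
  have cE: "compact E" and cG: "compact G" unfolding E_def G_def by (auto intro!: compact_add F_compact W_compact)
  have [measurable]: "E \<in> sets borel" "G \<in> sets borel" using cE cG borel_compact by auto
  have Gle: "emeasure h G \<le> 2 * emeasure h E"
  proof -
    have "G \<subseteq> E \<union> ((E + W L + W L + W L + W L) - E)"
    proof
      fix x assume "x \<in> G"
      then have "x + 0 + 0 + 0 \<in> E + W L + W L + W L + W L"
        unfolding G_def using W_zero by (intro set_plus_intro)
      then show "x \<in> E \<union> ((E + W L + W L + W L + W L) - E)" by auto
    qed
    then have "emeasure h G \<le> emeasure h (E \<union> ((E + W L + W L + W L + W L) - E))"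
      by (intro emeasure_mono sets.Un sets.Diff compact_sets compact_add cE W_compact)
    also have "\<dots> \<le> emeasure h E + emeasure h ((E + W L + W L + W L + W L) - E)"
      by (intro emeasure_subadditive sets.Diff compact_sets compact_add cE W_compact)
    also have "\<dots> \<le> emeasure h E + ennreal (2 ^ (L + 3) / 2 ^ (L + 3)) * emeasure h (F (L + 3))"
      unfolding E_def by (intro add_left_mono W_inv) auto
    also have "\<dots> = 2 * emeasure h E" by (simp add: E_def mult_2)
    finally show ?thesis .
  qed
  define \<phi> where "\<phi> x g = f (a (- g) x) * indicator G g" for x g
  have \<phi>: "cbp (\<phi> x)" "\<And>g. 0 \<le> \<phi> x g" if x: "x \<in> space M" for x
  proof -
    have [measurable]: "(\<lambda>g. f (a (- g) x)) \<in> borel_measurable borel" using x by measurable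
    have c0: "0 \<le> c" using f(2,3) order_trans by blast
    show "cbp (\<phi> x)"
    proof (rule cbpI[where c = c and K = G])
      show "\<phi> x \<in> borel_measurable borel" unfolding \<phi>_def by measurable
      show "\<bar>\<phi> x g\<bar> \<le> c" for g using f(2,3) c0 by (auto simp: \<phi>_def indicator_def)
    qed (auto simp: cG \<phi>_def)
    show "0 \<le> \<phi> x g" for g using f(2) by (simp add: \<phi>_def)
  qed
  define Dset where "Dset = {x \<in> space M. t < real (jmax lam L (\<lambda>n. orbit_average n f x))}"
  have D [measurable]: "Dset \<in> sets M" unfolding Dset_def by measurable
  \<comment> \<open>As \<open>- (g + s) = - s + - g\<close>, averaging at the point
    \<open>a (- g) x\<close> of the orbit is multiplication of \<open>g\<close> by \<open>s\<close>
    from the right, which is what \<open>T n\<close> does.\<close>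
  have transfer: "orbit_average n f (a (- g) x) = T n (\<phi> x) g" if x: "x \<in> space M" and g: "g \<in> E" and n: "n \<le> L" for x g n
  proof -
    have "AE s in U n. f (a (- s) (a (- g) x)) = \<phi> x (g + s)"
      using U_supp[of n]
    proof eventually_elim
      case (elim s)
      have "s \<in> W L" using elim W_F[OF n] by auto
      then have "g + s \<in> G" unfolding G_def using g by (intro set_plus_intro)
      moreover have "a (- (g + s)) x = a (- s) (a (- g) x)"
        using action_add[OF x, of "- s" "- g"] by (simp add: minus_add)
      ultimately show ?case by (simp add: \<phi>_def)
    qed
    then show ?thesis unfolding orbit_average_def T_def av_def
    proof (rule integral_cong_AE[rotated 2])
      have [measurable_cong]: "sets (U n) = sets borel" by (rule cmeasure_sets[OF cmeasure_U])
      show "(\<lambda>s. f (a (- s) (a (- g) x))) \<in> borel_measurable (U n)"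
        using action_space[OF x] by measurable
      have [measurable]: "\<phi> x \<in> borel_measurable borel" by (rule cbp_measurable[OF \<phi>(1)[OF x]])
      show "(\<lambda>s. \<phi> x (g + s)) \<in> borel_measurable (U n)" by measurable
    qed
  qed
  define C where "C = 10^18 / (lam * sqrt t)"
  have C0: "0 \<le> C" using lam t by (simp add: C_def)
  have inner: "(\<integral>\<^sup>+g. indicator E g * indicator Dset (a (- g) x) \<partial>h) \<le> ennreal C * (\<integral>\<^sup>+g. ennreal (\<phi> x g) \<partial>h)"
    if x: "x \<in> space M" for x
  proof -
    \<comment> \<open>The count is an integer, so exceeding \<open>t > 0\<close> means at least 1.
      This meets the hypothesis \<open>1 \<le> M\<close> of the inequality on the group and loses
      nothing, since \<open>t \<le> M1\<close>.\<close>
    define M1 where "M1 = max 1 t"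
    have M1: "1 \<le> M1" "t \<le> M1" by (auto simp: M1_def)
    have [measurable]: "T n (\<phi> x) \<in> borel_measurable borel" for n by (rule cbp_measurable[OF cbp_T[OF \<phi>(1)[OF x]]])
    have B: "{g. M1 \<le> real (jmax lam L (\<lambda>n. T n (\<phi> x) g))} \<in> sets h"
    proof -
      have "{g \<in> space h. M1 \<le> real (jmax lam L (\<lambda>n. T n (\<phi> x) g))} \<in> sets h" by measurable
      then show ?thesis by simp
    qed
    have "(\<integral>\<^sup>+g. indicator E g * indicator Dset (a (- g) x) \<partial>h) \<le> (\<integral>\<^sup>+g. indicator {g. M1 \<le> real (jmax lam L (\<lambda>n. T n (\<phi> x) g))} g \<partial>h)"
    proof (rule nn_integral_mono)
      fix g
      have "M1 \<le> real (jmax lam L (\<lambda>n. T n (\<phi> x) g))" if "g \<in> E" "a (- g) x \<in> Dset"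
      proof -
        have "jmax lam L (\<lambda>n. orbit_average n f (a (- g) x)) = jmax lam L (\<lambda>n. T n (\<phi> x) g)"
          using that x by (intro jmax_cong transfer)
        then have "t < real (jmax lam L (\<lambda>n. T n (\<phi> x) g))" using that by (simp add: Dset_def)
        then show ?thesis using t by (simp add: M1_def)
      qed
      then show "indicator E g * indicator Dset (a (- g) x) \<le> (indicator {g. M1 \<le> real (jmax lam L (\<lambda>n. T n (\<phi> x) g))} g :: ennreal)"
        by (auto simp: indicator_def)
    qed
    also have "\<dots> = emeasure h {g. M1 \<le> real (jmax lam L (\<lambda>n. T n (\<phi> x) g))}" using B by simp
    also have "\<dots> \<le> ennreal (10^18 / (lam * sqrt M1) * (\<integral>g. \<phi> x g \<partial>h))"
      by (rule weak_type_jumps_cbp[OF \<phi>[OF x] lam M1(1)])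
    also have "\<dots> \<le> ennreal (C * (\<integral>g. \<phi> x g \<partial>h))"
      unfolding C_def using lam t M1 \<phi>(2)[OF x]
      by (intro ennreal_leI mult_right_mono divide_left_mono mult_left_mono) auto
    also have "\<dots> = ennreal C * ennreal (\<integral>g. \<phi> x g \<partial>h)"
      using C0 \<phi>(2)[OF x] by (intro ennreal_mult) auto
    also have "ennreal (\<integral>g. \<phi> x g \<partial>h) = (\<integral>\<^sup>+g. ennreal (\<phi> x g) \<partial>h)"
      using \<phi>[OF x] by (intro nn_integral_eq_integral[symmetric] cbp_integrable) auto
    finally show ?thesis .
  qed
  \<comment> \<open>The action preserves \<open>M\<close>, so every \<open>g\<close> in
    \<open>E\<close> sees the same measure of \<open>Dset\<close>; averaging over \<open>E\<close>
    makes room for Fubini.\<close>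
  have "emeasure h E * emeasure M Dset = (\<integral>\<^sup>+g. indicator E g * (\<integral>\<^sup>+x. indicator Dset (a (- g) x) \<partial>M) \<partial>h)"
    by (subst nn_action) (auto simp: nn_integral_multc sets_h)
  also have "\<dots> = (\<integral>\<^sup>+g. \<integral>\<^sup>+x. indicator E g * indicator Dset (a (- g) x) \<partial>M \<partial>h)"
    by (intro nn_integral_cong nn_integral_cmult[symmetric]) measurable
  also have "\<dots> = (\<integral>\<^sup>+x. \<integral>\<^sup>+g. indicator E g * indicator Dset (a (- g) x) \<partial>h \<partial>M)"
    by (rule hM.Fubini'[symmetric]) measurable
  also have "\<dots> \<le> (\<integral>\<^sup>+x. ennreal C * (\<integral>\<^sup>+g. ennreal (f (a (- g) x)) * indicator G g \<partial>h) \<partial>M)"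
  proof (rule nn_integral_mono)
    fix x assume x: "x \<in> space M"
    have "(\<integral>\<^sup>+g. ennreal (\<phi> x g) \<partial>h) = (\<integral>\<^sup>+g. ennreal (f (a (- g) x)) * indicator G g \<partial>h)"
      by (intro nn_integral_cong) (simp add: \<phi>_def indicator_def)
    then show "(\<integral>\<^sup>+g. indicator E g * indicator Dset (a (- g) x) \<partial>h) \<le> ennreal C * (\<integral>\<^sup>+g. ennreal (f (a (- g) x)) * indicator G g \<partial>h)"
      using inner[OF x] by simp
  qed
  also have "\<dots> = ennreal C * (\<integral>\<^sup>+x. \<integral>\<^sup>+g. ennreal (f (a (- g) x)) * indicator G g \<partial>h \<partial>M)"
    by (rule nn_integral_cmult) measurable
  also have "(\<integral>\<^sup>+x. \<integral>\<^sup>+g. ennreal (f (a (- g) x)) * indicator G g \<partial>h \<partial>M) = (\<integral>\<^sup>+g. \<integral>\<^sup>+x. ennreal (f (a (- g) x)) * indicator G g \<partial>M \<partial>h)"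
    by (rule hM.Fubini') measurable
  also have "\<dots> = (\<integral>\<^sup>+g. (\<integral>\<^sup>+x. ennreal (f (a (- g) x)) \<partial>M) * indicator G g \<partial>h)"
    by (intro nn_integral_cong nn_integral_multc) measurable
  also have "\<dots> = (\<integral>\<^sup>+g. (\<integral>\<^sup>+x. ennreal (f x) \<partial>M) * indicator G g \<partial>h)"
    by (subst nn_action[where f = "\<lambda>x. ennreal (f x)"]) auto
  also have "\<dots> = (\<integral>\<^sup>+x. ennreal (f x) \<partial>M) * emeasure h G"
    by (subst nn_integral_cmult) (auto simp: sets_h)
  also have "(\<integral>\<^sup>+x. ennreal (f x) \<partial>M) = ennreal (\<integral>x. f x \<partial>M)"
    using f by (intro nn_integral_eq_integral) auto
  also have "ennreal C * (ennreal (\<integral>x. f x \<partial>M) * emeasure h G) \<le> ennreal C * (ennreal (\<integral>x. f x \<partial>M) * (2 * emeasure h E))"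
    by (intro mult_left_mono Gle) auto
  also have "\<dots> = emeasure h E * ennreal (2 * C * (\<integral>x. f x \<partial>M))"
    using C0 f(2) by (simp add: ennreal_mult' ac_simps)
  finally have "emeasure h E * emeasure M Dset \<le> emeasure h E * ennreal (2 * C * (\<integral>x. f x \<partial>M))" .
  moreover have "emeasure h E \<noteq> 0" "emeasure h E \<noteq> \<infinity>"
    using F_pos[of "L + 3"] finite_compact[OF cE] by (auto simp: E_def)
  ultimately have "emeasure M Dset \<le> ennreal (2 * C * (\<integral>x. f x \<partial>M))"
    by (simp add: ennreal_mult_le_mult_iff)
  then show ?thesis by (simp add: Dset_def C_def)
qed

text \<open>Bounded truncations keep the functions on the group in \<open>cbp\<close>. The counts
  are lower semicontinuous by \<open>jmax_limit\<close>, so Fatou's lemma removes the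
  truncation.\<close>

lemma weak_type_nonneg:
  fixes f :: "'x \<Rightarrow> real"
  assumes f: "integrable M f" "\<And>x. 0 \<le> f x" and lam: "0 < lam" and t: "0 < t"
  shows "emeasure M {x \<in> space M. t < real (jmax lam L (\<lambda>n. orbit_average n f x))}
    \<le> ennreal (2 * 10^18 / (lam * sqrt t) * (\<integral>x. f x \<partial>M))"
proof -
  have [measurable]: "f \<in> borel_measurable M" using f by auto
  define fj where "fj j x = min (f x) (real j)" for j x
  have fj: "integrable M (fj j)" "\<And>x. 0 \<le> fj j x" "\<And>x. fj j x \<le> real j" "\<And>x. fj j x \<le> f x" for j
    unfolding fj_def using f(2) by (auto intro: Bochner_Integration.integrable_bound[OF f(1)])
  have [measurable]: "fj j \<in> borel_measurable M" for j using fj(1)[of j] by auto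
  define Dj where "Dj j = {x \<in> space M. t < real (jmax lam L (\<lambda>n. orbit_average n (fj j) x))}" for j
  define D0 where "D0 = {x \<in> space M. t < real (jmax lam L (\<lambda>n. orbit_average n f x))}"
  define C where "C = 2 * 10^18 / (lam * sqrt t) * (\<integral>x. f x \<partial>M)"
  have Dm [measurable]: "Dj j \<in> sets M" "D0 \<in> sets M" for j unfolding Dj_def D0_def by measurable
  have lim: "AE x in M. \<forall>n. integrable (U n) (\<lambda>s. f (a (- s) x))"
    unfolding AE_all_countable using AE_orbit_average_integrable[OF f(1)] by blast
  have "emeasure M D0 = (\<integral>\<^sup>+x. indicator D0 x \<partial>M)" by simp
  also have "\<dots> \<le> (\<integral>\<^sup>+x. liminf (\<lambda>j. indicator (Dj j) x) \<partial>M)"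
  proof (rule nn_integral_mono_AE)
    show "AE x in M. indicator D0 x \<le> (liminf (\<lambda>j. indicator (Dj j) x) :: ennreal)"
      using lim AE_space
    proof eventually_elim
      case (elim x)
      have conv: "(\<lambda>j. orbit_average n (fj j) x) \<longlonglongrightarrow> orbit_average n f x" for n
        unfolding orbit_average_def
      proof (rule integral_dominated_convergence[where w = "\<lambda>s. f (a (- s) x)"])
        have [measurable_cong]: "sets (U n) = sets borel" by (rule cmeasure_sets[OF cmeasure_U])
        show "(\<lambda>s. f (a (- s) x)) \<in> borel_measurable (U n)" "(\<lambda>s. fj j (a (- s) x)) \<in> borel_measurable (U n)" for j
          using elim(2) by measurable
        show "AE s in U n. (\<lambda>j. fj j (a (- s) x)) \<longlonglongrightarrow> f (a (- s) x)"
        proof (rule AE_I2)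
          fix s
          obtain j0 :: nat where "f (a (- s) x) \<le> real j0" using real_arch_simple by blast
          then have "\<forall>\<^sub>F j in sequentially. fj j (a (- s) x) = f (a (- s) x)"
            unfolding eventually_sequentially by (intro exI[of _ j0]) (auto simp: fj_def min_def)
          then show "(\<lambda>j. fj j (a (- s) x)) \<longlonglongrightarrow> f (a (- s) x)" by (rule tendsto_eventually)
        qed
      qed (use elim fj in auto)
      show ?case
      proof (cases "x \<in> D0")
        case True
        have "\<forall>\<^sub>F j in sequentially. jmax lam L (\<lambda>n. orbit_average n f x) \<le> jmax lam L (\<lambda>n. orbit_average n (fj j) x)"
          by (rule jmax_limit) (rule conv)
        then have "\<forall>\<^sub>F j in sequentially. 1 \<le> (indicator (Dj j) x :: ennreal)"
          by eventually_elim (use True in \<open>auto simp: D0_def Dj_def\<close>)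
        then have "1 \<le> (liminf (\<lambda>j. indicator (Dj j) x) :: ennreal)" by (rule Liminf_bounded)
        then show ?thesis by (simp add: indicator_def)
      qed simp
    qed
  qed
  also have "\<dots> \<le> liminf (\<lambda>j. \<integral>\<^sup>+x. indicator (Dj j) x \<partial>M)"
    by (rule nn_integral_liminf) measurable
  also have "\<dots> \<le> liminf (\<lambda>j. ennreal C)"
  proof (rule Liminf_mono[OF always_eventually], rule allI)
    fix j
    have "(\<integral>\<^sup>+x. indicator (Dj j) x \<partial>M) \<le> ennreal (2 * 10^18 / (lam * sqrt t) * (\<integral>x. fj j x \<partial>M))"
      using weak_type_bounded[OF fj(1,2,3) lam t, of L j] by (simp add: Dj_def)
    also have "\<dots> \<le> ennreal C"
      unfolding C_def using lam t by (intro ennreal_leI mult_left_mono integral_mono fj f) auto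
    finally show "(\<integral>\<^sup>+x. indicator (Dj j) x \<partial>M) \<le> ennreal C" .
  qed
  also have "\<dots> = ennreal C" by (simp add: Liminf_const)
  finally show ?thesis by (simp add: D0_def C_def)
qed

text \<open>Four nonnegative parts, each with \<open>lam / 4\<close> and \<open>t / 4\<close>: the
  factor 2 becomes 2 * 4 * 2 = 16 for each part, 64 in total.\<close>

lemma weak_type_complex:
  fixes f :: "'x \<Rightarrow> complex"
  assumes f: "integrable M f" and lam: "0 < lam" and t: "0 < t"
  shows "emeasure M {x \<in> space M. t < real (jmax lam L (\<lambda>n. orbit_average n f x))}
    \<le> ennreal (64 * 10^18 / (lam * sqrt t) * (\<integral>x. norm (f x) \<partial>M))"
proof -
  define q :: "nat \<Rightarrow> 'x \<Rightarrow> real" where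
    "q i x = (if i = 0 then max (Re (f x)) 0 else if i = 1 then max (- Re (f x)) 0
      else if i = 2 then max (Im (f x)) 0 else max (- Im (f x)) 0)" for i x
  have [measurable]: "f \<in> borel_measurable M" using f by auto
  have [measurable]: "q i \<in> borel_measurable M" for i unfolding q_def[abs_def] by measurable
  have q: "0 \<le> q i x" "q i x \<le> norm (f x)" for i x
    unfolding q_def using abs_Re_le_cmod[of "f x"] abs_Im_le_cmod[of "f x"] by auto
  have qi: "integrable M (q i)" for i
    by (rule Bochner_Integration.integrable_bound[OF f]) (use q in auto)
  define Q where "Q i = {x \<in> space M. t / 4 < real (jmax (lam / 4) L (\<lambda>n. orbit_average n (q i) x))}" for i
  define I where "I = (\<integral>x. norm (f x) \<partial>M)"
  have I0: "0 \<le> I" by (simp add: I_def)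
  have Qm [measurable]: "Q i \<in> sets M" for i unfolding Q_def by measurable
  have Qle: "emeasure M (Q i) \<le> ennreal (16 * 10^18 / (lam * sqrt t) * I)" for i
  proof -
    have "emeasure M (Q i) \<le> ennreal (2 * 10^18 / (lam / 4 * sqrt (t / 4)) * (\<integral>x. q i x \<partial>M))"
      unfolding Q_def using lam t by (intro weak_type_nonneg qi q) auto
    also have "\<dots> \<le> ennreal (2 * 10^18 / (lam / 4 * sqrt (t / 4)) * I)"
      unfolding I_def using lam t by (intro ennreal_leI mult_left_mono integral_mono qi integrable_norm f q) auto
    also have "2 * 10^18 / (lam / 4 * sqrt (t / 4)) = 16 * 10^18 / (lam * sqrt t)"
      by (simp add: real_sqrt_divide)
    finally show ?thesis .
  qed
  have lim: "AE x in M. (\<forall>n. integrable (U n) (\<lambda>s. f (a (- s) x))) \<and> (\<forall>i n. integrable (U n) (\<lambda>s. q i (a (- s) x)))"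
    unfolding AE_conj_iff AE_all_countable using AE_orbit_average_integrable[OF f] AE_orbit_average_integrable[OF qi] by blast
  have "emeasure M {x \<in> space M. t < real (jmax lam L (\<lambda>n. orbit_average n f x))} \<le> emeasure M (Q 0 \<union> Q 1 \<union> Q 2 \<union> Q 3)"
  proof (rule emeasure_mono_AE)
    show "AE x in M. x \<in> {x \<in> space M. t < real (jmax lam L (\<lambda>n. orbit_average n f x))} \<longrightarrow> x \<in> Q 0 \<union> Q 1 \<union> Q 2 \<union> Q 3"
      using lim
    proof (eventually_elim, intro impI)
      fix x
      assume int: "(\<forall>n. integrable (U n) (\<lambda>s. f (a (- s) x))) \<and> (\<forall>i n. integrable (U n) (\<lambda>s. q i (a (- s) x)))"
        and x: "x \<in> {x \<in> space M. t < real (jmax lam L (\<lambda>n. orbit_average n f x))}"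
      have decomp: "orbit_average n f x = (of_real (orbit_average n (q 0) x) + - of_real (orbit_average n (q 1) x))
          + (\<i> * of_real (orbit_average n (q 2) x) + - (\<i> * of_real (orbit_average n (q 3) x)))" for n
      proof -
        have e: "f y = (of_real (q 0 y) - of_real (q 1 y)) + (\<i> * of_real (q 2 y) - \<i> * of_real (q 3 y))" for y
          by (rule complex_eqI) (auto simp: q_def)
        have i: "integrable (U n) (\<lambda>s. complex_of_real (q i (a (- s) x)))" for i using int by auto
        have "orbit_average n f x = (\<integral>s. (of_real (q 0 (a (- s) x)) - of_real (q 1 (a (- s) x)))
            + (\<i> * of_real (q 2 (a (- s) x)) - \<i> * of_real (q 3 (a (- s) x))) \<partial>U n)"
          unfolding orbit_average_def e[symmetric] ..
        also have "\<dots> = (of_real (orbit_average n (q 0) x) - of_real (orbit_average n (q 1) x))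
            + (\<i> * of_real (orbit_average n (q 2) x) - \<i> * of_real (orbit_average n (q 3) x))"
          using i by (simp add: orbit_average_def)
        finally show ?thesis by simp
      qed
      have one: "jmax (lam / 4) L (\<lambda>n. z * complex_of_real (u n)) \<le> jmax (lam / 4) L u" if "norm z = 1" for u z
      proof (rule jmax_weaken)
        fix x y assume "lam / 4 < norm (z * complex_of_real (u x) - z * complex_of_real (u y))"
        then show "lam / 4 < norm (u x - u y)"
          using that by (simp add: right_diff_distrib[symmetric] norm_mult flip: of_real_diff)
      qed
      define A0 A1 A2 A3 where "A0 n = complex_of_real (orbit_average n (q 0) x)" and "A1 n = - complex_of_real (orbit_average n (q 1) x)"
        and "A2 n = \<i> * complex_of_real (orbit_average n (q 2) x)" and "A3 n = - (\<i> * complex_of_real (orbit_average n (q 3) x))" for n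
      have "jmax lam L (\<lambda>n. orbit_average n f x) = jmax ((lam / 4 + lam / 4) + (lam / 4 + lam / 4)) L (\<lambda>n. (A0 n + A1 n) + (A2 n + A3 n))"
        by (simp add: decomp A0_def A1_def A2_def A3_def)
      also have "\<dots> \<le> jmax (lam / 4 + lam / 4) L (\<lambda>n. A0 n + A1 n) + jmax (lam / 4 + lam / 4) L (\<lambda>n. A2 n + A3 n)"
        by (rule jmax_add)
      also have "\<dots> \<le> (jmax (lam / 4) L A0 + jmax (lam / 4) L A1) + (jmax (lam / 4) L A2 + jmax (lam / 4) L A3)"
        by (intro add_mono jmax_add)
      finally have "t < real (jmax (lam / 4) L A0) + real (jmax (lam / 4) L A1) + real (jmax (lam / 4) L A2) + real (jmax (lam / 4) L A3)"
        using x by (simp add: of_nat_add[symmetric] del: of_nat_add)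
      moreover have "jmax (lam / 4) L A0 \<le> jmax (lam / 4) L (\<lambda>n. orbit_average n (q 0) x)"
        unfolding A0_def using one[of 1 "\<lambda>n. orbit_average n (q 0) x"] by simp
      moreover have "jmax (lam / 4) L A1 \<le> jmax (lam / 4) L (\<lambda>n. orbit_average n (q 1) x)"
        unfolding A1_def using one[of "-1" "\<lambda>n. orbit_average n (q 1) x"] by simp
      moreover have "jmax (lam / 4) L A2 \<le> jmax (lam / 4) L (\<lambda>n. orbit_average n (q 2) x)"
        unfolding A2_def using one[of \<i> "\<lambda>n. orbit_average n (q 2) x"] by simp
      moreover have "jmax (lam / 4) L A3 \<le> jmax (lam / 4) L (\<lambda>n. orbit_average n (q 3) x)"
        unfolding A3_def using one[of "- \<i>" "\<lambda>n. orbit_average n (q 3) x"] by simp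
      ultimately have "t / 4 < real (jmax (lam / 4) L (\<lambda>n. orbit_average n (q 0) x)) \<or> t / 4 < real (jmax (lam / 4) L (\<lambda>n. orbit_average n (q 1) x))
          \<or> t / 4 < real (jmax (lam / 4) L (\<lambda>n. orbit_average n (q 2) x)) \<or> t / 4 < real (jmax (lam / 4) L (\<lambda>n. orbit_average n (q 3) x))"
        by linarith
      then show "x \<in> Q 0 \<union> Q 1 \<union> Q 2 \<union> Q 3" using x by (auto simp: Q_def)
    qed
  qed measurable
  also have "\<dots> \<le> emeasure M (Q 0) + emeasure M (Q 1) + emeasure M (Q 2) + emeasure M (Q 3)"
    by (intro order_trans[OF emeasure_subadditive] add_right_mono emeasure_subadditive sets.Un Qm)
  also have "\<dots> \<le> ennreal (16 * 10^18 / (lam * sqrt t) * I) + ennreal (16 * 10^18 / (lam * sqrt t) * I)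
      + ennreal (16 * 10^18 / (lam * sqrt t) * I) + ennreal (16 * 10^18 / (lam * sqrt t) * I)"
    by (intro add_mono Qle)
  also have "\<dots> = ennreal (64 * 10^18 / (lam * sqrt t) * I)"
  proof -
    have "0 \<le> 16 * 10^18 / (lam * sqrt t) * I" using lam t I0 by auto
    then show ?thesis by (subst ennreal_plus[symmetric], simp, simp)+ simp
  qed
  finally show ?thesis by (simp add: I_def)
qed

end

section \<open>Admissible Foelner sequences\<close>

lemma (in folner_action) ergodic_average_eq_orbit_average:
  fixes f :: "'x \<Rightarrow> complex"
  assumes [measurable]: "f \<in> borel_measurable M" and x: "x \<in> space M"
  shows "ergodic_average h F a n f x = orbit_average n f x"
proof -
  have [measurable]: "(\<lambda>s. f (a (- s) x)) \<in> borel_measurable h" using x by measurable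
  have [measurable]: "F n \<in> sets h" by (rule compact_sets[OF F_compact])
  have "orbit_average n f x = (\<integral>s. (indicator (F n) s / m n) *\<^sub>R f (a (- s) x) \<partial>h)"
    unfolding orbit_average_def unif_def by (rule integral_density) auto
  also have "\<dots> = (\<integral>s. (1 / m n) *\<^sub>R (indicator (F n) s *\<^sub>R f (a (- s) x)) \<partial>h)" by simp
  also have "\<dots> = (1 / m n) *\<^sub>R (\<integral>s. indicator (F n) s *\<^sub>R f (a (- s) x) \<partial>h)"
    by (rule integral_scaleR_right)
  finally show ?thesis by (simp add: ergodic_average_def set_lebesgue_integral_def)
qed

text \<open>The point is sigma-finiteness: by local compactness the members of a countable basis
  that lie in compact sets cover the group.\<close>

lemma haar_space_of_locally_compact:
  fixes h :: "'g::{topological_group_add, t2_space, second_countable_topology} measure"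
  assumes lc: "locally compact (UNIV :: 'g set)" and h: "right_haar_measure h"
  shows "haar_space h"
proof -
  have sets: "sets h = sets borel" and fin: "\<And>K. compact K \<Longrightarrow> emeasure h K < \<infinity>"
    and inv: "\<And>E g. E \<in> sets borel \<Longrightarrow> emeasure h ((\<lambda>x. x + g) ` E) = emeasure h E"
    using h by (auto simp: right_haar_measure_def)
  obtain B :: "'g set set" where B: "countable B" "topological_basis B" using ex_countable_basis by blast
  define C where "C = {b \<in> B. \<exists>K. compact K \<and> b \<subseteq> K}"
  have "sigma_finite_measure h"
  proof
    show "\<exists>A. countable A \<and> A \<subseteq> sets h \<and> \<Union> A = space h \<and> (\<forall>a\<in>A. emeasure h a \<noteq> \<infinity>)"
    proof (intro exI[of _ C] conjI ballI)
      show "countable C" unfolding C_def by (rule countable_subset[OF _ B(1)]) auto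
      show "C \<subseteq> sets h" unfolding C_def sets using topological_basis_open[OF B(2)] by auto
      show "\<Union> C = space h"
      proof -
        have "x \<in> \<Union> C" for x
        proof -
          obtain u K where u: "open u" "compact K" "x \<in> u" "u \<subseteq> K"
            using lc unfolding locally_def by (metis UNIV_I open_UNIV open_openin subtopology_UNIV)
          obtain b where "b \<in> B" "x \<in> b" "b \<subseteq> u" using topological_basisE[OF B(2) u(1,3)] .
          then show ?thesis using u unfolding C_def by blast
        qed
        then show ?thesis using sets_eq_imp_space_eq[OF sets] by auto
      qed
      show "emeasure h b \<noteq> \<infinity>" if "b \<in> C" for b
      proof -
        obtain K where K: "compact K" "b \<subseteq> K" using \<open>b \<in> C\<close> unfolding C_def by blast
        have "emeasure h b \<le> emeasure h K" using K borel_compact[OF K(1)] by (intro emeasure_mono) (auto simp: sets)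
        then show ?thesis using fin[OF K(1)] by (auto simp: top_unique)
      qed
    qed
  qed
  then show ?thesis using sets fin inv by (intro haar_space.intro haar_space_axioms.intro)
qed

text \<open>Density zero of the empty set contradicts the bound \<open>1 - c' > 0\<close>. A point
  of \<open>Adm\<close> lies in an admissible atom of every level.\<close>

lemma Adm_nonempty:
  assumes "admissible_triple h F B P"
  shows "Adm h F P \<noteq> {}"
proof
  assume e: "Adm h F P = {}"
  obtain c' :: real where c': "0 < c'" "c' < 1" "ennreal (1 - c') \<le> lower_banach_density h (Adm h F P)"
    using assms by (auto simp: admissible_triple_def)
  have "lower_banach_density h (Adm h F P) \<le> 0"
    unfolding lower_banach_density_def e
  proof (rule SUP_least)
    fix K assume "K \<in> {K. compact K \<and> 0 < haar_size h K}"
    have "(INF g. haar_size h ((g +o K) \<inter> {}) / haar_size h (g +o K)) \<le> haar_size h ((0 +o K) \<inter> {}) / haar_size h (0 +o K)"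
      by (rule INF_lower) simp
    also have "\<dots> = 0" by simp
    finally show "(INF g. haar_size h ((g +o K) \<inter> {}) / haar_size h (g +o K)) \<le> 0" .
  qed
  then have "ennreal (1 - c') \<le> 0" using c'(3) by (rule order_trans[rotated])
  then show False using c' by (simp add: ennreal_eq_0_iff)
qed

definition sym_union :: "(nat \<Rightarrow> 'g::group_add set) \<Rightarrow> nat \<Rightarrow> 'g set" where
  "sym_union F i = insert 0 (\<Union>n\<le>i. F n \<union> uminus ` F n)"

lemma powi_diff: "(2::real) powi (int k - int n) = 2 ^ k / 2 ^ n"
  by (simp add: power_int_diff)

section \<open>Products of elements of the symmetrised sets\<close>

context haar_space
begin

lemma shift_sets:
  assumes "A \<in> sets borel" shows "{y. y - s \<in> A} \<in> sets h"
proof -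
  note [measurable] = assms
  have "{y \<in> space h. y - s \<in> A} \<in> sets h" by measurable
  then show ?thesis by simp
qed

lemma shift_emeasure:
  assumes A: "A \<in> sets borel" shows "emeasure h {y. y - s \<in> A} = emeasure h A"
proof -
  have "{y. y - s \<in> A} = (\<lambda>x. x + s) ` A"
  proof -
    have "y \<in> (\<lambda>x. x + s) ` A" if "y - s \<in> A" for y
      using that by (intro image_eqI[of _ _ "y - s"]) auto
    then show ?thesis by auto
  qed
  then show ?thesis using inv[OF A] by simp
qed

text \<open>A point moved out of \<open>A\<close> by \<open>s\<close> followed by \<open>t\<close>
  was either out of \<open>A\<close> already after \<open>s\<close>, and \<open>t\<close> preserves
  the measure of such points, or it leaves by \<open>t\<close>.\<close>

lemma shift_defect_add:
  assumes A: "A \<in> sets borel"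
  shows "emeasure h ({y. y - (s + t) \<in> A} - A) \<le> emeasure h ({y. y - s \<in> A} - A) + emeasure h ({y. y - t \<in> A} - A)"
proof -
  define Z where "Z = {y. y - s \<in> A} - A"
  have Z: "Z \<in> sets borel" unfolding Z_def using shift_sets[OF A, of s] A by (auto simp: sets_h)
  have "{y. y - (s + t) \<in> A} - A \<subseteq> {y. y - t \<in> Z} \<union> ({y. y - t \<in> A} - A)"
    by (auto simp: Z_def diff_add_eq_diff_diff_swap)
  then have "emeasure h ({y. y - (s + t) \<in> A} - A) \<le> emeasure h ({y. y - t \<in> Z} \<union> ({y. y - t \<in> A} - A))"
    using A Z by (intro emeasure_mono sets.Un sets.Diff shift_sets) (auto simp: sets_h)
  also have "\<dots> \<le> emeasure h {y. y - t \<in> Z} + emeasure h ({y. y - t \<in> A} - A)"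
    using A Z by (intro emeasure_subadditive sets.Diff shift_sets) (auto simp: sets_h)
  finally show ?thesis unfolding shift_emeasure[OF Z] unfolding Z_def .
qed

lemma compact_sym_union:
  fixes F :: "nat \<Rightarrow> 'g set"
  shows "(\<And>n. compact (F n)) \<Longrightarrow> compact (sym_union F i)"
  unfolding sym_union_def by (intro compact_insert compact_UN compact_Un compact_neg) auto

text \<open>A product of four elements of the symmetrised sets moves less than half of an admissible atom
  out of the atom, hence it is a quotient of two points of the atom.\<close>

lemma sym_union_words:
  assumes ff: "filtered_folner_sequence h F B P" and A: "A \<in> admissible_atoms h F P (i + 3)"
    and s: "s1 \<in> sym_union F i" "s2 \<in> sym_union F i" "s3 \<in> sym_union F i" "s4 \<in> sym_union F i"
  shows "\<exists>b\<in>B (i + 3). \<exists>b'\<in>B (i + 3). s1 + s2 + s3 + s4 = - b + b'"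
proof -
  define k where "k = i + 3"
  have AP: "A \<in> P k" and adm: "\<And>n. n < k \<Longrightarrow> invariant_set h (2 powi (int n - int k)) (F n) A"
    using A by (auto simp: admissible_atoms_def k_def)
  have af: "A \<in> sets h" "0 < haar_size h A" "haar_size h A < \<infinity>"
    using ff AP unfolding filtered_folner_sequence_def atomic_filtration_def by blast+
  have sA: "A \<in> sets borel" using af(1) by (simp add: sets_h)
  have A0: "0 < emeasure h A" "emeasure h A < \<infinity>" using af by simp_all
  have one: "emeasure h ({y. y - s \<in> A} - A) \<le> ennreal (1 / 8) * emeasure h A" if s: "s \<in> sym_union F i" for s
  proof (cases "s = 0")
    case False
    then obtain n where n: "n \<le> i" "s \<in> F n \<or> s \<in> uminus ` F n" using s by (auto simp: sym_union_def)
    have "haar_size h ((A + F n) - A) \<le> ennreal (2 powi (int n - int k)) * haar_size h A"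
      "haar_size h ((A + uminus ` F n) - A) \<le> ennreal (2 powi (int n - int k)) * haar_size h A"
      using adm[of n] n by (auto simp: invariant_set_def k_def)
    moreover have "haar_size h ({y. y - s \<in> A} - A) \<le> haar_size h ((A + C) - A)" if "s \<in> C" for C
    proof (rule outer_measure_of_mono)
      have "y \<in> A + C" if "y - s \<in> A" for y
        using set_plus_intro[OF that \<open>s \<in> C\<close>] by simp
      then show "{y. y - s \<in> A} - A \<subseteq> A + C - A" by auto
    qed
    ultimately have "haar_size h ({y. y - s \<in> A} - A) \<le> ennreal (2 powi (int n - int k)) * haar_size h A"
      using n(2) by (meson order_trans)
    then have "emeasure h ({y. y - s \<in> A} - A) \<le> ennreal (2 powi (int n - int k)) * emeasure h A"
      using af(1) sets.Diff[OF shift_sets[OF sA, of s] af(1)] by simp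
    \<comment> \<open>The offset 3 in \<open>k = i + 3\<close> gives 1/8 for one element, hence 1/2
      for four of them.\<close>
    also have "\<dots> \<le> ennreal (1 / 8) * emeasure h A"
    proof (intro mult_right_mono ennreal_leI)
      have "(2::real) ^ n \<le> 2 ^ i" using n by (intro power_increasing) auto
      then show "(2::real) powi (int n - int k) \<le> 1 / 8"
        unfolding powi_diff by (simp add: k_def power_add field_simps)
    qed simp
    finally show ?thesis .
  qed simp
  define s where "s = s1 + s2 + s3 + s4"
  have "emeasure h ({y. y - s \<in> A} - A) \<le> emeasure h ({y. y - s1 \<in> A} - A) + emeasure h ({y. y - s2 \<in> A} - A)
      + emeasure h ({y. y - s3 \<in> A} - A) + emeasure h ({y. y - s4 \<in> A} - A)"
    unfolding s_def
    by (intro order_trans[OF shift_defect_add[OF sA]] add_right_mono shift_defect_add[OF sA])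
  also have "\<dots> \<le> ennreal (1 / 8) * emeasure h A + ennreal (1 / 8) * emeasure h A
      + ennreal (1 / 8) * emeasure h A + ennreal (1 / 8) * emeasure h A"
    by (intro add_mono one s)
  also have "\<dots> = ennreal (1 / 2) * emeasure h A"
    by (simp flip: distrib_right ennreal_plus)
  also have "\<dots> < emeasure h A"
  proof -
    obtain r where r: "0 < r" "emeasure h A = ennreal r"
      using A0 by (cases "emeasure h A" rule: ennreal_cases) auto
    have "ennreal (1 / 2) * ennreal r = ennreal (1 / 2 * r)" by (rule ennreal_mult[symmetric]) (use r in auto)
    also have "\<dots> < ennreal r" using r by (intro ennreal_lessI) auto
    finally show ?thesis using r(2) by simp
  qed
  finally have lt: "emeasure h ({y. y - s \<in> A} - A) < emeasure h A" .
  \<comment> \<open>A translate disjoint from \<open>A\<close> would move out the full measure of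
    \<open>A\<close>.\<close>
  have "{y. y - s \<in> A} \<inter> A \<noteq> {}"
  proof
    assume "{y. y - s \<in> A} \<inter> A = {}"
    then have "{y. y - s \<in> A} - A = {y. y - s \<in> A}" by auto
    then show False using lt shift_emeasure[OF sA, of s] by simp
  qed
  then obtain y where y: "y \<in> A" "y - s \<in> A" by auto
  obtain \<gamma> where "A \<subseteq> \<gamma> +o B k"
    using ff AP unfolding filtered_folner_sequence_def by blast
  then have "y - s \<in> \<gamma> +o B k" "y \<in> \<gamma> +o B k" using y by auto
  then obtain b b' where b: "b \<in> B k" "b' \<in> B k" "y - s = \<gamma> + b" "y = \<gamma> + b'"
    unfolding elt_set_plus_def by blast
  have "s = - (y - s) + y" by (simp only: minus_diff_eq diff_add_cancel)
  also have "\<dots> = - (\<gamma> + b) + (\<gamma> + b')" using b(3,4) by simp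
  also have "\<dots> = - b + b'"
    by (simp add: minus_add add.assoc[symmetric] del: add_uminus_conv_diff)
       (simp add: add.assoc)
  finally have "s = - b + b'" .
  then show ?thesis using b(1,2) unfolding s_def k_def by blast
qed

end

text \<open>An atom of level \<open>i + 3\<close> fits into a translate of \<open>B (i + 3)\<close>,
  so products of four elements are quotients of two elements of \<open>B (i + 3)\<close>; boundary
  invariance of \<open>F n\<close> with respect to that set then gives \<open>W_inv\<close>.\<close>

lemma folner_inv_of_admissible:
  fixes h :: "'g::{topological_group_add, t2_space, second_countable_topology} measure"
  assumes hs: "haar_space h" and adm: "admissible_folner_sequence h F"
  shows "folner_inv h F (sym_union F)"
proof -
  interpret haar_space h by fact
  obtain B P where tr: "admissible_triple h F B P" using adm by (auto simp: admissible_folner_sequence_def)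
  then have ff: "filtered_folner_sequence h F B P" by (simp add: admissible_triple_def)
  have F: "compact (F n)" "0 < haar_size h (F n)" for n
    using ff by (auto simp: filtered_folner_sequence_def folner_sequence_def)
  have sF: "F n \<in> sets h" for n by (rule compact_sets[OF F(1)])
  obtain x0 where x0: "x0 \<in> Adm h F P" using Adm_nonempty[OF tr] by blast
  show ?thesis
  proof
    show "compact (F n)" for n by (rule F)
    show "0 < emeasure h (F n)" for n using F(2)[of n] sF[of n] by simp
    show "compact (sym_union F i)" for i by (rule compact_sym_union[OF F(1)])
    show "0 \<in> sym_union F i" for i by (simp add: sym_union_def)
    show "F n \<subseteq> sym_union F i" "uminus ` F n \<subseteq> sym_union F i" if "n \<le> i" for n i
      using that by (auto simp: sym_union_def)
    show "emeasure h (F n + sym_union F i + sym_union F i + sym_union F i + sym_union F i - F n)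
        \<le> ennreal (2 ^ (i + 3) / 2 ^ n) * emeasure h (F n)" if n: "i + 3 \<le> n" for i n
    proof -
      define V where "V = sym_union F i"
      have cV: "compact V" unfolding V_def by (rule compact_sym_union[OF F(1)])
      obtain A where A: "A \<in> admissible_atoms h F P (i + 3)"
        using x0 by (auto simp: Adm_def)
      have "F n + V + V + V + V - F n \<subseteq> K_boundary (B (i + 3)) (F n)"
      proof
        fix y assume y: "y \<in> F n + V + V + V + V - F n"
        then obtain x s1 s2 s3 s4 where x: "x \<in> F n" "y = x + s1 + s2 + s3 + s4"
          "s1 \<in> V" "s2 \<in> V" "s3 \<in> V" "s4 \<in> V" by (auto elim!: set_plus_elim)
        obtain b b' where b: "b \<in> B (i + 3)" "b' \<in> B (i + 3)" "s1 + s2 + s3 + s4 = - b + b'"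
          using sym_union_words[OF ff A] x(3-6) unfolding V_def by blast
        \<comment> \<open>With \<open>g = x - b\<close> the translate of \<open>B (i + 3)\<close> by
          \<open>g\<close> contains \<open>x\<close>, which lies in \<open>F n\<close>, and
          \<open>y\<close>, which does not.\<close>
        define g where "g = x - b"
        have "y = x + (s1 + s2 + s3 + s4)" using x by (simp add: add.assoc)
        then have "y = g + b'" unfolding b(3) by (simp add: g_def add.assoc[symmetric])
        moreover have "x = g + b" by (simp add: g_def)
        ultimately have "y \<in> g +o B (i + 3)" "x \<in> g +o B (i + 3)" using b by (auto simp: elt_set_plus_def)
        then show "y \<in> K_boundary (B (i + 3)) (F n)"
          unfolding K_boundary_def using x(1) y by blast
      qed
      then have "haar_size h (F n + V + V + V + V - F n) \<le> haar_size h (K_boundary (B (i + 3)) (F n))"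
        by (rule outer_measure_of_mono)
      also have "\<dots> \<le> ennreal (2 powi (int (i + 3) - int n)) * haar_size h (F n)"
        using ff n unfolding filtered_folner_sequence_def boundary_invariant_set_def by blast
      finally have "haar_size h (F n + V + V + V + V - F n) \<le> ennreal (2 ^ (i + 3) / 2 ^ n) * haar_size h (F n)"
        unfolding powi_diff .
      \<comment> \<open>All factors are compact, so the set is Borel and its outer measure is its
        measure.\<close>
      moreover have "F n + V + V + V + V - F n \<in> sets h"
        by (intro sets.Diff compact_sets compact_add F cV)
      ultimately show ?thesis using sF by (simp add: V_def)
    qed
  qed
qed

theorem theorem2p13:
  fixes h :: "'g::{topological_group_add, t2_space, second_countable_topology} measure"
    and F :: "nat \<Rightarrow> 'g set"
    and M :: "'x measure"
    and a :: "'g \<Rightarrow> 'x \<Rightarrow> 'x"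
  assumes "locally compact (UNIV :: 'g set)"
    and "right_haar_measure h"
    and "amenable h"
    and "admissible_folner_sequence h F"
    and "sigma_finite_measure M"
    and "measure_preserving_action M a"
  shows "\<exists>c::real. c > 0 \<and>
    (\<forall>lam::real. \<forall>m::real. \<forall>f::'x \<Rightarrow> complex. lam > 0 \<longrightarrow> m > 0 \<longrightarrow> integrable M f \<longrightarrow>
       emeasure M {x \<in> space M.
           ereal_of_enat (jump_quantity lam (\<lambda>n. ergodic_average h F a n f) x) > ereal m}
         \<le> ennreal (c / (lam * sqrt m) * (\<integral>x. norm (f x) \<partial>M)))"
proof -
  interpret folner_inv h F "sym_union F"
    by (intro folner_inv_of_admissible haar_space_of_locally_compact assms)
  interpret folner_action h F "sym_union F" M a
    by (intro folner_action.intro folner_inv_axioms folner_action_axioms.intro assms)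
  show ?thesis
  proof (intro exI[of _ "64 * 10^18"] conjI allI impI)
    fix lam t :: real and f :: "'x \<Rightarrow> complex"
    assume lam: "lam > 0" and t: "t > 0" and f: "integrable M f"
    have [measurable]: "f \<in> borel_measurable M" using f by auto
    define D where "D L = {x \<in> space M. t < real (jmax lam L (\<lambda>n. orbit_average n f x))}" for L
    have D [measurable]: "D L \<in> sets M" for L unfolding D_def by measurable
    have inc: "incseq D"
    proof (rule incseq_SucI)
      fix L
      have "jmax lam L u \<le> jmax lam (Suc L) u" for u :: "nat \<Rightarrow> complex" by (rule jmax_mono_length) simp
      then show "D L \<subseteq> D (Suc L)"
        unfolding D_def by (auto intro: order_less_le_trans)
    qed
    \<comment> \<open>An inclusion is enough, as \<open>jmax\<close> may count more than
      \<open>jump_quantity\<close> does, and monotonicity asks for measurability of the larger set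
      only. The bound is uniform in \<open>L\<close>, so it passes to the increasing union.\<close>
    have "{x \<in> space M. ereal_of_enat (jump_quantity lam (\<lambda>n. ergodic_average h F a n f) x) > ereal t} \<subseteq> (\<Union>L. D L)"
    proof
      fix x assume "x \<in> {x \<in> space M. ereal_of_enat (jump_quantity lam (\<lambda>n. ergodic_average h F a n f) x) > ereal t}"
      then have x: "x \<in> space M" "ereal t < ereal_of_enat (jump_quantity lam (\<lambda>n. ergodic_average h F a n f) x)" by auto
      obtain L where "t < real (jmax lam L (\<lambda>n. ergodic_average h F a n f x))"
        using jump_quantity_less[OF x(2)] t by auto
      then show "x \<in> (\<Union>L. D L)" using x(1) by (auto simp: D_def ergodic_average_eq_orbit_average)
    qed
    then have "emeasure M {x \<in> space M. ereal_of_enat (jump_quantity lam (\<lambda>n. ergodic_average h F a n f) x) > ereal t}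
        \<le> emeasure M (\<Union>L. D L)" by (rule emeasure_mono) measurable
    also have "\<dots> = (SUP L. emeasure M (D L))"
      using inc D by (intro SUP_emeasure_incseq[symmetric]) auto
    also have "\<dots> \<le> ennreal (64 * 10^18 / (lam * sqrt t) * (\<integral>x. norm (f x) \<partial>M))"
      unfolding D_def by (intro SUP_least weak_type_complex f lam t)
    finally show "emeasure M {x \<in> space M. ereal_of_enat (jump_quantity lam (\<lambda>n. ergodic_average h F a n f) x) > ereal t}
        \<le> ennreal (64 * 10^18 / (lam * sqrt t) * (\<integral>x. norm (f x) \<partial>M))" .
  qed simp
qed

end
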